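(* Let $R\in(0,1]$, $\varepsilon\in(0,1]$, let $A:B_R^+\to\mathbb R^{3\times3}$ be pointwise symmetric with $A\ge\lambda_{\min}>0$ and $A\in\mathcal A^\infty(C_A,\gamma_A,B_R^+)$, and let $f$ satisfy $\|\nabla^pf\|_{L^2(B_R^+)}\le C_f\gamma_f^p\max\{p/R,\varepsilon^{-1}\}^p$ for all $p\in\mathbb N_0$. Let $u$, smooth on $B_R^+\cup\Gamma_R$ with $\nabla u\in L^2(B_R^+)$, satisfy $-\mathrm{div}(A\nabla u)=f$ in $B_R^+$ and $u=0$ on $\Gamma_R$. Then there exist $K_1,K_2\ge1$ depending only on $\lambda_{\min},C_A,\gamma_A,\gamma_f$ such that for all integers $p\ge0$, $q\ge-2$ with $(p,q)\ne(0,-2)$, $$N'_{R,p,q}(u)\le K_1^{p+2}K_2^{q+2}\left[C_fR^2\frac{\max\{p+q+3,R/\varepsilon\}^{p+q}}{[p+q]!}+(p+q+3)R\|\nabla u\|_{L^2(B_R^+)}\right].$$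
   Context: $B_R^+:=\{\mathbf x\in\mathbb R^3:|\mathbf x|<R,\ x_3>0\}$, $\Gamma_R:=\{\mathbf x\in\mathbb R^3:|\mathbf x|<R,\ x_3=0\}$. Write $\mathbf x=(x,y)$ with $x=(x_1,x_2)$, $y=x_3$. For multi-indices, $|\nabla^nv|^2=\sum_{|\alpha|=n}\frac{n!}{\alpha!}|D^\alpha v|^2$ (all three variables) and $|\nabla_x^pv|^2=\sum_{\alpha\in\mathbb N_0^2,|\alpha|=p}\frac{p!}{\alpha!}|D_x^\alpha v|^2$ (tangential variables only). $\mathcal A^\infty(C,\gamma,\omega)$ is the set of (tensor-valued) functions with $\|\nabla^nA\|_{L^\infty(\omega)}\le C\gamma^nn!$ for all $n\in\mathbb N_0$. $[n]:=\max\{1,n\}$ and $[n]!$ means $([n])!$. For $p\ge0$, $q\ge-2$: $N'_{R,p,q}(v):=\frac{1}{[p+q]!}\sup_{R/2\le r<R}(R-r)^{p+q+2}\|\partial_y^{q+2}\nabla_x^pv\|_{L^2(B_r^+)}$. *)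

theory Defs
  imports "HOL-Analysis.Analysis"
begin

text \<open>Points of R^3 are vectors of type real^3; components 1,2 are the tangential
variables x = (x1,x2), component 3 is the normal variable y = x3.\<close>

definition half_ball :: "real \<Rightarrow> (real^3) set" where
  "half_ball R = {z. norm z < R \<and> z $ 3 > 0}"

definition flat_bdry :: "real \<Rightarrow> (real^3) set" where
  "flat_bdry R = {z. norm z < R \<and> z $ 3 = 0}"

definition partial :: "3 \<Rightarrow> (real^3 \<Rightarrow> real) \<Rightarrow> real^3 \<Rightarrow> real" where
  "partial i v z = deriv (\<lambda>t. v (z + t *\<^sub>R axis i 1)) 0"

fun pdiff :: "3 list \<Rightarrow> (real^3 \<Rightarrow> real) \<Rightarrow> real^3 \<Rightarrow> real" where
  "pdiff [] v = v"
| "pdiff (i # is) v = partial i (pdiff is v)"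

definition smooth_on :: "(real^3) set \<Rightarrow> (real^3 \<Rightarrow> real) \<Rightarrow> bool" where
  "smooth_on U v \<longleftrightarrow> (\<forall>ds. continuous_on U (pdiff ds v) \<and>
      (\<forall>z\<in>U. \<forall>i. (\<lambda>t. pdiff ds v (z + t *\<^sub>R axis i 1)) differentiable (at 0)))"

definition mi_list :: "(3 \<Rightarrow> nat) \<Rightarrow> 3 list" where
  "mi_list \<alpha> = replicate (\<alpha> 1) 1 @ replicate (\<alpha> 2) 2 @ replicate (\<alpha> 3) 3"

definition Dmi :: "(3 \<Rightarrow> nat) \<Rightarrow> (real^3 \<Rightarrow> real) \<Rightarrow> real^3 \<Rightarrow> real" where
  "Dmi \<alpha> v = pdiff (mi_list \<alpha>) v"

definition mi_abs :: "(3 \<Rightarrow> nat) \<Rightarrow> nat" where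
  "mi_abs \<alpha> = (\<Sum>i\<in>UNIV. \<alpha> i)"

definition mi_fact :: "(3 \<Rightarrow> nat) \<Rightarrow> nat" where
  "mi_fact \<alpha> = (\<Prod>i\<in>UNIV. fact (\<alpha> i))"

definition grad_norm :: "nat \<Rightarrow> (real^3 \<Rightarrow> real) \<Rightarrow> real^3 \<Rightarrow> real" where
  "grad_norm n v z = sqrt (\<Sum>\<alpha>\<in>{\<alpha>. mi_abs \<alpha> = n}.
      (fact n / real (mi_fact \<alpha>)) * (Dmi \<alpha> v z)\<^sup>2)"

definition tan_grad_norm :: "nat \<Rightarrow> nat \<Rightarrow> (real^3 \<Rightarrow> real) \<Rightarrow> real^3 \<Rightarrow> real" where
  "tan_grad_norm k p v z = sqrt (\<Sum>\<alpha>\<in>{\<alpha>. \<alpha> 3 = 0 \<and> mi_abs \<alpha> = p}.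
      (fact p / real (mi_fact \<alpha>)) * (Dmi (\<alpha>(3 := k)) v z)\<^sup>2)"

definition mgrad_norm :: "nat \<Rightarrow> (real^3 \<Rightarrow> real^3^3) \<Rightarrow> real^3 \<Rightarrow> real" where
  "mgrad_norm n A z = sqrt (\<Sum>\<alpha>\<in>{\<alpha>. mi_abs \<alpha> = n}.
      (fact n / real (mi_fact \<alpha>)) *
        (norm ((\<chi> i j. Dmi \<alpha> (\<lambda>w. A w $ i $ j) z) :: real^3^3))\<^sup>2)"

definition Ainf :: "real \<Rightarrow> real \<Rightarrow> (real^3) set \<Rightarrow> (real^3 \<Rightarrow> real^3^3) \<Rightarrow> bool" where
  "Ainf C \<gamma> \<omega> A \<longleftrightarrow> (\<forall>i j. smooth_on \<omega> (\<lambda>w. A w $ i $ j)) \<and>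
     (\<forall>n. \<forall>z\<in>\<omega>. mgrad_norm n A z \<le> C * \<gamma> ^ n * fact n)"

definition L2norm :: "(real^3) set \<Rightarrow> (real^3 \<Rightarrow> real) \<Rightarrow> ennreal" where
  "L2norm S g = (let I = (\<integral>\<^sup>+ z. indicator S z * ennreal ((g z)\<^sup>2) \<partial>lborel)
                 in if I = \<infinity> then \<infinity> else ennreal (sqrt (enn2real I)))"

definition brk :: "int \<Rightarrow> nat" where
  "brk n = nat (max 1 n)"

definition Nprime :: "real \<Rightarrow> nat \<Rightarrow> int \<Rightarrow> (real^3 \<Rightarrow> real) \<Rightarrow> ennreal" where
  "Nprime R p q v = ennreal (1 / fact (brk (int p + q))) *
     (SUP r\<in>{R/2..<R}. ennreal ((R - r) ^ nat (int p + q + 2)) *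
        L2norm (half_ball r) (tan_grad_norm (nat (q + 2)) p v))"

end

theory Submission
  imports Defs
begin

text \<open>
  A tangential derivative \<open>w = D\<^sup>\<alpha>u\<close> again vanishes on the flat boundary and
  solves \<open>div (A\<nabla>w + G) = 0\<close>, where \<open>G\<close> collects the commutator of
  \<open>D\<^sup>\<alpha>\<close> with \<open>A\<close> and one tangential derivative less of \<open>f\<close>. Testing with \<open>\<eta>\<^sup>2w\<close>
  for a cutoff \<open>\<eta>\<close> gives a Caccioppoli inequality, which bounds \<open>\<nabla>D\<^sup>\<alpha>u\<close> on a half ball
  by lower derivatives on a half ball larger by \<open>(R - r)/(|\<alpha>| + 1)\<close>; since \<open>u\<close> is smooth, no
  difference quotients are needed. Iterating this controls all derivatives with at most one normal
  direction. The equation expresses \<open>\<partial>\<^sub>y\<^sup>2u\<close> through \<open>f\<close>, second derivatives with fewer normal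
  directions and first derivatives; differentiating it yields the remaining derivatives by induction
  on the order and on the number of normal directions, with weight \<open>K\<^sub>1\<close> per tangential and
  \<open>K\<^sub>2 \<ge> K\<^sub>1\<close> per normal direction. Both inductions close because the majorant
  \<open>S\<^sub>m = C\<^sub>f R max(m, R/\<epsilon>)\<^bsup>m-1\<^esup> + m! \<parallel>\<nabla>u\<parallel>\<close> satisfies \<open>m!/(m-k)! S\<^sub>m\<^sub>-\<^sub>k \<le> S\<^sub>m\<close>.
\<close>

section \<open>Iterated partial derivatives\<close>

text \<open>All estimates live on half balls of radius \<open>r < R\<close>, where every derivative
  is bounded; on the full half ball only the norms of \<open>f\<close> and of the gradient of
  \<open>u\<close> are available, since \<open>u\<close> may degenerate at the round boundary. The
  weight is a power of \<open>R - r\<close>. The particular enlargement of the radius is a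
  compromise: the n-th power of the weight loses at most a factor e for every order n, while the
  quotient in the Caccioppoli inequality costs a factor of order n, which the majorant absorbs.
  Normal derivatives come from an identity that holds pointwise, so their induction keeps
  \<open>r\<close> fixed and gains from the weights instead. A second derivative with at most one
  normal direction weighs \<open>K1 * K2\<close> at most, against \<open>K2 * K2\<close>, and is
  small once \<open>K2\<close> is large compared with \<open>K1\<close>. A commutator is small for
  large \<open>K1\<close>, because a derivative that falls on \<open>A\<close> is missing on
  \<open>u\<close>. The exponent m - 1 in the majorant reflects that derivatives of \<open>u\<close>
  of order m + 1 meet derivatives of \<open>f\<close> of order m - 1.\<close>

lemma DERIV_line_shift:
  fixes v :: "real^3 \<Rightarrow> real"
  assumes "((\<lambda>t. v (z + x *\<^sub>R e + t *\<^sub>R e)) has_real_derivative D) (at 0)"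
  shows "((\<lambda>t. v (z + t *\<^sub>R e)) has_real_derivative D) (at x)"
proof -
  have "(\<lambda>t. v (z + x *\<^sub>R e + t *\<^sub>R e)) = (\<lambda>t. v (z + (t + x) *\<^sub>R e))"
    by (simp add: algebra_simps)
  with assms show ?thesis
    using DERIV_shift[of "\<lambda>t. v (z + t *\<^sub>R e)" D 0 x] by simp
qed

lemma eventually_line_in_open:
  fixes z e :: "real^3"
  assumes "open U" "z \<in> U"
  shows "\<forall>\<^sub>F t in nhds (0::real). z + t *\<^sub>R e \<in> U"
proof -
  have "((\<lambda>t. z + t *\<^sub>R e) \<longlongrightarrow> z) (nhds (0::real))"
    using isCont_def continuous_on_eq_continuous_at
    by (auto intro!: tendsto_eq_intros filterlim_ident)
  then show ?thesis using assms topological_tendstoD by blast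
qed

lemma DERIV_line_cong:
  fixes v v' :: "real^3 \<Rightarrow> real"
  assumes "open U" "z \<in> U" "\<And>w. w \<in> U \<Longrightarrow> v w = v' w"
  shows "((\<lambda>t. v (z + t *\<^sub>R e)) has_real_derivative D) (at 0) \<longleftrightarrow>
         ((\<lambda>t. v' (z + t *\<^sub>R e)) has_real_derivative D) (at 0)"
  by (rule DERIV_cong_ev) (use eventually_line_in_open[OF assms(1,2), of e] assms in \<open>auto elim: eventually_mono\<close>)

text \<open>\<open>partial\<close> is defined through \<open>deriv\<close>, which means nothing
  without differentiability; under \<open>smooth_on\<close> it becomes a true derivative along a
  line. Many later steps keep the simplifier from unfolding \<open>pdiff (i # ds)\<close> so that
  this rule still applies.\<close>

lemma smooth_on_DERIV:
  assumes "smooth_on U v" "z \<in> U"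
  shows "((\<lambda>t. pdiff ds v (z + t *\<^sub>R axis i 1)) has_real_derivative pdiff (i # ds) v z) (at 0)"
  using assms unfolding smooth_on_def
  by (auto simp: partial_def DERIV_deriv_iff_real_differentiable)

lemma smooth_on_continuous: "smooth_on U v \<Longrightarrow> continuous_on U (pdiff ds v)"
  by (auto simp: smooth_on_def)

lemma pdiff_append: "pdiff (a @ b) v = pdiff a (pdiff b v)"
  by (induction a) auto

lemma smooth_on_pdiff: "smooth_on U v \<Longrightarrow> smooth_on U (pdiff ds v)"
  by (auto simp: smooth_on_def simp flip: pdiff_append)

text \<open>A family closed under differentiation must be the family of iterated partial derivatives.
Smoothness and the rules for sums and products are read off from this.\<close>

lemma smooth_on_family:
  assumes U: "open U"
    and base: "\<And>z. z \<in> U \<Longrightarrow> P [] z = v z"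
    and cont: "\<And>ds. continuous_on U (P ds)"
    and der: "\<And>ds i z. z \<in> U \<Longrightarrow>
      ((\<lambda>t. P ds (z + t *\<^sub>R axis i 1)) has_real_derivative P (i # ds) z) (at 0)"
  shows pdiff_family: "z \<in> U \<Longrightarrow> pdiff ds v z = P ds z"
    and smooth_on_familyI: "smooth_on U v"
proof -
  have eq: "pdiff ds v z = P ds z" if "z \<in> U" for ds z
    using that
  proof (induction ds arbitrary: z)
    case (Cons i ds)
    have "((\<lambda>t. pdiff ds v (z + t *\<^sub>R axis i 1)) has_real_derivative P (i # ds) z) (at 0)"
      using DERIV_line_cong[OF U Cons.prems, of "pdiff ds v" "P ds"] Cons der by blast
    then show ?case by (simp add: partial_def DERIV_imp_deriv)
  qed (simp add: base)
  then show "z \<in> U \<Longrightarrow> pdiff ds v z = P ds z" by blast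
  show "smooth_on U v"
    unfolding smooth_on_def
  proof (intro allI conjI ballI)
    show "continuous_on U (pdiff ds v)" for ds
      using cont eq by (metis continuous_on_cong)
    fix ds z i assume z: "z \<in> U"
    have "((\<lambda>t. pdiff ds v (z + t *\<^sub>R axis i 1)) has_real_derivative P (i # ds) z) (at 0)"
      using DERIV_line_cong[OF U z, of "pdiff ds v" "P ds"] eq der z by blast
    then show "(\<lambda>t. pdiff ds v (z + t *\<^sub>R axis i 1)) differentiable at 0"
      using real_differentiable_def by blast
  qed
qed

lemma smooth_on_cong:
  assumes "open U" "smooth_on U v" "\<And>z. z \<in> U \<Longrightarrow> v z = v' z"
  shows "smooth_on U v'"
  by (rule smooth_on_familyI[where P = "\<lambda>ds. pdiff ds v"])
     (use assms in \<open>simp_all add: smooth_on_continuous smooth_on_DERIV del: pdiff.simps(2)\<close>)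

lemma pdiff_cong:
  assumes "open U" "smooth_on U v" "\<And>z. z \<in> U \<Longrightarrow> v z = v' z" "z \<in> U"
  shows "pdiff ds v' z = pdiff ds v z"
  by (rule pdiff_family[where P = "\<lambda>ds. pdiff ds v"])
     (use assms in \<open>simp_all add: smooth_on_continuous smooth_on_DERIV del: pdiff.simps(2)\<close>)

lemma
  assumes U: "open U" and sm: "\<And>k. k \<in> I \<Longrightarrow> smooth_on U (v k)"
  shows pdiff_sum: "z \<in> U \<Longrightarrow> pdiff ds (\<lambda>w. \<Sum>k\<in>I. v k w) z = (\<Sum>k\<in>I. pdiff ds (v k) z)"
    and smooth_on_sum: "smooth_on U (\<lambda>w. \<Sum>k\<in>I. v k w)"
proof -
  have "((\<lambda>t. \<Sum>k\<in>I. pdiff ds (v k) (z + t *\<^sub>R axis i 1)) has_real_derivative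
      (\<Sum>k\<in>I. pdiff (i # ds) (v k) z)) (at 0)" if "z \<in> U" for ds i z
    using that sm by (intro DERIV_sum smooth_on_DERIV) 
  moreover have "continuous_on U (\<lambda>z. \<Sum>k\<in>I. pdiff ds (v k) z)" for ds
    using sm by (intro continuous_on_sum smooth_on_continuous)
  ultimately show "z \<in> U \<Longrightarrow> pdiff ds (\<lambda>w. \<Sum>k\<in>I. v k w) z = (\<Sum>k\<in>I. pdiff ds (v k) z)"
    "smooth_on U (\<lambda>w. \<Sum>k\<in>I. v k w)"
    using smooth_on_family[OF U, of "\<lambda>ds z. \<Sum>k\<in>I. pdiff ds (v k) z" "\<lambda>w. \<Sum>k\<in>I. v k w"] by simp_all
qed

lemma
  assumes U: "open U" and sm: "smooth_on U v"
  shows pdiff_uminus: "z \<in> U \<Longrightarrow> pdiff ds (\<lambda>w. - v w) z = - pdiff ds v z"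
    and smooth_on_uminus: "smooth_on U (\<lambda>w. - v w)"
proof -
  have "((\<lambda>t. - pdiff ds v (z + t *\<^sub>R axis i 1)) has_real_derivative
      - pdiff (i # ds) v z) (at 0)" if "z \<in> U" for ds i z
    using that sm by (intro DERIV_minus smooth_on_DERIV) 
  moreover have "continuous_on U (\<lambda>z. - pdiff ds v z)" for ds
    using sm by (intro continuous_on_minus smooth_on_continuous)
  ultimately show "z \<in> U \<Longrightarrow> pdiff ds (\<lambda>w. - v w) z = - pdiff ds v z"
    "smooth_on U (\<lambda>w. - v w)"
    using smooth_on_family[OF U, of "\<lambda>ds z. - pdiff ds v z" "\<lambda>w. - v w"] by simp_all
qed

text \<open>The sum of \<open>F a b\<close> over all ways to split \<open>ds\<close> into a subsequence \<open>a\<close> and the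
complementary subsequence \<open>b\<close>.\<close>

fun leib :: "'a list \<Rightarrow> ('a list \<Rightarrow> 'a list \<Rightarrow> real) \<Rightarrow> real" where
  "leib [] F = F [] []"
| "leib (d # ds) F = leib ds (\<lambda>a b. F (d # a) b) + leib ds (\<lambda>a b. F a (d # b))"

text \<open>The multiset equation is all that later estimates need to know about a split: it
  determines the length of \<open>b\<close>, the directions that can occur in it, and its
  weight.\<close>

lemma leib_mono:
  assumes "\<And>a b. mset a + mset b = mset ds \<Longrightarrow> F a b \<le> G a b"
  shows "leib ds F \<le> leib ds G"
  using assms
proof (induction ds arbitrary: F G)
  case (Cons d ds)
  have "leib ds (\<lambda>a b. F (d # a) b) \<le> leib ds (\<lambda>a b. G (d # a) b)"
    "leib ds (\<lambda>a b. F a (d # b)) \<le> leib ds (\<lambda>a b. G a (d # b))"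
    by (intro Cons; simp)+
  then show ?case by simp
qed simp

lemma leib_add: "leib ds (\<lambda>a b. F a b + G a b) = leib ds F + leib ds G"
  by (induction ds arbitrary: F G) simp_all

lemma leib_cmult: "leib ds (\<lambda>a b. c * F a b) = c * leib ds F"
  by (induction ds arbitrary: F) (simp_all add: algebra_simps)

text \<open>Isolates the term in which no derivative falls on the first factor. For products with
  entries of \<open>A\<close> this is the principal part, and the remainder is the
  commutator.\<close>

lemma leib_split: "leib ds F = F [] ds + leib ds (\<lambda>a b. if a = [] then 0 else F a b)"
proof (induction ds arbitrary: F)
  case (Cons d ds)
  have "leib ds (\<lambda>a b. F a (d # b)) = F [] (d # ds) + leib ds (\<lambda>a b. if a = [] then 0 else F a (d # b))"
    by (rule Cons)
  then show ?case by simp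
qed simp

text \<open>Pascal's rule mirrors the recursion of \<open>leib\<close>: the head of the list joins
  either the first part, which shifts the index of \<open>\<phi>\<close>, or the second.\<close>

lemma leib_length: "leib ds (\<lambda>a b. \<phi> (length a)) = (\<Sum>k\<le>length ds. real (length ds choose k) * \<phi> k)"
proof (induction ds arbitrary: \<phi>)
  case (Cons d ds)
  let ?n = "length ds"
  have "(\<Sum>k\<le>Suc ?n. real (Suc ?n choose k) * \<phi> k)
      = \<phi> 0 + (\<Sum>k\<le>?n. real (Suc ?n choose Suc k) * \<phi> (Suc k))"
    by (subst sum.atMost_Suc_shift) simp
  also have "\<dots> = (\<Sum>k\<le>?n. real (?n choose k) * \<phi> (Suc k)) +
       (\<phi> 0 + (\<Sum>k\<le>?n. real (?n choose Suc k) * \<phi> (Suc k)))"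
    by (simp add: algebra_simps sum.distrib)
  also have "\<phi> 0 + (\<Sum>k\<le>?n. real (?n choose Suc k) * \<phi> (Suc k))
      = (\<Sum>k\<le>Suc ?n. real (?n choose k) * \<phi> k)"
    by (subst sum.atMost_Suc_shift) simp
  finally show ?case using Cons[of "\<lambda>k. \<phi> (Suc k)"] Cons[of \<phi>] by simp
qed simp

lemma DERIV_leib:
  assumes "\<And>a b. ((\<lambda>t. F a b t) has_real_derivative F' a b) (at x)"
  shows "((\<lambda>t. leib ds (\<lambda>a b. F a b t)) has_real_derivative leib ds F') (at x)"
  using assms by (induction ds arbitrary: F F') (auto intro!: DERIV_add)

lemma continuous_on_leib:
  assumes "\<And>a b. continuous_on U (F a b)"
  shows "continuous_on U (\<lambda>z. leib ds (\<lambda>a b. F a b z))"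
  using assms by (induction ds arbitrary: F) (auto intro!: continuous_on_add)

text \<open>The product rule turns each term into two, with the new direction in front of one of the
  two parts. These are exactly the terms of \<open>leib (i # ds)\<close>, so the family is closed
  under differentiation.\<close>

lemma
  assumes U: "open U" and f: "smooth_on U f" and g: "smooth_on U g"
  shows pdiff_mult: "z \<in> U \<Longrightarrow>
      pdiff ds (\<lambda>w. f w * g w) z = leib ds (\<lambda>a b. pdiff a f z * pdiff b g z)"
    and smooth_on_mult: "smooth_on U (\<lambda>w. f w * g w)"
proof -
  have der: "((\<lambda>t. leib ds (\<lambda>a b. pdiff a f (z + t *\<^sub>R axis i 1) * pdiff b g (z + t *\<^sub>R axis i 1)))
      has_real_derivative leib (i # ds) (\<lambda>a b. pdiff a f z * pdiff b g z)) (at 0)"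
    if "z \<in> U" for ds i z
  proof -
    have "((\<lambda>t. leib ds (\<lambda>a b. pdiff a f (z + t *\<^sub>R axis i 1) * pdiff b g (z + t *\<^sub>R axis i 1)))
      has_real_derivative leib ds (\<lambda>a b. pdiff (i # a) f z * pdiff b g z + pdiff a f z * pdiff (i # b) g z)) (at 0)"
      using DERIV_mult[OF smooth_on_DERIV[OF f that] smooth_on_DERIV[OF g that]]
      by (intro DERIV_leib) (simp add: mult.commute)
    then show ?thesis by (simp only: leib.simps leib_add)
  qed
  have cont: "continuous_on U (\<lambda>z. leib ds (\<lambda>a b. pdiff a f z * pdiff b g z))" for ds
    using f g by (intro continuous_on_leib continuous_on_mult smooth_on_continuous)
  show "z \<in> U \<Longrightarrow> pdiff ds (\<lambda>w. f w * g w) z = leib ds (\<lambda>a b. pdiff a f z * pdiff b g z)"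
    by (rule pdiff_family[OF U]) (use der cont in \<open>simp_all del: leib.simps(2)\<close>)
  show "smooth_on U (\<lambda>w. f w * g w)"
    by (rule smooth_on_familyI[OF U, where P = "\<lambda>ds z. leib ds (\<lambda>a b. pdiff a f z * pdiff b g z)"])
       (use der cont in \<open>simp_all del: leib.simps(2)\<close>)
qed

section \<open>Symmetry of mixed partial derivatives\<close>

lemma second_difference:
  assumes sm: "smooth_on U v" and s: "0 < s"
    and sub: "\<And>x y. \<lbrakk>0 \<le> x; x \<le> s; 0 \<le> y; y \<le> s\<rbrakk> \<Longrightarrow> z + x *\<^sub>R axis i 1 + y *\<^sub>R axis j 1 \<in> U"
  shows "\<exists>x y. 0 < x \<and> x < s \<and> 0 < y \<and> y < s \<and>
    v (z + s *\<^sub>R axis i 1 + s *\<^sub>R axis j 1) - v (z + s *\<^sub>R axis i 1) - v (z + s *\<^sub>R axis j 1) + v z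
     = s * s * pdiff [j, i] v (z + x *\<^sub>R axis i 1 + y *\<^sub>R axis j 1)"
proof -
  let ?i = "axis i 1 :: real^3" and ?j = "axis j 1 :: real^3"
  have d1: "((\<lambda>x. v (z + y *\<^sub>R ?j + x *\<^sub>R ?i)) has_real_derivative
      pdiff [i] v (z + y *\<^sub>R ?j + x *\<^sub>R ?i)) (at x)"
    if "0 \<le> x" "x \<le> s" "0 \<le> y" "y \<le> s" for x y
    using smooth_on_DERIV[OF sm sub[OF that], of "[]" i]
    by (intro DERIV_line_shift[of v "z + y *\<^sub>R ?j" x ?i]) (simp add: add_ac)
  \<comment> \<open>The mean value theorem is applied in direction \<open>i\<close> to the increment
    of \<open>v\<close> over the step \<open>s\<close> in direction \<open>j\<close>, and afterwards
    in direction \<open>j\<close> to the first derivative.\<close>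
  have "\<exists>x. 0 < x \<and> x < s \<and>
     (v (z + s *\<^sub>R ?j + s *\<^sub>R ?i) - v (z + 0 *\<^sub>R ?j + s *\<^sub>R ?i))
     - (v (z + s *\<^sub>R ?j + 0 *\<^sub>R ?i) - v (z + 0 *\<^sub>R ?j + 0 *\<^sub>R ?i))
     = (s - 0) * (pdiff [i] v (z + s *\<^sub>R ?j + x *\<^sub>R ?i) - pdiff [i] v (z + 0 *\<^sub>R ?j + x *\<^sub>R ?i))"
    by (rule MVT2[OF s], rule DERIV_diff; rule d1) (use s in simp_all)
  then obtain x where x: "0 < x" "x < s" and
    ex: "v (z + s *\<^sub>R ?j + s *\<^sub>R ?i) - v (z + s *\<^sub>R ?i) - v (z + s *\<^sub>R ?j) + v z
     = s * (pdiff [i] v (z + s *\<^sub>R ?j + x *\<^sub>R ?i) - pdiff [i] v (z + x *\<^sub>R ?i))"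
    by (auto simp: add_ac diff_diff_eq2 diff_diff_eq diff_add_eq simp del: pdiff.simps)
  have d2: "((\<lambda>y. pdiff [i] v (z + x *\<^sub>R ?i + y *\<^sub>R ?j)) has_real_derivative
      pdiff [j, i] v (z + x *\<^sub>R ?i + y *\<^sub>R ?j)) (at y)" if "0 \<le> y" "y \<le> s" for y
    by (rule DERIV_line_shift, rule smooth_on_DERIV[OF sm sub]) (use x that in simp_all)
  have "\<exists>y. 0 < y \<and> y < s \<and>
     pdiff [i] v (z + x *\<^sub>R ?i + s *\<^sub>R ?j) - pdiff [i] v (z + x *\<^sub>R ?i + 0 *\<^sub>R ?j)
     = (s - 0) * pdiff [j, i] v (z + x *\<^sub>R ?i + y *\<^sub>R ?j)"
    by (rule MVT2[OF s], rule d2) (use s in simp_all)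
  then obtain y where y: "0 < y" "y < s" and
    ey: "pdiff [i] v (z + s *\<^sub>R ?j + x *\<^sub>R ?i) - pdiff [i] v (z + x *\<^sub>R ?i)
     = s * pdiff [j, i] v (z + x *\<^sub>R ?i + y *\<^sub>R ?j)"
    by (auto simp: add_ac simp del: pdiff.simps)
  have "v (z + s *\<^sub>R ?i + s *\<^sub>R ?j) - v (z + s *\<^sub>R ?i) - v (z + s *\<^sub>R ?j) + v z
     = s * s * pdiff [j, i] v (z + x *\<^sub>R ?i + y *\<^sub>R ?j)"
    using ex[unfolded ey] by (simp add: add_ac mult.assoc del: pdiff.simps)
  then show ?thesis using x y by blast
qed

text \<open>The second difference over a square is symmetric in \<open>i\<close> and
  \<open>j\<close>, and it is \<open>s * s\<close> times a value of either mixed derivative inside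
  the square. By continuity, different values at \<open>z\<close> would keep the two derivatives
  apart on a small square.\<close>

lemma pdiff_swap_aux:
  assumes U: "open U" and sm: "smooth_on U v" and z: "z \<in> U"
  shows "pdiff [i, j] v z = pdiff [j, i] v z"
proof (rule ccontr)
  assume ne: "pdiff [i, j] v z \<noteq> pdiff [j, i] v z"
  define e where "e = \<bar>pdiff [i, j] v z - pdiff [j, i] v z\<bar> / 2"
  have e: "e > 0" using ne by (simp add: e_def)
  have "isCont (pdiff ds v) z" for ds
    using U z smooth_on_continuous[OF sm] by (simp add: continuous_on_eq_continuous_at)
  then have "\<forall>\<^sub>F w in nhds z. w \<in> U \<and> dist (pdiff [i,j] v w) (pdiff [i,j] v z) < e
      \<and> dist (pdiff [j,i] v w) (pdiff [j,i] v z) < e"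
    using U z e unfolding continuous_at tendsto_at_iff_tendsto_nhds
    by (intro eventually_conj eventually_nhds_in_open tendstoD)
  then obtain d where d: "d > 0" and
    near: "\<And>w. dist w z < d \<Longrightarrow> w \<in> U \<and> dist (pdiff [i,j] v w) (pdiff [i,j] v z) < e
      \<and> dist (pdiff [j,i] v w) (pdiff [j,i] v z) < e"
    unfolding eventually_nhds_metric by blast
  \<comment> \<open>Points of the square of side \<open>s\<close> are within
    \<open>2 * s < d\<close> of its corner \<open>z\<close>.\<close>
  define s where "s = d / 3"
  have s: "s > 0" using d by (simp add: s_def)
  have dz: "dist (z + x *\<^sub>R axis k 1 + y *\<^sub>R axis l 1) z < d"
    if "0 \<le> x" "x \<le> s" "0 \<le> y" "y \<le> s" for x y k l
  proof -
    have "norm (x *\<^sub>R axis k 1 + y *\<^sub>R axis l 1 :: real^3) \<le> x + y"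
      using that norm_triangle_ineq[of "x *\<^sub>R axis k 1 :: real^3" "y *\<^sub>R axis l 1"] by (simp add: norm_axis_1)
    also have "\<dots> < d" using that d by (simp add: s_def)
    finally show ?thesis by (simp add: dist_norm)
  qed
  obtain x y where xy: "0 < x" "x < s" "0 < y" "y < s"
    and 1: "v (z + s *\<^sub>R axis i 1 + s *\<^sub>R axis j 1) - v (z + s *\<^sub>R axis i 1) - v (z + s *\<^sub>R axis j 1) + v z
     = s * s * pdiff [j, i] v (z + x *\<^sub>R axis i 1 + y *\<^sub>R axis j 1)"
    using second_difference[OF sm s, of z i j] near dz by blast
  obtain x' y' where xy': "0 < x'" "x' < s" "0 < y'" "y' < s"
    and 2: "v (z + s *\<^sub>R axis j 1 + s *\<^sub>R axis i 1) - v (z + s *\<^sub>R axis j 1) - v (z + s *\<^sub>R axis i 1) + v z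
     = s * s * pdiff [i, j] v (z + x' *\<^sub>R axis j 1 + y' *\<^sub>R axis i 1)"
    using second_difference[OF sm s, of z j i] near dz by blast
  have "s * s * pdiff [j, i] v (z + x *\<^sub>R axis i 1 + y *\<^sub>R axis j 1)
      = s * s * pdiff [i, j] v (z + x' *\<^sub>R axis j 1 + y' *\<^sub>R axis i 1)"
    using 1 2 by (simp add: algebra_simps del: pdiff.simps)
  then have "pdiff [j, i] v (z + x *\<^sub>R axis i 1 + y *\<^sub>R axis j 1)
      = pdiff [i, j] v (z + x' *\<^sub>R axis j 1 + y' *\<^sub>R axis i 1)" using s by simp
  moreover have "dist (pdiff [j,i] v (z + x *\<^sub>R axis i 1 + y *\<^sub>R axis j 1)) (pdiff [j,i] v z) < e"
    "dist (pdiff [i,j] v (z + x' *\<^sub>R axis j 1 + y' *\<^sub>R axis i 1)) (pdiff [i,j] v z) < e"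
    using near dz xy xy' by (simp_all del: pdiff.simps)
  ultimately show False unfolding e_def dist_real_def by argo
qed

lemma pdiff_swap:
  assumes "open U" "smooth_on U v" "z \<in> U"
  shows "pdiff (i # j # ds) v z = pdiff (j # i # ds) v z"
  using pdiff_swap_aux[OF assms(1) smooth_on_pdiff[OF assms(2), of ds] assms(3), of i j] by simp

lemma pdiff_Cons_cong:
  assumes "open U" "z \<in> U" "\<And>w. w \<in> U \<Longrightarrow> pdiff a v w = pdiff b v w"
  shows "pdiff (i # a) v z = pdiff (i # b) v z"
proof -
  have "deriv (\<lambda>t. pdiff a v (z + t *\<^sub>R axis i 1)) 0 = deriv (\<lambda>t. pdiff b v (z + t *\<^sub>R axis i 1)) 0"
    using eventually_line_in_open[OF assms(1,2), of "axis i 1"] assms(3)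
    by (intro deriv_cong_ev) (auto elim: eventually_mono)
  then show ?thesis by (simp add: partial_def)
qed

lemma pdiff_move_front:
  assumes U: "open U" and sm: "smooth_on U v" and "x \<in> set ds" "z \<in> U"
  shows "pdiff ds v z = pdiff (x # remove1 x ds) v z"
  using assms(3,4)
proof (induction ds arbitrary: z)
  case (Cons d ds)
  show ?case
  proof (cases "x = d")
    case False
    then have "pdiff (d # ds) v z = pdiff (d # x # remove1 x ds) v z"
      using Cons by (intro pdiff_Cons_cong[OF U]) auto
    then show ?thesis using False pdiff_swap[OF U sm Cons.prems(2)] by simp
  qed simp
qed simp

text \<open>Multi-indices appear in the norms, but lists are easier to extend and to split. As the
  order is irrelevant, the two encodings can be exchanged, and a direction can be moved to whichever
  end suits an induction.\<close>

lemma pdiff_mset: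
  assumes U: "open U" and sm: "smooth_on U v" and "mset a = mset b" "z \<in> U"
  shows "pdiff a v z = pdiff b v z"
  using assms(3,4)
proof (induction a arbitrary: b z)
  case (Cons x a)
  have x: "x \<in> set b" using Cons.prems(1) by (metis list.set_intros(1) mset_eq_setD)
  have "mset a = mset (remove1 x b)" using Cons.prems(1) by (metis mset_remove1 add_mset_remove_trivial mset.simps(2))
  then have "pdiff (x # a) v z = pdiff (x # remove1 x b) v z"
    using Cons by (intro pdiff_Cons_cong[OF U]) auto
  then show ?case using pdiff_move_front[OF U sm x Cons.prems(2)] by simp
qed simp

section \<open>The \<open>L\<^sup>2\<close> norm of bounded continuous functions\<close>

text \<open>A real-valued counterpart of \<open>L2norm\<close>, so that the estimates are real
  arithmetic. The Bochner integral is 0 for non-integrable functions, hence this behaves like a norm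
  only together with \<open>adm\<close>.\<close>

definition l2 :: "(real^3) set \<Rightarrow> (real^3 \<Rightarrow> real) \<Rightarrow> real" where
  "l2 S g = sqrt (\<integral>z. indicator S z * (g z)\<^sup>2 \<partial>lborel)"

text \<open>A class closed under sums, products and \<open>leib\<close> whose members are square
  integrable on bounded open sets. On each smaller half ball it contains all derivatives of
  \<open>u\<close>, \<open>f\<close> and the entries of \<open>A\<close>, which settles every
  integrability question at once.\<close>

definition adm :: "(real^3) set \<Rightarrow> (real^3 \<Rightarrow> real) \<Rightarrow> bool" where
  "adm S g \<longleftrightarrow> continuous_on S g \<and> (\<exists>B. \<forall>z\<in>S. \<bar>g z\<bar> \<le> B)"

lemma adm_bounded:
  assumes "adm S g" obtains B where "0 \<le> B" "\<And>z. z \<in> S \<Longrightarrow> \<bar>g z\<bar> \<le> B"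
proof -
  obtain B where B: "\<forall>z\<in>S. \<bar>g z\<bar> \<le> B" using assms by (auto simp: adm_def)
  show ?thesis by (rule that[of "max 0 B"]) (use B in \<open>auto intro: order_trans[OF _ max.cobounded2]\<close>)
qed

lemma adm_subset: "adm S g \<Longrightarrow> T \<subseteq> S \<Longrightarrow> adm T g"
  unfolding adm_def by (meson continuous_on_subset subsetD)

lemma adm_cong: "(\<And>z. z \<in> S \<Longrightarrow> f z = g z) \<Longrightarrow> adm S f \<longleftrightarrow> adm S g"
  unfolding adm_def by (simp cong: continuous_on_cong)

lemma adm_const: "adm S (\<lambda>_. c)"
  by (auto simp: adm_def)

lemma adm_uminus: "adm S f \<Longrightarrow> adm S (\<lambda>z. - f z)"
  by (auto simp: adm_def intro: continuous_on_minus)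

lemma adm_add:
  assumes "adm S f" "adm S g" shows "adm S (\<lambda>z. f z + g z)"
proof -
  obtain B where B: "\<And>z. z \<in> S \<Longrightarrow> \<bar>f z\<bar> \<le> B" using adm_bounded[OF assms(1)] by metis
  obtain C where C: "\<And>z. z \<in> S \<Longrightarrow> \<bar>g z\<bar> \<le> C" using adm_bounded[OF assms(2)] by metis
  have "\<bar>f z + g z\<bar> \<le> B + C" if "z \<in> S" for z using B[OF that] C[OF that] by linarith
  then show ?thesis using assms unfolding adm_def by (blast intro: continuous_on_add)
qed

lemma adm_mult:
  assumes "adm S f" "adm S g" shows "adm S (\<lambda>z. f z * g z)"
proof -
  obtain B where B: "0 \<le> B" "\<And>z. z \<in> S \<Longrightarrow> \<bar>f z\<bar> \<le> B" using adm_bounded[OF assms(1)] by metis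
  obtain C where C: "\<And>z. z \<in> S \<Longrightarrow> \<bar>g z\<bar> \<le> C" using adm_bounded[OF assms(2)] by metis
  have "\<bar>f z * g z\<bar> \<le> B * C" if "z \<in> S" for z
    using B(1) B(2)[OF that] C[OF that] by (auto simp: abs_mult intro: mult_mono)
  then show ?thesis using assms unfolding adm_def by (blast intro: continuous_on_mult)
qed

lemma adm_power: "adm S f \<Longrightarrow> adm S (\<lambda>z. f z ^ n)"
  by (induction n) (auto intro: adm_const adm_mult)

lemma adm_sum: "(\<And>k. k \<in> I \<Longrightarrow> adm S (f k)) \<Longrightarrow> adm S (\<lambda>z. \<Sum>k\<in>I. f k z)"
  by (induction I rule: infinite_finite_induct) (auto intro: adm_const adm_add)

lemma adm_leib: "(\<And>a b. adm S (F a b)) \<Longrightarrow> adm S (\<lambda>z. leib ds (\<lambda>a b. F a b z))"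
  by (induction ds arbitrary: F) (auto intro: adm_add)

lemmas adm_intros = adm_const adm_uminus adm_add adm_mult adm_power adm_sum adm_leib

lemma adm_measurable:
  assumes "open S" "adm S g"
  shows "(\<lambda>z. indicator S z * g z) \<in> borel_measurable lborel"
  using borel_measurable_continuous_on_indicator[of S g] assms by (simp add: adm_def)

lemma adm_integrable:
  assumes "open S" "bounded S" "adm S g"
  shows "integrable lborel (\<lambda>z. indicator S z * g z)"
proof -
  obtain B where B: "\<And>z. z \<in> S \<Longrightarrow> \<bar>g z\<bar> \<le> B" using adm_bounded[OF assms(3)] by metis
  show ?thesis
    by (rule integrableI_bounded_set[where A = S and B = B])
      (use assms adm_measurable[OF assms(1,3)] B emeasure_bounded_finite[OF assms(2)] in auto)
qed

lemma integral_adm_mono: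
  assumes S: "open S" "bounded S" and "adm S f" "adm S g" "\<And>z. z \<in> S \<Longrightarrow> f z \<le> g z"
  shows "(\<integral>z. indicator S z * f z \<partial>lborel) \<le> (\<integral>z. indicator S z * g z \<partial>lborel)"
  using assms by (intro integral_mono adm_integrable) (auto simp: indicator_def)

lemma l2_nonneg: "0 \<le> l2 S g"
  by (simp add: l2_def)

lemma l2_square: "(l2 S g)\<^sup>2 = (\<integral>z. indicator S z * (g z)\<^sup>2 \<partial>lborel)"
  by (simp add: l2_def)

lemma l2_cong: "(\<And>z. z \<in> S \<Longrightarrow> f z = g z) \<Longrightarrow> l2 S f = l2 S g"
  unfolding l2_def by (intro arg_cong[where f = sqrt] Bochner_Integration.integral_cong)
    (auto simp: indicator_def)

lemma l2_mono_abs: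
  assumes "open S" "bounded S" "adm S f" "adm S g" "\<And>z. z \<in> S \<Longrightarrow> \<bar>f z\<bar> \<le> \<bar>g z\<bar>"
  shows "l2 S f \<le> l2 S g"
  unfolding l2_def
  by (intro real_sqrt_le_mono integral_adm_mono) (use assms in \<open>auto intro: adm_intros simp: abs_le_square_iff\<close>)

lemma l2_cmult: "l2 S (\<lambda>z. c * g z) = \<bar>c\<bar> * l2 S g"
proof -
  have "(\<lambda>z. indicator S z * (c * g z)\<^sup>2) = (\<lambda>z. c\<^sup>2 * (indicator S z * (g z)\<^sup>2))"
    by (auto simp: power_mult_distrib)
  then show ?thesis by (simp add: l2_def real_sqrt_mult)
qed

lemma l2_mult_le:
  assumes "open S" "bounded S" "adm S c" "adm S g" "\<And>z. z \<in> S \<Longrightarrow> \<bar>c z\<bar> \<le> C" "0 \<le> C"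
  shows "l2 S (\<lambda>z. c z * g z) \<le> C * l2 S g"
proof -
  have "l2 S (\<lambda>z. c z * g z) \<le> l2 S (\<lambda>z. C * g z)"
    using assms by (intro l2_mono_abs adm_intros) (auto simp: abs_mult intro!: mult_right_mono)
  then show ?thesis using assms by (simp add: l2_cmult)
qed

lemma l2_subset:
  assumes "open S" "bounded S" "open T" "T \<subseteq> S" "adm S g"
  shows "l2 T g \<le> l2 S g"
proof -
  have "integrable lborel (\<lambda>z. indicator T z * (g z)\<^sup>2)" "integrable lborel (\<lambda>z. indicator S z * (g z)\<^sup>2)"
    using assms bounded_subset by (auto intro!: adm_integrable adm_power intro: adm_subset)
  then show ?thesis unfolding l2_def
    using assms by (intro real_sqrt_le_mono integral_mono) (auto simp: indicator_def)
qed

text \<open>Minkowski's inequality follows from \<open>(f + g)\<^sup>2 \<le> (1 + t) f\<^sup>2 + (1 + 1/t) g\<^sup>2\<close> for a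
\<open>t > 0\<close> close to the quotient of the norms.\<close>

lemma l2_add:
  assumes S: "open S" "bounded S" and f: "adm S f" and g: "adm S g"
  shows "l2 S (\<lambda>z. f z + g z) \<le> l2 S f + l2 S g"
proof (rule field_le_epsilon)
  fix e :: real assume e: "e > 0"
  \<comment> \<open>The added \<open>e / 2\<close> keeps \<open>a\<close> and \<open>b\<close>
    positive even if a norm vanishes, so that \<open>b / a\<close> can serve as the parameter of
    Young's inequality.\<close>
  define a b where "a = l2 S f + e / 2" and "b = l2 S g + e / 2"
  have ab: "a > 0" "b > 0" "l2 S f \<le> a" "l2 S g \<le> b"
    using e l2_nonneg[of S] by (auto simp: a_def b_def add_nonneg_pos)
  have young: "(x + y)\<^sup>2 \<le> (1 + b / a) * x\<^sup>2 + (1 + a / b) * y\<^sup>2" for x y :: real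
  proof -
    have "(1 + b / a) * x\<^sup>2 + (1 + a / b) * y\<^sup>2 - (x + y)\<^sup>2 = (b * x - a * y)\<^sup>2 / (a * b)"
      using ab by (simp add: field_simps power2_eq_square)
    moreover have "(b * x - a * y)\<^sup>2 / (a * b) \<ge> 0" using ab by simp
    ultimately show ?thesis by linarith
  qed
  have "(l2 S (\<lambda>z. f z + g z))\<^sup>2
      \<le> (\<integral>z. indicator S z * ((1 + b / a) * (f z)\<^sup>2 + (1 + a / b) * (g z)\<^sup>2) \<partial>lborel)"
    unfolding l2_square using S f g young by (intro integral_adm_mono adm_intros) auto
  also have "\<dots> = (1 + b / a) * (l2 S f)\<^sup>2 + (1 + a / b) * (l2 S g)\<^sup>2"
  proof -
    have "(\<lambda>z. indicator S z * ((1 + b / a) * (f z)\<^sup>2 + (1 + a / b) * (g z)\<^sup>2))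
       = (\<lambda>z. (1 + b / a) * (indicator S z * (f z)\<^sup>2) + (1 + a / b) * (indicator S z * (g z)\<^sup>2))"
      by (auto simp: algebra_simps)
    moreover have "integrable lborel (\<lambda>z. indicator S z * (f z)\<^sup>2)" "integrable lborel (\<lambda>z. indicator S z * (g z)\<^sup>2)"
      using S f g by (auto intro: adm_integrable adm_power)
    ultimately show ?thesis by (simp add: l2_square)
  qed
  also have "\<dots> \<le> (1 + b / a) * a\<^sup>2 + (1 + a / b) * b\<^sup>2"
    using ab by (intro add_mono mult_left_mono power_mono l2_nonneg) auto
  also have "\<dots> = (a + b)\<^sup>2"
    using ab by (simp add: field_simps power2_eq_square)
  finally have "l2 S (\<lambda>z. f z + g z) \<le> a + b"
    using ab power2_le_imp_le by (metis add_nonneg_nonneg less_imp_le)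
  then show "l2 S (\<lambda>z. f z + g z) \<le> l2 S f + l2 S g + e" by (simp add: a_def b_def)
qed

lemma l2_sum:
  assumes S: "open S" "bounded S" and f: "\<And>k. k \<in> I \<Longrightarrow> adm S (f k)"
  shows "l2 S (\<lambda>z. \<Sum>k\<in>I. f k z) \<le> (\<Sum>k\<in>I. l2 S (f k))"
  using f
proof (induction I rule: infinite_finite_induct)
  case (insert k I)
  have "l2 S (\<lambda>z. f k z + (\<Sum>k\<in>I. f k z)) \<le> l2 S (f k) + l2 S (\<lambda>z. \<Sum>k\<in>I. f k z)"
    using S insert by (intro l2_add adm_intros) auto
  then show ?case using insert by fastforce
qed (simp_all add: l2_def)

lemma l2_leib:
  assumes S: "open S" "bounded S" and F: "\<And>a b. adm S (F a b)"
  shows "l2 S (\<lambda>z. leib ds (\<lambda>a b. F a b z)) \<le> leib ds (\<lambda>a b. l2 S (F a b))"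
  using F
proof (induction ds arbitrary: F)
  case (Cons d ds)
  have "l2 S (\<lambda>z. leib ds (\<lambda>a b. F (d # a) b z) + leib ds (\<lambda>a b. F a (d # b) z))
      \<le> l2 S (\<lambda>z. leib ds (\<lambda>a b. F (d # a) b z)) + l2 S (\<lambda>z. leib ds (\<lambda>a b. F a (d # b) z))"
    using S Cons.prems by (intro l2_add adm_intros) auto
  then show ?case using Cons.IH[of "\<lambda>a b. F (d # a) b"] Cons.IH[of "\<lambda>a b. F a (d # b)"] Cons.prems
    by simp
qed simp

section \<open>A Caccioppoli inequality on half balls\<close>

lemma half_ball_eq: "half_ball R = ball 0 R \<inter> {z. z $ 3 > 0}"
  by (auto simp: half_ball_def)

lemma open_half_ball: "open (half_ball R)"
  unfolding half_ball_eq by (intro open_Int open_ball open_Collect_less continuous_intros)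

lemma bounded_half_ball: "bounded (half_ball R)"
  unfolding half_ball_eq by (intro bounded_Int) simp

lemma half_ball_mono: "r \<le> R \<Longrightarrow> half_ball r \<subseteq> half_ball R"
  by (auto simp: half_ball_def)

text \<open>Beyond radius \<open>\<rho>\<close> the function is locally zero, so differentiability
  in \<open>half_ball R\<close> extends to the whole upper half space. The gap between
  \<open>\<rho>\<close> and \<open>R\<close> lets the two regions overlap.\<close>

lemma upper_DERIV:
  fixes h :: "real^3 \<Rightarrow> real"
  assumes "\<rho> < R" and h0: "\<And>z. z \<notin> half_ball \<rho> \<Longrightarrow> h z = 0" and g0: "\<And>z. z \<notin> half_ball \<rho> \<Longrightarrow> g z = 0"
    and der: "\<And>z. z \<in> half_ball R \<Longrightarrow> ((\<lambda>t. h (z + t *\<^sub>R e)) has_real_derivative g z) (at 0)"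
    and z: "z $ 3 > 0"
  shows "((\<lambda>t. h (z + t *\<^sub>R e)) has_real_derivative g z) (at 0)"
proof (cases "z \<in> half_ball R")
  case False
  then have "norm z \<ge> R" using z by (auto simp: half_ball_def)
  then have z': "z \<in> {w. norm w > \<rho>}" using assms(1) by auto
  have "open {w::real^3. norm w > \<rho>}" by (intro open_Collect_less continuous_intros)
  then have "((\<lambda>t. h (z + t *\<^sub>R e)) has_real_derivative 0) (at 0) \<longleftrightarrow>
      ((\<lambda>t. (\<lambda>_. 0) (z + t *\<^sub>R e)) has_real_derivative 0) (at (0::real))"
    using z' by (intro DERIV_line_cong) (auto intro!: h0 simp: half_ball_def)
  moreover have "g z = 0" using z' by (intro g0) (auto simp: half_ball_def)
  ultimately show ?thesis by simp
qed (rule der)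

text \<open>Translation invariance of the Lebesgue measure replaces the divergence theorem: the
difference quotients of \<open>h\<close> have integral zero, and they are dominated because \<open>h\<close> vanishes
at least linearly at the flat boundary.\<close>

lemma integral_directional_derivative_eq_0:
  fixes h g :: "real^3 \<Rightarrow> real"
  assumes "\<rho> < R" and h0: "\<And>z. z \<notin> half_ball \<rho> \<Longrightarrow> h z = 0" and g0: "\<And>z. z \<notin> half_ball \<rho> \<Longrightarrow> g z = 0"
    and der: "\<And>z. z \<in> half_ball R \<Longrightarrow> ((\<lambda>t. h (z + t *\<^sub>R axis i 1)) has_real_derivative g z) (at 0)"
    and gB: "\<And>z. z \<in> half_ball \<rho> \<Longrightarrow> \<bar>g z\<bar> \<le> B" and hB: "\<And>z. z \<in> half_ball \<rho> \<Longrightarrow> \<bar>h z\<bar> \<le> B * z $ 3"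
    and B: "0 \<le> B"
    and h: "integrable lborel h" and g: "g \<in> borel_measurable lborel"
  shows "(\<integral>z. g z \<partial>lborel) = 0"
proof -
  let ?e = "axis i 1 :: real^3"
  have der': "((\<lambda>t. h (z + t *\<^sub>R ?e)) has_real_derivative g z) (at 0)" if "z $ 3 > 0" for z
    by (rule upper_DERIV[OF assms(1) h0 g0 der that])
  have gB': "\<bar>g z\<bar> \<le> B" for z using gB[of z] g0[of z] B by (cases "z \<in> half_ball \<rho>") auto
  have lip: "\<bar>h (z + t *\<^sub>R ?e) - h z\<bar> \<le> B * t" if t: "t > 0" for z t
  proof (cases "z $ 3 > 0")
    case True
    have "((\<lambda>t. h (z + t *\<^sub>R ?e)) has_real_derivative g (z + x *\<^sub>R ?e)) (at x)" if "0 \<le> x" for x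
      by (rule DERIV_line_shift, rule der') (use True that in \<open>auto simp: axis_def\<close>)
    then obtain x where "h (z + t *\<^sub>R ?e) - h (z + 0 *\<^sub>R ?e) = (t - 0) * g (z + x *\<^sub>R ?e)"
      using MVT2[OF t, of "\<lambda>t. h (z + t *\<^sub>R ?e)" "\<lambda>x. g (z + x *\<^sub>R ?e)"] by blast
    then show ?thesis using gB'[of "z + x *\<^sub>R ?e"] t by (auto simp: abs_mult mult.commute)
  next
    case False
    then have z: "h z = 0" by (intro h0) (auto simp: half_ball_def)
    show ?thesis
    proof (cases "z + t *\<^sub>R ?e \<in> half_ball \<rho>")
      case True
      \<comment> \<open>A point that is not in the upper half space can enter the half ball only by
        a normal shift, and then it arrives at height at most \<open>t\<close>, where the linear
        bound on \<open>h\<close> applies.\<close>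
      then have i: "i = 3" using False by (auto simp: half_ball_def axis_def split: if_splits)
      have "\<bar>h (z + t *\<^sub>R ?e)\<bar> \<le> B * (z + t *\<^sub>R ?e) $ 3" by (rule hB[OF True])
      also have "\<dots> \<le> B * t" using False B i by (intro mult_left_mono) (auto simp: axis_def)
      finally show ?thesis using z by simp
    qed (use z h0 B t in auto)
  qed
  define s where "s n = 1 / real (Suc n)" for n
  have s: "0 < s n" "s n \<le> 1" for n by (auto simp: s_def)
  have s0: "s \<longlonglongrightarrow> 0" unfolding s_def by (rule LIMSEQ_inverse_real_of_nat[unfolded inverse_eq_divide])
  define q where "q n z = (h (z + s n *\<^sub>R ?e) - h z) / s n" for n z
  have shift: "integrable lborel (\<lambda>z. h (z + v)) \<and> (\<integral>z. h (z + v) \<partial>lborel) = (\<integral>z. h z \<partial>lborel)" for v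
  proof -
    have h': "h \<in> borel_measurable borel" using h by auto
    have "integrable (distr lborel borel (\<lambda>z. v + z)) h" using h by (simp add: lborel_distr_plus)
    then have "integrable lborel (\<lambda>z. h (v + z))" using h' by (subst (asm) integrable_distr_eq) auto
    moreover have "(\<integral>z. h (v + z) \<partial>lborel) = integral\<^sup>L (distr lborel borel (\<lambda>z. v + z)) h"
      using h' by (subst integral_distr) auto
    ultimately show ?thesis by (simp add: lborel_distr_plus add.commute[of _ v])
  qed
  have q0: "(\<integral>z. q n z \<partial>lborel) = 0" for n
    unfolding q_def using shift[of "s n *\<^sub>R ?e"] h by simp
  \<comment> \<open>On the hyperplane itself the quotients in the normal direction need not converge
    to \<open>g\<close>; it is a null set.\<close>
  have null: "AE z in lborel. (z::real^3) $ 3 \<noteq> 0"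
  proof -
    have "negligible {z::real^3. z $ 3 = 0}" by (rule negligible_standard_hyperplane_cart)
    moreover have "{z::real^3. z $ 3 = 0} \<in> sets borel"
      by (intro borel_closed closed_Collect_eq continuous_intros)
    ultimately have "{z::real^3. z $ 3 = 0} \<in> null_sets lborel"
      by (simp add: negligible_iff_null_sets null_sets_def)
    then show ?thesis by (rule AE_I') auto
  qed
  have lim: "AE z in lborel. (\<lambda>n. q n z) \<longlonglongrightarrow> g z"
    using null
  proof (rule AE_mp, intro AE_I2 impI)
    fix z :: "real^3" assume z3: "z $ 3 \<noteq> 0"
    show "(\<lambda>n. q n z) \<longlonglongrightarrow> g z"
    proof (cases "z $ 3 > 0")
      case True
      have "((\<lambda>t. (h (z + t *\<^sub>R ?e) - h z) / t) \<longlongrightarrow> g z) (at 0)"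
        using der'[OF True] by (simp add: has_field_derivative_iff)
      moreover have "filterlim s (at 0) sequentially"
        using s0 s by (intro filterlim_atI) (auto simp: less_imp_neq[symmetric])
      ultimately show ?thesis unfolding q_def by (rule filterlim_compose)
    next
      case False
      then have neg: "z $ 3 < 0" using z3 by simp
      then have "\<forall>\<^sub>F n in sequentially. s n < - z $ 3" using s0 by (intro order_tendstoD) auto
      then have "\<forall>\<^sub>F n in sequentially. q n z = 0"
      proof eventually_elim
        case (elim n)
        have "h z = 0" "h (z + s n *\<^sub>R ?e) = 0"
          using neg elim s[of n] by (auto intro!: h0 simp: half_ball_def axis_def split: if_splits)
        then show ?case by (simp add: q_def)
      qed
      moreover have "g z = 0" using neg by (intro g0) (auto simp: half_ball_def)
      ultimately show ?thesis using tendsto_eventually[of "\<lambda>n. q n z" 0] by simp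
    qed
  qed
  \<comment> \<open>The shifts have length at most 1, so every quotient vanishes outside this ball;
    inside, the bound is \<open>lip\<close>.\<close>
  have dom: "norm (q n z) \<le> B * indicator (cball 0 (\<bar>\<rho>\<bar> + 1)) z" for n z
  proof (cases "z \<in> cball 0 (\<bar>\<rho>\<bar> + 1)")
    case True
    have "\<bar>h (z + s n *\<^sub>R ?e) - h z\<bar> / s n \<le> B"
      using lip[OF s(1), of z n] s(1)[of n] by (simp add: pos_divide_le_eq)
    then show ?thesis using True s(1)[of n] by (simp add: q_def abs_divide)
  next
    case False
    have "norm (s n *\<^sub>R ?e) \<le> 1" using s[of n] by (simp add: norm_axis_1)
    then have "norm (z + s n *\<^sub>R ?e) \<ge> norm z - 1" using norm_diff_ineq[of z "s n *\<^sub>R ?e"] by linarith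
    then have "h z = 0" "h (z + s n *\<^sub>R ?e) = 0" using False by (auto intro!: h0 simp: half_ball_def)
    then show ?thesis using False by (simp add: q_def)
  qed
  have "(\<lambda>n. \<integral>z. q n z \<partial>lborel) \<longlonglongrightarrow> (\<integral>z. g z \<partial>lborel)"
  proof (rule integral_dominated_convergence[where w = "\<lambda>z. B * indicator (cball 0 (\<bar>\<rho>\<bar> + 1)) z"])
    show "integrable lborel (\<lambda>z::real^3. B * indicator (cball 0 (\<bar>\<rho>\<bar> + 1)) z)"
      by (intro integrable_mult_right integrable_real_indicator emeasure_bounded_finite) auto
    show "q n \<in> borel_measurable lborel" for n
      unfolding q_def using shift[of "s n *\<^sub>R ?e"] h by auto
  qed (use g lim dom in auto)
  then show ?thesis using LIMSEQ_unique[OF _ tendsto_const] by (simp add: q0)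
qed

section \<open>A continuously differentiable cutoff function\<close>

lemma DERIV_max_0_square: "((\<lambda>t::real. (max 0 t)\<^sup>2) has_real_derivative 2 * max 0 t) (at t)"
proof (cases t "0::real" rule: linorder_cases)
  case less
  have "((\<lambda>t::real. (max 0 t)\<^sup>2) has_real_derivative 0) (at t) \<longleftrightarrow> ((\<lambda>t::real. 0) has_real_derivative 0) (at t)"
    using less eventually_nhds_in_open[of "{..<0}" t]
    by (intro DERIV_cong_ev) (auto elim!: eventually_mono)
  then show ?thesis using less by simp
next
  case equal
  have "((\<lambda>h::real. (max 0 h)\<^sup>2 / h) \<longlongrightarrow> 0) (at 0)"
  proof (rule Lim_null_comparison)
    show "\<forall>\<^sub>F h in at 0. norm ((max 0 h)\<^sup>2 / h) \<le> \<bar>h\<bar>"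
      by (intro always_eventually allI) (auto simp: max_def power2_eq_square abs_mult)
    show "((\<lambda>h::real. \<bar>h\<bar>) \<longlongrightarrow> 0) (at 0)" by (auto intro!: tendsto_eq_intros)
  qed
  then show ?thesis using equal by (simp add: has_field_derivative_iff)
next
  case greater
  have "((\<lambda>t::real. (max 0 t)\<^sup>2) has_real_derivative 2 * t) (at t) \<longleftrightarrow> ((\<lambda>t::real. t\<^sup>2) has_real_derivative 2 * t) (at t)"
    using greater eventually_nhds_in_open[of "{0<..}" t]
    by (intro DERIV_cong_ev) (auto elim!: eventually_mono)
  moreover have "((\<lambda>t::real. t\<^sup>2) has_real_derivative 2 * t) (at t)"
    by (auto intro!: derivative_eq_intros)
  ultimately show ?thesis using greater by simp
qed

text \<open>A continuously differentiable step from 0 on \<open>t \<le> 0\<close> to 1 on \<open>t \<ge> 1\<close>.\<close>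

definition step :: "real \<Rightarrow> real" where
  "step t = 1 - (max 0 (1 - (max 0 t)\<^sup>2))\<^sup>2"

definition step' :: "real \<Rightarrow> real" where
  "step' t = 4 * max 0 (1 - (max 0 t)\<^sup>2) * max 0 t"

lemma DERIV_step: "(step has_real_derivative step' t) (at t)"
proof -
  have "((\<lambda>t. 1 - (max 0 (1 - (max 0 t)\<^sup>2))\<^sup>2) has_real_derivative
      0 - (2 * max 0 (1 - (max 0 t)\<^sup>2)) * (0 - 2 * max 0 t)) (at t)"
    by (intro DERIV_diff DERIV_const DERIV_max_0_square DERIV_chain2[OF DERIV_max_0_square])
  then show ?thesis by (simp add: step_def[abs_def] step'_def mult_ac)
qed

lemma step_bounds: "0 \<le> step t" "step t \<le> 1"
  by (auto simp: step_def max_def power_le_one)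

lemma step_ge_1: assumes "1 \<le> t" shows "step t = 1" "step' t = 0"
proof -
  have "1 \<le> t\<^sup>2" using assms by (rule one_le_power)
  then have "max 0 (1 - t\<^sup>2) = 0" by (intro max_absorb1) linarith
  then show "step t = 1" "step' t = 0" using assms by (simp_all add: step_def step'_def)
qed

lemma step_nonpos: "t \<le> 0 \<Longrightarrow> step t = 0" "t \<le> 0 \<Longrightarrow> step' t = 0"
  by (auto simp: step_def step'_def max_def)

lemma step'_bounds: "\<bar>step' t\<bar> \<le> 4"
proof (cases "0 \<le> t \<and> t \<le> 1")
  case True
  then have "t\<^sup>2 \<le> 1" by (simp add: power_le_one)
  then have "(1 - t\<^sup>2) * t \<le> 1 * 1" using True by (intro mult_mono) auto
  moreover have "step' t = 4 * ((1 - t\<^sup>2) * t)" "0 \<le> (1 - t\<^sup>2) * t"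
    using True \<open>t\<^sup>2 \<le> 1\<close> by (auto simp: step'_def)
  ultimately show ?thesis by linarith
next
  case False
  then show ?thesis using step_ge_1(2)[of t] step_nonpos(2)[of t] by linarith
qed

lemma continuous_on_step: "continuous_on S step" "continuous_on S step'"
  unfolding step_def[abs_def] step'_def[abs_def] by (intro continuous_intros)+

lemma exists_cutoff:
  assumes r: "0 < r" "r < \<rho>"
  obtains \<eta> :: "real^3 \<Rightarrow> real" and c :: "real^3 \<Rightarrow> real^3" where
    "\<And>z i. ((\<lambda>t. \<eta> (z + t *\<^sub>R axis i 1)) has_real_derivative c z $ i) (at 0)"
    "\<And>z. 0 \<le> \<eta> z" "\<And>z. \<eta> z \<le> 1" "\<And>z. norm z < r \<Longrightarrow> \<eta> z = 1"
    "\<And>z. \<rho> \<le> norm z \<Longrightarrow> \<eta> z = 0" "\<And>z. \<rho> \<le> norm z \<Longrightarrow> c z = 0"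
    "\<And>z. norm (c z) \<le> 8 / (\<rho> - r)"
    "\<And>S. continuous_on S \<eta>" "\<And>S i. continuous_on S (\<lambda>z. c z $ i)"
proof -
  define D where "D = \<rho>\<^sup>2 - r\<^sup>2"
  have D: "D = (\<rho> - r) * (\<rho> + r)" by (simp add: D_def power2_eq_square algebra_simps)
  then have D0: "D > 0" using r by simp
  \<comment> \<open>The squared norm is a polynomial and therefore differentiable at the origin too.
    It is normalised so that \<open>\<tau>\<close> is at least 1 inside radius \<open>r\<close> and
    at most 0 outside radius \<open>\<rho>\<close>.\<close>
  define \<tau> :: "real^3 \<Rightarrow> real" where "\<tau> z = (\<rho>\<^sup>2 - z \<bullet> z) / D" for z
  define c :: "real^3 \<Rightarrow> real^3" where "c z = (- 2 * step' (\<tau> z) / D) *\<^sub>R z" for z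
  have out: "\<tau> z \<le> 0" if "\<rho> \<le> norm z" for z
    using that r D0 power_mono[of \<rho> "norm z" 2] by (auto simp: \<tau>_def power2_norm_eq_inner divide_le_0_iff)
  show ?thesis
  proof (rule that[of "\<lambda>z. step (\<tau> z)" c])
    show "((\<lambda>t. step (\<tau> (z + t *\<^sub>R axis i 1))) has_real_derivative c z $ i) (at 0)" for z i
    proof -
      have "(z + t *\<^sub>R axis i 1) \<bullet> (z + t *\<^sub>R axis i 1) = z \<bullet> z + 2 * t * (z $ i) + t\<^sup>2" for t
        by (simp add: inner_add_left inner_add_right inner_axis inner_axis' power2_eq_square algebra_simps)
      then have "((\<lambda>t. \<tau> (z + t *\<^sub>R axis i 1)) has_real_derivative (- 2 * z $ i / D)) (at 0)"
        unfolding \<tau>_def using D0 by (auto intro!: derivative_eq_intros simp: field_simps)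
      from DERIV_chain2[OF DERIV_step this] show ?thesis by (simp add: c_def mult_ac)
    qed
    show "step (\<tau> z) = 1" if "norm z < r" for z
    proof -
      have "z \<bullet> z \<le> r\<^sup>2" using that power_mono[of "norm z" r 2] by (simp add: power2_norm_eq_inner)
      then show ?thesis using D0 by (intro step_ge_1(1)) (simp add: \<tau>_def D_def)
    qed
    show "c z = 0" if "\<rho> \<le> norm z" for z using step_nonpos(2)[OF out[OF that]] by (simp add: c_def)
    then show "norm (c z) \<le> 8 / (\<rho> - r)" for z
    proof (cases "\<rho> \<le> norm z")
      case False
      \<comment> \<open>Here \<open>norm z < \<rho>\<close>, which is below
        \<open>\<rho> + r\<close> and cancels against a factor of \<open>D\<close>. The 8 is the 2
        from differentiating the square times the bound 4 of \<open>step'\<close>.\<close>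
      have "norm (c z) = 2 * \<bar>step' (\<tau> z)\<bar> / D * norm z" using D0 by (simp add: c_def abs_mult)
      also have "\<dots> \<le> 2 * 4 / D * (\<rho> + r)"
        using False step'_bounds[of "\<tau> z"] D0 r by (intro mult_mono divide_right_mono) auto
      also have "\<dots> = 8 / (\<rho> - r)" using r unfolding D by (simp add: divide_simps)
      finally show ?thesis .
    qed (use \<open>r < \<rho>\<close> in simp)
    have \<tau>: "continuous_on S \<tau>" for S unfolding \<tau>_def[abs_def] using D0 by (intro continuous_intros) auto
    show "continuous_on S (\<lambda>z. step (\<tau> z))" for S
      by (rule continuous_on_compose2[OF continuous_on_step(1)[of UNIV] \<tau>]) auto
    have "continuous_on S (\<lambda>z. step' (\<tau> z))" for S
      by (rule continuous_on_compose2[OF continuous_on_step(2)[of UNIV] \<tau>]) auto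
    then show "continuous_on S (\<lambda>z. c z $ i)" for S i unfolding c_def using D0 by (intro continuous_intros) auto
  qed (use step_bounds step_nonpos out in auto)
qed

section \<open>The energy estimate\<close>

lemma norm_matrix_vector_le:
  fixes M :: "real^3^3"
  assumes "\<And>i j. \<bar>M $ i $ j\<bar> \<le> C"
  shows "norm (M *v X) \<le> 9 * C * norm X"
proof -
  have "\<bar>(M *v X) $ i\<bar> \<le> 3 * C * norm X" for i
  proof -
    have "\<bar>(M *v X) $ i\<bar> \<le> (\<Sum>j\<in>UNIV. \<bar>M $ i $ j * X $ j\<bar>)"
      by (simp add: matrix_vector_mult_def sum_abs)
    also have "\<dots> \<le> (\<Sum>j\<in>(UNIV::3 set). C * norm X)"
      unfolding abs_mult by (intro sum_mono mult_mono assms component_le_norm_cart) (use assms[of 1 1] in auto)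
    finally show ?thesis by simp
  qed
  then have "(\<Sum>i\<in>(UNIV::3 set). \<bar>(M *v X) $ i\<bar>) \<le> (\<Sum>i\<in>(UNIV::3 set). 3 * C * norm X)"
    by (intro sum_mono)
  then show ?thesis using norm_le_l1_cart[of "M *v X"] by simp
qed

text \<open>With \<open>s\<close> the cutoff, \<open>c\<close> its gradient and \<open>X\<close> the
  gradient of \<open>w\<close>, the inner product pairs the gradient of \<open>s\<^sup>2 * w\<close>
  with the flux \<open>M *v X + G\<close>. Young's inequality absorbs two mixed terms at the price
  of \<open>lam / 4\<close> each, which leaves half of the coercive term.\<close>

lemma cutoff_energy_lower_bound:
  fixes X G c :: "real^3" and M :: "real^3^3"
  assumes lam: "lam > 0" and coer: "lam * (norm X)\<^sup>2 \<le> X \<bullet> (M *v X)"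
    and M: "norm (M *v X) \<le> L * norm X" and L: "0 \<le> L" and s: "0 \<le> s" "s \<le> 1" 
  shows "lam / 2 * s\<^sup>2 * (norm X)\<^sup>2 - (1 + 1 / lam) * (norm G)\<^sup>2 - (1 + 4 * L\<^sup>2 / lam) * (w\<^sup>2 * (norm c)\<^sup>2)
     \<le> (s\<^sup>2 *\<^sub>R X + (2 * s * w) *\<^sub>R c) \<bullet> (M *v X + G)"
proof -
  define x g e where "x = s * norm X" and "g = s * norm G" and "e = \<bar>w\<bar> * norm c"
  have xge: "0 \<le> x" "0 \<le> g" "0 \<le> e" using s by (auto simp: x_def g_def e_def)
  have 1: "s\<^sup>2 * (X \<bullet> (M *v X)) \<ge> lam * x\<^sup>2"
    using mult_left_mono[OF coer, of "s\<^sup>2"] by (simp add: x_def power_mult_distrib mult_ac)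
  have 2: "s\<^sup>2 * (X \<bullet> G) \<ge> - (x * g)"
    using mult_left_mono[of "- (norm X * norm G)" "X \<bullet> G" "s\<^sup>2"] Cauchy_Schwarz_ineq2[of X G]
    by (simp add: x_def g_def power2_eq_square mult_ac abs_le_iff)
  have 3: "2 * s * w * (c \<bullet> (M *v X)) \<ge> - (2 * L * e * x)"
  proof -
    have "\<bar>2 * s * w * (c \<bullet> (M *v X))\<bar> \<le> 2 * s * \<bar>w\<bar> * (norm c * (L * norm X))"
      using s order_trans[OF Cauchy_Schwarz_ineq2 mult_left_mono[OF M norm_ge_zero[of c]]]
      by (simp add: abs_mult mult_left_mono)
    moreover have "2 * L * e * x = 2 * s * \<bar>w\<bar> * (norm c * (L * norm X))"
      unfolding x_def e_def by (simp only: mult_ac)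
    ultimately show ?thesis by linarith
  qed
  have 4: "2 * s * w * (c \<bullet> G) \<ge> - (2 * e * g)"
  proof -
    have "\<bar>2 * s * w * (c \<bullet> G)\<bar> \<le> 2 * s * \<bar>w\<bar> * (norm c * norm G)"
      using s Cauchy_Schwarz_ineq2[of c G] by (simp add: abs_mult mult_left_mono)
    moreover have "2 * e * g = 2 * s * \<bar>w\<bar> * (norm c * norm G)"
      unfolding g_def e_def by (simp only: mult_ac)
    ultimately show ?thesis by linarith
  qed
  have young: "a * b \<le> lam / 4 * a\<^sup>2 + b\<^sup>2 / lam" for a b :: real
  proof -
    have "lam / 4 * a\<^sup>2 + b\<^sup>2 / lam - a * b = (lam * a - 2 * b)\<^sup>2 / (4 * lam)"
      using lam by (simp add: field_simps power2_eq_square)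
    moreover have "(lam * a - 2 * b)\<^sup>2 / (4 * lam) \<ge> 0" using lam by simp
    ultimately show ?thesis by linarith
  qed
  have y1: "x * g \<le> lam / 4 * x\<^sup>2 + g\<^sup>2 / lam" by (rule young)
  have y2: "2 * L * e * x \<le> lam / 4 * x\<^sup>2 + 4 * L\<^sup>2 / lam * e\<^sup>2"
    using young[of x "2 * L * e"] by (simp add: power_mult_distrib mult_ac)
  have y3: "2 * e * g \<le> e\<^sup>2 + g\<^sup>2" using sum_squares_bound[of e g] by simp
  have g: "g\<^sup>2 \<le> (norm G)\<^sup>2"
    using s xge unfolding g_def by (intro power_mono mult_left_le_one_le) auto
  have g': "(1 + 1 / lam) * g\<^sup>2 \<le> (1 + 1 / lam) * (norm G)\<^sup>2"
    using g lam by (intro mult_left_mono) auto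
  have expand: "(s\<^sup>2 *\<^sub>R X + (2 * s * w) *\<^sub>R c) \<bullet> (M *v X + G)
      = s\<^sup>2 * (X \<bullet> (M *v X)) + s\<^sup>2 * (X \<bullet> G) + 2 * s * w * (c \<bullet> (M *v X)) + 2 * s * w * (c \<bullet> G)"
    by (simp add: inner_add_left inner_add_right algebra_simps)
  have eqs: "lam / 2 * s\<^sup>2 * (norm X)\<^sup>2 = lam / 2 * x\<^sup>2" "w\<^sup>2 * (norm c)\<^sup>2 = e\<^sup>2"
    by (auto simp: x_def e_def power_mult_distrib)
  have sums: "(1 + 1 / lam) * g\<^sup>2 = g\<^sup>2 + g\<^sup>2 / lam" "(1 + 4 * L\<^sup>2 / lam) * e\<^sup>2 = e\<^sup>2 + 4 * L\<^sup>2 / lam * e\<^sup>2"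
    by (auto simp: algebra_simps)
  show ?thesis unfolding expand eqs sums using g'[unfolded sums] 1 2 3 4 y1 y2 y3 by linarith
qed

text \<open>The constants of the pointwise energy bound with \<open>L = 9 * C\<close>: the first
  summand belongs to \<open>G\<close>, the second to \<open>w\<close>. The 64 is the square of the 8
  in the gradient of the cutoff, and \<open>2 / lam\<close> removes the factor in front of the
  coercive term.\<close>

definition cacc :: "real \<Rightarrow> real \<Rightarrow> real" where
  "cacc lam C = sqrt (2 / lam * ((1 + 1 / lam) + 64 * (1 + 4 * (9 * C)\<^sup>2 / lam)))"

lemma norm_square_vec3: "(norm (\<chi> i. x i :: real^3))\<^sup>2 = (\<Sum>i\<in>UNIV. (x i)\<^sup>2)"
  unfolding power2_norm_eq_inner by (simp add: inner_vec_def power2_eq_square)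

text \<open>\<open>F\<close> is divergence free, and the product of \<open>F\<close> with
  \<open>w\<close> and the squared cutoff vanishes on the round boundary through the cutoff and on
  the flat one through \<open>w\<close>. Hence the integral of \<open>F\<close> against the gradient
  of the test function is zero, and the pointwise lower bound for that integrand gives the estimate.
  \<open>flat\<close> is the Dirichlet condition in the quantitative form that the integration lemma
  asks for.\<close>

lemma caccioppoli:
  fixes A :: "real^3 \<Rightarrow> real^3^3" and X G F dF :: "3 \<Rightarrow> real^3 \<Rightarrow> real" and w :: "real^3 \<Rightarrow> real"
  assumes r: "0 < r" "r < \<rho>" "\<rho> < R" and lam: "lam > 0"
    and w: "\<And>z i. z \<in> half_ball R \<Longrightarrow> ((\<lambda>t. w (z + t *\<^sub>R axis i 1)) has_real_derivative X i z) (at 0)"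
    and F: "\<And>z i. z \<in> half_ball R \<Longrightarrow> ((\<lambda>t. F i (z + t *\<^sub>R axis i 1)) has_real_derivative dF i z) (at 0)"
    and div: "\<And>z. z \<in> half_ball R \<Longrightarrow> (\<Sum>i\<in>UNIV. dF i z) = 0"
    and Feq: "\<And>z i. z \<in> half_ball \<rho> \<Longrightarrow> F i z = (\<Sum>j\<in>UNIV. A z $ i $ j * X j z) + G i z"
    and coer: "\<And>z \<xi>. z \<in> half_ball \<rho> \<Longrightarrow> lam * (norm \<xi>)\<^sup>2 \<le> \<xi> \<bullet> (A z *v \<xi>)"
    and A: "\<And>z i j. z \<in> half_ball \<rho> \<Longrightarrow> \<bar>A z $ i $ j\<bar> \<le> C" and C: "0 \<le> C"
    and adm: "adm (half_ball \<rho>) w" "\<And>i. adm (half_ball \<rho>) (X i)" "\<And>i. adm (half_ball \<rho>) (F i)"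
      "\<And>i. adm (half_ball \<rho>) (dF i)" "\<And>i. adm (half_ball \<rho>) (G i)"
    and flat: "\<And>z. z \<in> half_ball \<rho> \<Longrightarrow> \<bar>w z\<bar> \<le> B * z $ 3"
  shows "l2 (half_ball r) (X k) \<le> cacc lam C * ((\<Sum>i\<in>UNIV. l2 (half_ball \<rho>) (G i)) + l2 (half_ball \<rho>) w / (\<rho> - r))"
proof -
  let ?S = "half_ball \<rho>"
  note S = open_half_ball[of \<rho>] bounded_half_ball[of \<rho>]
  obtain \<eta> :: "real^3 \<Rightarrow> real" and c :: "real^3 \<Rightarrow> real^3" where
    \<eta>: "\<And>z i. ((\<lambda>t. \<eta> (z + t *\<^sub>R axis i 1)) has_real_derivative c z $ i) (at 0)"
    and \<eta>01: "\<And>z. 0 \<le> \<eta> z" "\<And>z. \<eta> z \<le> 1" and \<eta>1: "\<And>z. norm z < r \<Longrightarrow> \<eta> z = 1"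
    and \<eta>0: "\<And>z. \<rho> \<le> norm z \<Longrightarrow> \<eta> z = 0" "\<And>z. \<rho> \<le> norm z \<Longrightarrow> c z = 0"
    and c: "\<And>z. norm (c z) \<le> 8 / (\<rho> - r)"
    and cont: "\<And>S. continuous_on S \<eta>" "\<And>S i. continuous_on S (\<lambda>z. c z $ i)"
    by (rule exists_cutoff[OF r(1,2)]) (rule that)
  have adm\<eta>: "adm ?S \<eta>" unfolding adm_def using cont \<eta>01 by (auto intro!: exI[of _ 1])
  have admc: "adm ?S (\<lambda>z. c z $ i)" for i
    unfolding adm_def using cont c by (auto intro!: exI[of _ "8 / (\<rho> - r)"] order_trans[OF component_le_norm_cart])
  \<comment> \<open>\<open>g i\<close> is the derivative in direction \<open>i\<close> of
    \<open>(\<eta> z)\<^sup>2 * (w z * F i z)\<close>. Its last summand disappears when summed over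
    \<open>i\<close>.\<close>
  define g where "g i z = 2 * \<eta> z * c z $ i * (w z * F i z) + (\<eta> z)\<^sup>2 * (X i z * F i z) + (\<eta> z)\<^sup>2 * (w z * dF i z)" for i z
  have admg: "adm ?S (g i)" for i
    unfolding g_def by (intro adm_intros adm\<eta> admc adm)
  have int0: "(\<integral>z. indicator ?S z * g i z \<partial>lborel) = 0" for i
  proof -
    define h where "h z = indicator ?S z * ((\<eta> z)\<^sup>2 * (w z * F i z))" for z
    obtain B1 where B1: "0 \<le> B1" "\<And>z. z \<in> ?S \<Longrightarrow> \<bar>g i z\<bar> \<le> B1" using adm_bounded[OF admg] by metis
    obtain B2 where B2: "0 \<le> B2" "\<And>z. z \<in> ?S \<Longrightarrow> \<bar>F i z\<bar> \<le> B2" using adm_bounded[OF adm(3)] by metis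
    define B' where "B' = max B1 (\<bar>B\<bar> * B2)"
    \<comment> \<open>Within \<open>half_ball R\<close> the indicator changes nothing, because the
      cutoff and its gradient vanish from radius \<open>\<rho>\<close> on.\<close>
    have h_eq: "h z = (\<eta> z)\<^sup>2 * (w z * F i z)" if "z \<in> half_ball R" for z
      using that \<eta>0(1)[of z] by (auto simp: h_def indicator_def half_ball_def)
    have g_eq: "indicator ?S z * g i z = g i z" if "z \<in> half_ball R" for z
      using that \<eta>0[of z] by (auto simp: g_def indicator_def half_ball_def)
    show ?thesis
    proof (rule integral_directional_derivative_eq_0[OF r(3), where h = h and B = B'])
      show "((\<lambda>t. h (z + t *\<^sub>R axis i 1)) has_real_derivative indicator ?S z * g i z) (at 0)"
        if z: "z \<in> half_ball R" for z
      proof -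
        have "((\<lambda>t. (\<eta> (z + t *\<^sub>R axis i 1))\<^sup>2 * (w (z + t *\<^sub>R axis i 1) * F i (z + t *\<^sub>R axis i 1)))
          has_real_derivative g i z) (at 0)"
          using \<eta>[of z i] w[OF z, of i] F[OF z, of i]
          by (auto intro!: derivative_eq_intros simp: g_def algebra_simps)
        then show ?thesis
          using DERIV_line_cong[OF open_half_ball z, of h "\<lambda>z. (\<eta> z)\<^sup>2 * (w z * F i z)"] h_eq
          unfolding g_eq[OF z] by simp
      qed
      show "\<bar>indicator ?S z * g i z\<bar> \<le> B'" if "z \<in> ?S" for z
        using B1(2)[OF that] that by (simp add: B'_def)
      show "\<bar>h z\<bar> \<le> B' * z $ 3" if z: "z \<in> ?S" for z
      proof -
        have z3: "z $ 3 > 0" using z by (simp add: half_ball_def)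
        have "\<bar>w z\<bar> \<le> \<bar>B\<bar> * z $ 3"
          using flat[OF z] z3 mult_right_mono[of B "\<bar>B\<bar>" "z $ 3"] by linarith
        then have "\<bar>w z\<bar> * \<bar>F i z\<bar> \<le> \<bar>B\<bar> * z $ 3 * B2"
          using B2(2)[OF z] z3 by (intro mult_mono) auto
        moreover have "\<bar>h z\<bar> \<le> \<bar>w z\<bar> * \<bar>F i z\<bar>"
          using z \<eta>01[of z] by (simp add: h_def abs_mult mult_left_le_one_le power_le_one)
        moreover have "\<bar>B\<bar> * z $ 3 * B2 \<le> B' * z $ 3"
          using z3 mult_right_mono[of "\<bar>B\<bar> * B2" B' "z $ 3"] by (simp add: B'_def mult_ac)
        ultimately show ?thesis by linarith
      qed
      show "integrable lborel h" unfolding h_def[abs_def]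
        by (intro adm_integrable S adm_intros adm\<eta> adm)
      show "(\<lambda>z. indicator ?S z * g i z) \<in> borel_measurable lborel" by (rule adm_measurable[OF S(1) admg])
    qed (use B1 in \<open>auto simp: h_def B'_def\<close>)
  qed
  define \<beta> where "\<beta> = 1 + 4 * (9 * C)\<^sup>2 / lam"
  define \<alpha> where "\<alpha> = 1 + 1 / lam"
  have \<alpha>\<beta>: "\<alpha> \<ge> 0" "\<beta> \<ge> 0" using lam by (auto simp: \<alpha>_def \<beta>_def)
  define E where "E = (8 / (\<rho> - r))\<^sup>2"
  have low: "lam / 2 * ((\<eta> z)\<^sup>2 * (X k z)\<^sup>2) \<le> (\<Sum>i\<in>UNIV. g i z) + (\<alpha> * (\<Sum>i\<in>UNIV. (G i z)\<^sup>2) + \<beta> * E * (w z)\<^sup>2)"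
    if z: "z \<in> ?S" for z
  proof -
    let ?X = "\<chi> i. X i z" and ?G = "\<chi> i. G i z"
    have zR: "z \<in> half_ball R" using z half_ball_mono[of \<rho> R] r by auto
    have F': "F i z = (A z *v ?X + ?G) $ i" for i
      using Feq[OF z] by (simp add: matrix_vector_mult_def)
    have "(\<Sum>i\<in>UNIV. g i z) = (\<Sum>i\<in>UNIV. ((\<eta> z)\<^sup>2 * X i z + 2 * \<eta> z * w z * c z $ i) * F i z) + (\<eta> z)\<^sup>2 * w z * (\<Sum>i\<in>UNIV. dF i z)"
      by (simp add: g_def sum_3 algebra_simps)
    also have "\<dots> = ((\<eta> z)\<^sup>2 *\<^sub>R ?X + (2 * \<eta> z * w z) *\<^sub>R c z) \<bullet> (A z *v ?X + ?G)"
      by (simp add: div[OF zR] inner_vec_def F' del: vector_add_component) simp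
    finally have g: "(\<Sum>i\<in>UNIV. g i z) = \<dots>" .
    have "lam / 2 * (\<eta> z)\<^sup>2 * (norm ?X)\<^sup>2 - \<alpha> * (norm ?G)\<^sup>2 - \<beta> * ((w z)\<^sup>2 * (norm (c z))\<^sup>2) \<le> (\<Sum>i\<in>UNIV. g i z)"
      unfolding g \<alpha>_def \<beta>_def
      by (rule cutoff_energy_lower_bound) (use lam coer[OF z] C \<eta>01 norm_matrix_vector_le[OF A[OF z]] in auto)
    moreover have "\<beta> * ((w z)\<^sup>2 * (norm (c z))\<^sup>2) \<le> \<beta> * ((w z)\<^sup>2 * E)"
      unfolding E_def using c \<alpha>\<beta> by (intro mult_left_mono power_mono) auto
    moreover have "(X k z)\<^sup>2 \<le> (norm ?X)\<^sup>2"
      unfolding norm_square_vec3 by (rule member_le_sum[of k UNIV "\<lambda>i. (X i z)\<^sup>2"]) auto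
    then have "lam / 2 * (\<eta> z)\<^sup>2 * (X k z)\<^sup>2 \<le> lam / 2 * (\<eta> z)\<^sup>2 * (norm ?X)\<^sup>2"
      using lam by (intro mult_left_mono) auto
    ultimately show ?thesis unfolding norm_square_vec3 by (simp add: mult_ac)
  qed
  have "lam / 2 * (l2 (half_ball r) (X k))\<^sup>2 \<le> (\<integral>z. indicator ?S z * (lam / 2 * ((\<eta> z)\<^sup>2 * (X k z)\<^sup>2)) \<partial>lborel)"
  proof -
    have "(l2 (half_ball r) (X k))\<^sup>2 = (l2 (half_ball r) (\<lambda>z. \<eta> z * X k z))\<^sup>2"
      using \<eta>1 by (intro arg_cong[where f = "\<lambda>x. x\<^sup>2"] l2_cong) (auto simp: half_ball_def)
    also have "\<dots> \<le> (l2 ?S (\<lambda>z. \<eta> z * X k z))\<^sup>2"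
      using r by (intro power_mono l2_subset l2_nonneg S open_half_ball half_ball_mono adm_intros adm\<eta> adm) auto
    finally have "lam / 2 * (l2 (half_ball r) (X k))\<^sup>2 \<le> lam / 2 * (\<integral>z. indicator ?S z * (\<eta> z * X k z)\<^sup>2 \<partial>lborel)"
      using lam by (simp add: l2_square)
    also have "\<dots> = (\<integral>z. lam / 2 * (indicator ?S z * (\<eta> z * X k z)\<^sup>2) \<partial>lborel)" by simp
    finally show ?thesis by (simp add: power_mult_distrib mult_ac)
  qed
  also have "\<dots> \<le> (\<integral>z. indicator ?S z * ((\<Sum>i\<in>UNIV. g i z) + (\<alpha> * (\<Sum>i\<in>UNIV. (G i z)\<^sup>2) + \<beta> * E * (w z)\<^sup>2)) \<partial>lborel)"
    using low by (intro integral_adm_mono S adm_intros adm\<eta> adm admg) auto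
  also have "\<dots> = (\<Sum>i\<in>UNIV. \<integral>z. indicator ?S z * g i z \<partial>lborel) + (\<alpha> * (\<Sum>i\<in>UNIV. (l2 ?S (G i))\<^sup>2) + \<beta> * E * (l2 ?S w)\<^sup>2)"
  proof -
    have eq: "(\<lambda>z. indicator ?S z * ((\<Sum>i\<in>UNIV. g i z) + (\<alpha> * (\<Sum>i\<in>UNIV. (G i z)\<^sup>2) + \<beta> * E * (w z)\<^sup>2)))
      = (\<lambda>z. (\<Sum>i\<in>UNIV. indicator ?S z * g i z) + (\<alpha> * (\<Sum>i\<in>UNIV. indicator ?S z * (G i z)\<^sup>2) + \<beta> * E * (indicator ?S z * (w z)\<^sup>2)))"
      by (auto simp: fun_eq_iff indicator_def)
    have i: "integrable lborel (\<lambda>z. indicator ?S z * g i z)" "integrable lborel (\<lambda>z. indicator ?S z * (G i z)\<^sup>2)"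
       "integrable lborel (\<lambda>z. indicator ?S z * (w z)\<^sup>2)" for i
      by (intro adm_integrable S adm_intros adm admg)+
    show ?thesis unfolding eq l2_square unfolding sum_3 using i by simp
  qed
  also have "\<dots> = \<alpha> * (\<Sum>i\<in>UNIV. (l2 ?S (G i))\<^sup>2) + \<beta> * E * (l2 ?S w)\<^sup>2"
    by (simp add: int0)
  also have "\<dots> \<le> \<alpha> * (\<Sum>i\<in>UNIV. l2 ?S (G i))\<^sup>2 + 64 * \<beta> * (l2 ?S w / (\<rho> - r))\<^sup>2"
  proof -
    have "(\<Sum>i\<in>(UNIV::3 set). (l2 ?S (G i))\<^sup>2) \<le> (\<Sum>i\<in>UNIV. l2 ?S (G i))\<^sup>2"
      unfolding sum_3 using l2_nonneg[of ?S] by (simp add: power2_eq_square algebra_simps)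
    then show ?thesis using \<alpha>\<beta> by (intro add_mono mult_left_mono) (auto simp: E_def power_divide mult.commute[of 64])
  qed
  also have "\<dots> \<le> \<alpha> * ((\<Sum>i\<in>UNIV. l2 ?S (G i)) + l2 ?S w / (\<rho> - r))\<^sup>2 + 64 * \<beta> * ((\<Sum>i\<in>UNIV. l2 ?S (G i)) + l2 ?S w / (\<rho> - r))\<^sup>2"
    using \<alpha>\<beta> r l2_nonneg[of ?S] by (intro add_mono mult_left_mono power_mono) (auto intro!: sum_nonneg add_nonneg_nonneg)
  also have "\<dots> = lam / 2 * (cacc lam C * ((\<Sum>i\<in>UNIV. l2 ?S (G i)) + l2 ?S w / (\<rho> - r)))\<^sup>2"
  proof -
    have "lam / 2 * (cacc lam C)\<^sup>2 = \<alpha> + 64 * \<beta>"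
      using \<alpha>\<beta> lam unfolding cacc_def \<alpha>_def[symmetric] \<beta>_def[symmetric] by simp
    then have "lam / 2 * (cacc lam C * t)\<^sup>2 = \<alpha> * t\<^sup>2 + 64 * \<beta> * t\<^sup>2" for t
      by (simp add: power_mult_distrib distrib_right flip: mult.assoc)
    then show ?thesis by simp
  qed
  finally have "(l2 (half_ball r) (X k))\<^sup>2 \<le> (cacc lam C * ((\<Sum>i\<in>UNIV. l2 ?S (G i)) + l2 ?S w / (\<rho> - r)))\<^sup>2"
    using lam by simp
  moreover have "0 \<le> cacc lam C * ((\<Sum>i\<in>UNIV. l2 ?S (G i)) + l2 ?S w / (\<rho> - r))"
    using \<alpha>\<beta> r lam l2_nonneg[of ?S] unfolding cacc_def
    by (intro mult_nonneg_nonneg add_nonneg_nonneg sum_nonneg divide_nonneg_nonneg real_sqrt_ge_zero) auto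
  ultimately show ?thesis by (rule power2_le_imp_le)
qed

section \<open>Gradient norms and multi-indices\<close>

lemma nn_integral_adm:
  assumes "open S" "bounded S" "adm S h" "\<And>z. z \<in> S \<Longrightarrow> 0 \<le> h z"
  shows "(\<integral>\<^sup>+ z. indicator S z * ennreal (h z) \<partial>lborel) = ennreal (\<integral>z. indicator S z * h z \<partial>lborel)"
proof -
  have "(\<integral>\<^sup>+ z. indicator S z * ennreal (h z) \<partial>lborel) = (\<integral>\<^sup>+ z. ennreal (indicator S z * h z) \<partial>lborel)"
    by (intro nn_integral_cong) (auto simp: indicator_def)
  also have "\<dots> = ennreal (\<integral>z. indicator S z * h z \<partial>lborel)"
    using assms by (intro nn_integral_eq_integral adm_integrable) (auto simp: indicator_def)
  finally show ?thesis .
qed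

text \<open>Formulated through the square of \<open>g\<close>: gradient norms are square roots of
  sums of squares, and these sums are evidently in \<open>adm\<close>.\<close>

lemma L2norm_adm:
  assumes S: "open S" "bounded S" and h: "adm S h" and g: "\<And>z. z \<in> S \<Longrightarrow> (g z)\<^sup>2 = h z"
  shows "L2norm S g = ennreal (sqrt (\<integral>z. indicator S z * h z \<partial>lborel))"
proof -
  have pos: "0 \<le> h z" if "z \<in> S" for z using g[OF that] by (metis zero_le_power2)
  have "(\<integral>\<^sup>+ z. indicator S z * ennreal ((g z)\<^sup>2) \<partial>lborel) = (\<integral>\<^sup>+ z. indicator S z * ennreal (h z) \<partial>lborel)"
    using g by (intro nn_integral_cong) (auto simp: indicator_def)
  then have "(\<integral>\<^sup>+ z. indicator S z * ennreal ((g z)\<^sup>2) \<partial>lborel) = ennreal (\<integral>z. indicator S z * h z \<partial>lborel)"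
    using nn_integral_adm[OF S h pos] by simp
  moreover have "0 \<le> (\<integral>z. indicator S z * h z \<partial>lborel)"
    using pos by (intro integral_nonneg_AE AE_I2) (auto simp: indicator_def)
  ultimately show ?thesis by (simp add: L2norm_def Let_def)
qed

text \<open>Carries the hypotheses on the full half ball over to single derivatives on smaller ones.
  Monotonicity of the nonnegative integral asks for no measurability of \<open>h\<close>, and an
  infinite right-hand side is harmless.\<close>

lemma l2_le_L2norm:
  assumes S: "open S" "bounded S" and g: "adm S g" and T: "S \<subseteq> T"
    and gh: "\<And>z. z \<in> S \<Longrightarrow> \<bar>g z\<bar> \<le> \<bar>h z\<bar>"
  shows "ennreal (l2 S g) \<le> L2norm T h"
proof -
  define I where "I = (\<integral>\<^sup>+ z. indicator T z * ennreal ((h z)\<^sup>2) \<partial>lborel)"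
  have "ennreal ((l2 S g)\<^sup>2) = (\<integral>\<^sup>+ z. indicator S z * ennreal ((g z)\<^sup>2) \<partial>lborel)"
    unfolding l2_square using S g by (intro nn_integral_adm[symmetric] adm_power) auto
  also have "\<dots> \<le> I"
    unfolding I_def using T gh
    by (intro nn_integral_mono) (auto simp: indicator_def abs_le_square_iff intro!: ennreal_leI)
  finally have le: "ennreal ((l2 S g)\<^sup>2) \<le> I" .
  show ?thesis
  proof (cases "I = \<infinity>")
    case False
    then have "(l2 S g)\<^sup>2 \<le> enn2real I"
      using enn2real_mono[OF le] by (simp add: less_top)
    then have "l2 S g \<le> sqrt (enn2real I)" by (rule real_le_rsqrt)
    then show ?thesis using False by (simp add: L2norm_def Let_def I_def[symmetric] ennreal_leI)
  qed (simp add: L2norm_def Let_def I_def[symmetric])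
qed

section \<open>Multi-indices and their weights\<close>

definition mi_of :: "3 list \<Rightarrow> 3 \<Rightarrow> nat" where
  "mi_of ds i = count (mset ds) i"

lemma mset_mi_list: "mset (mi_list (mi_of ds)) = mset ds"
proof (rule multiset_eqI)
  fix x :: 3
  show "count (mset (mi_list (mi_of ds))) x = count (mset ds) x"
    using exhaust_3[of x] by (auto simp: mi_list_def mi_of_def)
qed

lemma mi_abs_mi_of: "mi_abs (mi_of ds) = length ds"
proof (induction ds)
  case (Cons d ds)
  then show ?case using exhaust_3[of d] by (auto simp: mi_abs_def mi_of_def sum_3)
qed (simp add: mi_abs_def mi_of_def)

lemma finite_mi_abs: "finite {\<alpha>. mi_abs \<alpha> = n}"
proof (rule finite_subset)
  show "{\<alpha>. mi_abs \<alpha> = n} \<subseteq> (\<Pi>\<^sub>E i\<in>UNIV. {..n})"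
    by (auto simp: PiE_def mi_abs_def extensional_def intro: member_le_sum[of _ UNIV])
qed (intro finite_PiE; simp)

lemma mi_fact_3: "mi_fact \<alpha> = fact (\<alpha> 1) * fact (\<alpha> 2) * fact (\<alpha> 3)"
  unfolding mi_fact_def UNIV_3 by simp

lemma mi_fact_le: "real (mi_fact \<alpha>) \<le> fact (mi_abs \<alpha>)"
proof -
  have "fact (\<alpha> 1) * fact (\<alpha> 2) * fact (\<alpha> 3) \<le> (fact (\<alpha> 1 + \<alpha> 2) * fact (\<alpha> 3) :: nat)"
    by (rule mult_right_mono, rule dvd_imp_le, rule fact_fact_dvd_fact) auto
  also have "\<dots> \<le> fact (\<alpha> 1 + \<alpha> 2 + \<alpha> 3)" by (intro dvd_imp_le fact_fact_dvd_fact) auto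
  finally have "mi_fact \<alpha> \<le> fact (mi_abs \<alpha>)" by (simp add: mi_fact_3 mi_abs_def sum_3)
  then show ?thesis by (metis of_nat_fact of_nat_le_iff)
qed

lemma mi_fact_pos: "0 < mi_fact \<alpha>"
  by (simp add: mi_fact_def)

text \<open>The multinomial weights are at least 1 by \<open>mi_fact_le\<close>, so a single
  derivative is dominated by the gradient norm of its order.\<close>

lemma weighted_term_le_sqrt_sum:
  assumes "mi_abs \<alpha> = n" "0 \<le> t" "\<And>\<beta>. 0 \<le> c \<beta>" "t\<^sup>2 \<le> c \<alpha>"
  shows "t \<le> sqrt (\<Sum>\<alpha>\<in>{\<alpha>. mi_abs \<alpha> = n}. (fact n / real (mi_fact \<alpha>)) * c \<alpha>)"
proof (rule real_le_rsqrt)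
  have "t\<^sup>2 \<le> 1 * c \<alpha>" using assms by simp
  also have "\<dots> \<le> (fact n / real (mi_fact \<alpha>)) * c \<alpha>"
    using mi_fact_le[of \<alpha>] mi_fact_pos[of \<alpha>] assms by (intro mult_right_mono) (auto simp: pos_le_divide_eq)
  also have "\<dots> \<le> (\<Sum>\<alpha>\<in>{\<alpha>. mi_abs \<alpha> = n}. (fact n / real (mi_fact \<alpha>)) * c \<alpha>)"
    by (rule member_le_sum) (use assms finite_mi_abs in auto)
  finally show "t\<^sup>2 \<le> (\<Sum>\<alpha>\<in>{\<alpha>. mi_abs \<alpha> = n}. (fact n / real (mi_fact \<alpha>)) * c \<alpha>)" .
qed

lemma pdiff_le_grad_norm:
  assumes "open S" "smooth_on S v" "z \<in> S"
  shows "\<bar>pdiff ds v z\<bar> \<le> grad_norm (length ds) v z"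
proof -
  have "pdiff ds v z = Dmi (mi_of ds) v z"
    unfolding Dmi_def by (rule pdiff_mset[OF assms(1,2) _ assms(3)]) (simp add: mset_mi_list)
  then show ?thesis
    unfolding grad_norm_def by (intro weighted_term_le_sqrt_sum[of "mi_of ds"]) (auto simp: mi_abs_mi_of)
qed

lemma pdiff_le_mgrad_norm:
  assumes "open S" "smooth_on S (\<lambda>w. A w $ i $ j)" "z \<in> S"
  shows "\<bar>pdiff ds (\<lambda>w. A w $ i $ j) z\<bar> \<le> mgrad_norm (length ds) A z"
proof -
  have eq: "pdiff ds (\<lambda>w. A w $ i $ j) z = Dmi (mi_of ds) (\<lambda>w. A w $ i $ j) z"
    unfolding Dmi_def by (rule pdiff_mset[OF assms(1,2) _ assms(3)]) (simp add: mset_mi_list)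
  let ?M = "(\<chi> i j. Dmi (mi_of ds) (\<lambda>w. A w $ i $ j) z) :: real^3^3"
  have "\<bar>?M $ i $ j\<bar> \<le> norm (?M $ i)" by (rule component_le_norm_cart)
  also have "\<dots> \<le> norm ?M" by (rule Finite_Cartesian_Product.norm_nth_le)
  finally have "\<bar>pdiff ds (\<lambda>w. A w $ i $ j) z\<bar> \<le> norm ?M" by (simp add: eq)
  then have "\<bar>pdiff ds (\<lambda>w. A w $ i $ j) z\<bar>\<^sup>2 \<le> (norm ?M)\<^sup>2" by (intro power_mono) auto
  then show ?thesis
    unfolding mgrad_norm_def by (intro weighted_term_le_sqrt_sum[of "mi_of ds"]) (auto simp: mi_abs_mi_of)
qed

text \<open>The tangential multi-indices of order \<open>p\<close> are parametrised by their first entry, and their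
weights are the binomial coefficients.\<close>

lemma sum_tangential_weights:
  "finite {\<alpha>. \<alpha> 3 = 0 \<and> mi_abs \<alpha> = p}"
  "(\<Sum>\<alpha>\<in>{\<alpha>. \<alpha> 3 = 0 \<and> mi_abs \<alpha> = p}. fact p / real (mi_fact \<alpha>)) = 2 ^ p"
proof -
  show "finite {\<alpha>. \<alpha> 3 = 0 \<and> mi_abs \<alpha> = p}" by (rule finite_subset[OF _ finite_mi_abs[of p]]) auto
  define \<alpha> :: "nat \<Rightarrow> 3 \<Rightarrow> nat" where "\<alpha> k i = (if i = 1 then k else if i = 2 then p - k else 0)" for k i
  have img: "{\<alpha>. \<alpha> 3 = 0 \<and> mi_abs \<alpha> = p} = \<alpha> ` {..p}"
  proof (intro equalityI subsetI)
    fix \<beta> :: "3 \<Rightarrow> nat" assume "\<beta> \<in> {\<alpha>. \<alpha> 3 = 0 \<and> mi_abs \<alpha> = p}"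
    then have b: "\<beta> 3 = 0" "\<beta> 1 + \<beta> 2 = p" by (auto simp: mi_abs_def sum_3)
    have "\<beta> i = \<alpha> (\<beta> 1) i" for i using b exhaust_3[of i] by (auto simp: \<alpha>_def)
    then have "\<beta> = \<alpha> (\<beta> 1)" by (rule ext)
    moreover have "\<beta> 1 \<in> {..p}" using b by simp
    ultimately show "\<beta> \<in> \<alpha> ` {..p}" by (rule image_eqI)
  qed (auto simp: \<alpha>_def mi_abs_def sum_3)
  have inj: "inj_on \<alpha> {..p}" by (rule inj_onI) (metis \<alpha>_def)
  have "(\<Sum>\<alpha>\<in>{\<alpha>. \<alpha> 3 = 0 \<and> mi_abs \<alpha> = p}. fact p / real (mi_fact \<alpha>)) = (\<Sum>k\<le>p. fact p / real (mi_fact (\<alpha> k)))"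
    unfolding img by (subst sum.reindex[OF inj]) simp
  also have "\<dots> = (\<Sum>k\<le>p. real (p choose k))"
    by (intro sum.cong refl) (simp add: mi_fact_3 \<alpha>_def binomial_fact)
  also have "\<dots> = real (\<Sum>k\<le>p. p choose k)" by simp
  also have "\<dots> = 2 ^ p" by (simp only: choose_row_sum) simp
  finally show "(\<Sum>\<alpha>\<in>{\<alpha>. \<alpha> 3 = 0 \<and> mi_abs \<alpha> = p}. fact p / real (mi_fact \<alpha>)) = 2 ^ p" .
qed

text \<open>The weights add up to \<open>2 ^ p\<close>, so a common bound for all derivatives costs
  the square root of \<open>2 ^ p\<close>, estimated crudely by \<open>2 ^ p\<close>. This is why
  \<open>2 * K1\<close> takes the place of \<open>K1\<close> in the final bound.\<close>

lemma L2norm_tan_grad_norm_le: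
  assumes S: "open S" "bounded S" and adm: "\<And>ds. adm S (pdiff ds v)" and B: "0 \<le> B"
    and le: "\<And>\<alpha>. \<alpha> 3 = 0 \<Longrightarrow> mi_abs \<alpha> = p \<Longrightarrow> l2 S (Dmi (\<alpha>(3 := k)) v) \<le> B"
  shows "L2norm S (tan_grad_norm k p v) \<le> ennreal (2 ^ p * B)"
proof -
  let ?T = "{\<alpha>. \<alpha> 3 = 0 \<and> mi_abs \<alpha> = p}"
  define c where "c \<alpha> = fact p / real (mi_fact \<alpha>)" for \<alpha>
  have c: "0 \<le> c \<alpha>" for \<alpha> by (simp add: c_def)
  define h where "h z = (\<Sum>\<alpha>\<in>?T. c \<alpha> * (Dmi (\<alpha>(3 := k)) v z)\<^sup>2)" for z
  have admD: "adm S (\<lambda>z. (Dmi \<beta> v z)\<^sup>2)" for \<beta> unfolding Dmi_def by (intro adm_power adm)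
  have h: "adm S h" unfolding h_def[abs_def] by (intro adm_intros admD)
  have "(tan_grad_norm k p v z)\<^sup>2 = h z" for z
    unfolding tan_grad_norm_def h_def c_def by (intro real_sqrt_pow2 sum_nonneg) auto
  then have "L2norm S (tan_grad_norm k p v) = ennreal (sqrt (\<integral>z. indicator S z * h z \<partial>lborel))"
    by (intro L2norm_adm S h)
  also have "(\<integral>z. indicator S z * h z \<partial>lborel) = (\<Sum>\<alpha>\<in>?T. c \<alpha> * (l2 S (Dmi (\<alpha>(3 := k)) v))\<^sup>2)"
  proof -
    have "(\<lambda>z. indicator S z * h z) = (\<lambda>z. \<Sum>\<alpha>\<in>?T. c \<alpha> * (indicator S z * (Dmi (\<alpha>(3 := k)) v z)\<^sup>2))"
      unfolding h_def sum_distrib_left by (simp only: mult_ac)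
    then show ?thesis unfolding l2_square using adm_integrable[OF S admD] by simp
  qed
  also have "sqrt \<dots> \<le> sqrt (\<Sum>\<alpha>\<in>?T. c \<alpha> * B\<^sup>2)"
    using le c by (intro real_sqrt_le_mono sum_mono mult_left_mono power_mono l2_nonneg) auto
  also have "(\<Sum>\<alpha>\<in>?T. c \<alpha> * B\<^sup>2) = 2 ^ p * B\<^sup>2"
    unfolding c_def sum_distrib_right[symmetric] sum_tangential_weights ..
  also have "sqrt \<dots> = sqrt (2 ^ p) * B" using B by (simp add: real_sqrt_mult)
  also have "\<dots> \<le> 2 ^ p * B"
  proof -
    have "sqrt (2 ^ p) \<le> sqrt ((2 ^ p)\<^sup>2)"
      using self_le_power[of "2 ^ p :: real" 2] by (intro real_sqrt_le_mono) auto
    then show ?thesis using B by (intro mult_right_mono) auto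
  qed
  finally show ?thesis by (simp add: ennreal_leI)
qed

section \<open>The Dirichlet problem on a half ball\<close>

text \<open>Boundary values are limits from inside, since smoothness on the open half ball says
  nothing about \<open>pdiff\<close> at points of the flat boundary.\<close>

definition vanishing :: "real \<Rightarrow> (real^3 \<Rightarrow> real) \<Rightarrow> bool" where
  "vanishing R v \<longleftrightarrow> (\<forall>z0\<in>flat_bdry R. (v \<longlongrightarrow> 0) (at z0 within half_ball R))"

lemma vanishing_near:
  assumes "vanishing R v" "z0 \<in> flat_bdry R" "e > 0"
  obtains d where "d > 0" "\<And>z. z \<in> half_ball R \<Longrightarrow> dist z z0 < d \<Longrightarrow> \<bar>v z\<bar> < e"
proof -
  have "\<forall>\<^sub>F z in at z0 within half_ball R. dist (v z) 0 < e"
    using assms tendstoD[of v 0 _ e] unfolding vanishing_def by blast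
  then obtain d where "d > 0" "\<And>z. z \<in> half_ball R \<Longrightarrow> z \<noteq> z0 \<Longrightarrow> dist z z0 < d \<Longrightarrow> dist (v z) 0 < e"
    unfolding eventually_at by auto
  moreover have "z0 \<notin> half_ball R" using assms by (auto simp: half_ball_def flat_bdry_def)
  ultimately show ?thesis by (intro that[of d]) (auto simp: dist_real_def)
qed

lemma line_MVT:
  assumes sm: "smooth_on U v" and s: "a < b"
    and seg: "\<And>t. a \<le> t \<Longrightarrow> t \<le> b \<Longrightarrow> z + t *\<^sub>R axis i 1 \<in> U"
  obtains t where "a < t" "t < b" "v (z + b *\<^sub>R axis i 1) - v (z + a *\<^sub>R axis i 1) = (b - a) * pdiff [i] v (z + t *\<^sub>R axis i 1)"
proof -
  have der: "((\<lambda>t. v (z + t *\<^sub>R axis i 1)) has_real_derivative pdiff [i] v (z + t *\<^sub>R axis i 1)) (at t)"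
    if "a \<le> t" "t \<le> b" for t
    by (rule DERIV_line_shift) (use smooth_on_DERIV[OF sm seg[OF that], of "[]" i] in simp)
  show ?thesis using MVT2[OF s der] that by blast
qed

text \<open>The mean value theorem is applied along tangential segments pushed towards the flat
boundary.\<close>

lemma vanishing_tangential:
  assumes sm: "smooth_on (half_ball R) v" and van: "vanishing R v" and d: "d \<noteq> 3"
    and g: "continuous_on (half_ball R \<union> flat_bdry R) g"
    and gv: "\<And>z. z \<in> half_ball R \<Longrightarrow> g z = pdiff [d] v z"
  shows "vanishing R (pdiff [d] v)"
  unfolding vanishing_def
proof
  fix z0 assume z0: "z0 \<in> flat_bdry R"
  have z0n: "z0 \<notin> half_ball R" "norm z0 < R" "z0 $ 3 = 0" using z0 by (auto simp: half_ball_def flat_bdry_def)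
  have "(g \<longlongrightarrow> g z0) (at z0 within half_ball R)"
    using g z0 unfolding continuous_on_def by (meson UnI2 inf_sup_ord(3) tendsto_within_subset)
  then have lim: "(pdiff [d] v \<longlongrightarrow> g z0) (at z0 within half_ball R)"
    by (rule Lim_transform_eventually) (auto simp: gv eventually_at_filter)
  have "g z0 = 0"
  proof (rule ccontr)
    assume "g z0 \<noteq> 0"
    define L where "L = \<bar>g z0\<bar>"
    have L: "L > 0" using \<open>g z0 \<noteq> 0\<close> by (simp add: L_def)
    have "\<forall>\<^sub>F z in at z0 within half_ball R. dist (pdiff [d] v z) (g z0) < L / 2"
      using lim L by (intro tendstoD) auto
    then obtain \<eta> where \<eta>: "\<eta> > 0" and
      near: "\<And>z. z \<in> half_ball R \<Longrightarrow> dist z z0 < \<eta> \<Longrightarrow> dist (pdiff [d] v z) (g z0) < L / 2"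
      using z0n unfolding eventually_at by metis
    define s where "s = min \<eta> (R - norm z0) / 3"
    have s: "s > 0" "3 * s \<le> \<eta>" "3 * s \<le> R - norm z0" using \<eta> z0n by (auto simp: s_def)
    have comp: "(z0 + y *\<^sub>R axis 3 1 + x *\<^sub>R axis d 1) $ 3 = y" for x y
      using d z0n by (simp add: axis_def)
    have nrm: "norm (y *\<^sub>R axis 3 1 + x *\<^sub>R axis d 1 :: real^3) < 3 * s"
      if "0 \<le> x" "x \<le> s" "0 \<le> y" "y \<le> s" for x y
      using that s norm_triangle_ineq[of "y *\<^sub>R axis 3 1 :: real^3" "x *\<^sub>R axis d 1"] by (simp add: norm_axis_1)
    have inR: "norm (z0 + y *\<^sub>R axis 3 1 + x *\<^sub>R axis d 1) < R"
      "dist (z0 + y *\<^sub>R axis 3 1 + x *\<^sub>R axis d 1) z0 < \<eta>"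
      if "0 \<le> x" "x \<le> s" "0 \<le> y" "y \<le> s" for x y
      using nrm[OF that] s norm_triangle_ineq[of z0 "y *\<^sub>R axis 3 1 + x *\<^sub>R axis d 1"]
      by (auto simp: dist_norm add.assoc)
    define z1 where "z1 = z0 + s *\<^sub>R axis d 1"
    have z1: "z1 \<in> flat_bdry R"
      using inR(1)[of s 0] comp[of 0 s] s by (simp add: z1_def flat_bdry_def)
    \<comment> \<open>If the limit were nonzero, the derivative would exceed \<open>L / 2\<close> in
      size along a segment of length \<open>s\<close>, and \<open>v\<close> would change by more
      than \<open>s * L / 2\<close>. End values below \<open>e\<close> rule this out.\<close>
    define e where "e = s * L / 4"
    have e: "e > 0" using s L by (simp add: e_def)
    obtain d0 where d0: "d0 > 0" "\<And>z. z \<in> half_ball R \<Longrightarrow> dist z z0 < d0 \<Longrightarrow> \<bar>v z\<bar> < e"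
      using vanishing_near[OF van z0 e] by metis
    obtain d1 where d1: "d1 > 0" "\<And>z. z \<in> half_ball R \<Longrightarrow> dist z z1 < d1 \<Longrightarrow> \<bar>v z\<bar> < e"
      using vanishing_near[OF van z1 e] by metis
    define y where "y = min s (min d0 d1) / 2"
    have y: "0 < y" "y \<le> s" "y < d0" "y < d1" using s d0 d1 by (auto simp: y_def)
    have seg: "z0 + y *\<^sub>R axis 3 1 + x *\<^sub>R axis d 1 \<in> half_ball R" if "0 \<le> x" "x \<le> s" for x
      using inR(1)[of x y] comp[of y x] that y by (simp add: half_ball_def)
    obtain t where t: "0 < t" "t < s" and
      mvt: "v (z0 + y *\<^sub>R axis 3 1 + s *\<^sub>R axis d 1) - v (z0 + y *\<^sub>R axis 3 1 + 0 *\<^sub>R axis d 1)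
        = (s - 0) * pdiff [d] v (z0 + y *\<^sub>R axis 3 1 + t *\<^sub>R axis d 1)"
      using line_MVT[OF sm s(1) seg] by metis
    have "dist (pdiff [d] v (z0 + y *\<^sub>R axis 3 1 + t *\<^sub>R axis d 1)) (g z0) < L / 2"
      using t y by (intro near seg inR) auto
    then have "\<bar>pdiff [d] v (z0 + y *\<^sub>R axis 3 1 + t *\<^sub>R axis d 1)\<bar> > L / 2"
      unfolding L_def dist_real_def by linarith
    then have "s * (L / 2) < \<bar>v (z0 + y *\<^sub>R axis 3 1 + s *\<^sub>R axis d 1) - v (z0 + y *\<^sub>R axis 3 1 + 0 *\<^sub>R axis d 1)\<bar>"
      unfolding mvt abs_mult using s by simp
    moreover have "\<bar>v (z0 + y *\<^sub>R axis 3 1 + 0 *\<^sub>R axis d 1)\<bar> < e"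
      using y s by (intro d0 seg) (auto simp: dist_norm norm_axis_1)
    moreover have "\<bar>v (z0 + y *\<^sub>R axis 3 1 + s *\<^sub>R axis d 1)\<bar> < e"
      using y s by (intro d1 seg) (auto simp: dist_norm norm_axis_1 z1_def)
    ultimately show False unfolding e_def by linarith
  qed
  then show "(pdiff [d] v \<longlongrightarrow> 0) (at z0 within half_ball R)" using lim by simp
qed

text \<open>The mean value theorem on the normal segment from the foot point to \<open>z\<close>.
  The segment starts at a small height \<open>y\<close>, because at the foot point only a limit of
  \<open>v\<close> is known; this causes the error \<open>e\<close>.\<close>

lemma vanishing_linear_bound:
  assumes sm: "smooth_on (half_ball R) v" and van: "vanishing R v" and r: "r \<le> R"
    and B: "\<And>z. z \<in> half_ball r \<Longrightarrow> \<bar>pdiff [3] v z\<bar> \<le> B" and z: "z \<in> half_ball r"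
  shows "\<bar>v z\<bar> \<le> B * z $ 3"
proof (rule field_le_epsilon)
  fix e :: real assume e: "e > 0"
  define z0 where "z0 = z - (z $ 3) *\<^sub>R axis 3 1"
  have z3: "z $ 3 > 0" "norm z < r" using z by (auto simp: half_ball_def)
  have line: "norm (z0 + t *\<^sub>R axis 3 1) \<le> norm z" if "0 \<le> t" "t \<le> z $ 3" for t
    using that by (intro norm_le_componentwise_cart) (auto simp: z0_def axis_def)
  have comp: "(z0 + t *\<^sub>R axis 3 1) $ 3 = t" for t by (simp add: z0_def axis_def)
  have inr: "z0 + t *\<^sub>R axis 3 1 \<in> half_ball r" if "0 < t" "t \<le> z $ 3" for t
    using line[of t] comp[of t] that z3 by (simp add: half_ball_def)
  have "z0 \<in> flat_bdry R" using line[of 0] comp[of 0] z3 r by (simp add: flat_bdry_def)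
  then obtain d where d: "d > 0" "\<And>z. z \<in> half_ball R \<Longrightarrow> dist z z0 < d \<Longrightarrow> \<bar>v z\<bar> < e"
    using vanishing_near[OF van _ e] by metis
  define y where "y = min d (z $ 3) / 2"
  have y: "0 < y" "y < z $ 3" "y < d" using d z3 by (auto simp: y_def)
  have inR: "z0 + t *\<^sub>R axis 3 1 \<in> half_ball R" if "y \<le> t" "t \<le> z $ 3" for t
    using inr[of t] half_ball_mono[OF r] that y by auto
  obtain t where t: "y < t" "t < z $ 3" and
    mvt: "v (z0 + (z $ 3) *\<^sub>R axis 3 1) - v (z0 + y *\<^sub>R axis 3 1) = (z $ 3 - y) * pdiff [3] v (z0 + t *\<^sub>R axis 3 1)"
    using line_MVT[OF sm y(2) inR] by metis
  have t': "z0 + t *\<^sub>R axis 3 1 \<in> half_ball r" using inr[of t] t y by auto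
  have "\<bar>v (z0 + (z $ 3) *\<^sub>R axis 3 1) - v (z0 + y *\<^sub>R axis 3 1)\<bar> \<le> (z $ 3) * B"
    unfolding mvt abs_mult using y B[OF t'] by (intro mult_mono) auto
  moreover have "\<bar>v (z0 + y *\<^sub>R axis 3 1)\<bar> < e"
    using y by (intro d inR) (auto simp: dist_norm norm_axis_1)
  moreover have "z0 + (z $ 3) *\<^sub>R axis 3 1 = z" by (simp add: z0_def)
  ultimately show "\<bar>v z\<bar> \<le> B * z $ 3 + e" by (simp add: mult.commute)
qed

text \<open>\<open>\<rho>\<close> stands for R/\<epsilon> and \<open>U\<close> for a bound on the
  gradient of \<open>u\<close>. \<open>C\<close> is made nonnegative and \<open>\<gamma>\<close>,
  \<open>\<gamma>f\<close> at least 1 so that powers can be compared. In the bound on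
  \<open>f\<close> the division by \<open>R\<close> is pulled out of the maximum, ready to cancel
  against powers of \<open>R - r\<close>.\<close>

locale elliptic_problem =
  fixes R lam C \<gamma> \<gamma>f Cf \<rho> U :: real and A :: "real^3 \<Rightarrow> real^3^3" and f u :: "real^3 \<Rightarrow> real"
  assumes R: "0 < R" "R \<le> 1" and lam: "0 < lam" and C: "0 \<le> C" and \<gamma>: "1 \<le> \<gamma>" and \<gamma>f: "1 \<le> \<gamma>f"
    and Cf: "0 \<le> Cf" and \<rho>: "0 \<le> \<rho>" and U: "0 \<le> U"
    and coercive: "\<And>z \<xi>. z \<in> half_ball R \<Longrightarrow> lam * (norm \<xi>)\<^sup>2 \<le> \<xi> \<bullet> (A z *v \<xi>)"
    and A_smooth: "\<And>i j. smooth_on (half_ball R) (\<lambda>w. A w $ i $ j)"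
    and mgrad_A: "\<And>n z. z \<in> half_ball R \<Longrightarrow> mgrad_norm n A z \<le> C * \<gamma> ^ n * fact n"
    and u_smooth: "smooth_on (half_ball R) u"
    and u_ext: "\<And>ds. \<exists>g. continuous_on (half_ball R \<union> flat_bdry R) g \<and> (\<forall>z\<in>half_ball R. g z = pdiff ds u z)"
    and u_cont: "continuous_on (half_ball R \<union> flat_bdry R) u"
    and u_flat: "\<And>z. z \<in> flat_bdry R \<Longrightarrow> u z = 0"
    and pde: "\<And>z. z \<in> half_ball R \<Longrightarrow>
      - (\<Sum>i\<in>UNIV. partial i (\<lambda>w. \<Sum>j\<in>UNIV. A w $ i $ j * partial j u w) z) = f z"
    and grad_u: "L2norm (half_ball R) (grad_norm 1 u) \<le> ennreal U"
    and grad_f: "\<And>p. L2norm (half_ball R) (grad_norm p f)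
      \<le> ennreal (Cf * \<gamma>f ^ p * (max (real p) \<rho> / R) ^ p)"
begin

abbreviation H where "H \<equiv> half_ball R"

lemmas H = open_half_ball[of R]

lemma A_bound:
  "z \<in> H \<Longrightarrow> \<bar>pdiff ds (\<lambda>w. A w $ i $ j) z\<bar> \<le> C * \<gamma> ^ length ds * fact (length ds)"
  by (rule order_trans[OF pdiff_le_mgrad_norm[OF H A_smooth] mgrad_A])

section \<open>The flux and the right-hand side\<close>

definition flux :: "3 \<Rightarrow> real^3 \<Rightarrow> real" where
  "flux i w = (\<Sum>j\<in>UNIV. A w $ i $ j * partial j u w)"

lemma smooth_partial_u: "smooth_on H (partial j u)"
  using smooth_on_pdiff[OF u_smooth, of "[j]"] by simp

lemma flux_smooth: "smooth_on H (flux i)"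
  unfolding flux_def[abs_def] by (intro smooth_on_sum smooth_on_mult H A_smooth smooth_partial_u)

lemma pdiff_flux:
  assumes "z \<in> H"
  shows "pdiff ds (flux i) z =
    (\<Sum>j\<in>UNIV. leib ds (\<lambda>a b. pdiff a (\<lambda>w. A w $ i $ j) z * pdiff (b @ [j]) u z))"
proof -
  have "pdiff ds (flux i) z = (\<Sum>j\<in>UNIV. pdiff ds (\<lambda>w. A w $ i $ j * partial j u w) z)"
    unfolding flux_def[abs_def] by (intro pdiff_sum[OF H] smooth_on_mult H A_smooth smooth_partial_u assms)
  also have "\<dots> = (\<Sum>j\<in>UNIV. leib ds (\<lambda>a b. pdiff a (\<lambda>w. A w $ i $ j) z * pdiff b (partial j u) z))"
    by (intro sum.cong refl pdiff_mult[OF H A_smooth smooth_partial_u assms])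
  finally show ?thesis by (simp add: pdiff_append)
qed

lemma f_eq: "z \<in> H \<Longrightarrow> f z = - (\<Sum>i\<in>UNIV. pdiff [i] (flux i) z)"
  using pde[of z] by (simp add: flux_def[abs_def])

lemma smooth_div_flux: "smooth_on H (\<lambda>z. - (\<Sum>i\<in>UNIV. pdiff [i] (flux i) z))"
  by (intro smooth_on_uminus smooth_on_sum smooth_on_pdiff flux_smooth H)

text \<open>The hypotheses only bound norms of \<open>f\<close>; its regularity is inherited from
  \<open>A\<close> and \<open>u\<close> through the equation.\<close>

lemma f_smooth: "smooth_on H f"
  by (rule smooth_on_cong[OF H smooth_div_flux]) (simp only: f_eq)

lemma pdiff_f:
  assumes "z \<in> H"
  shows "pdiff ds f z = - (\<Sum>i\<in>UNIV. pdiff (ds @ [i]) (flux i) z)"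
proof -
  have "pdiff ds f z = pdiff ds (\<lambda>z. - (\<Sum>i\<in>UNIV. pdiff [i] (flux i) z)) z"
    by (rule pdiff_cong[OF H smooth_div_flux _ assms]) (simp only: f_eq)
  also have "\<dots> = - pdiff ds (\<lambda>z. \<Sum>i\<in>UNIV. pdiff [i] (flux i) z) z"
    by (intro pdiff_uminus[OF H] H smooth_on_sum smooth_on_pdiff flux_smooth assms)
  also have "pdiff ds (\<lambda>z. \<Sum>i\<in>UNIV. pdiff [i] (flux i) z) z = (\<Sum>i\<in>UNIV. pdiff ds (pdiff [i] (flux i)) z)"
    by (intro pdiff_sum[OF H] smooth_on_pdiff flux_smooth assms)
  finally show ?thesis by (simp only: pdiff_append)
qed

text \<open>The closed half ball of radius \<open>r\<close> is compact and contained in the set to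
  which all derivatives extend continuously.\<close>

lemma adm_u:
  assumes "r < R" shows "adm (half_ball r) (pdiff ds u)"
proof -
  obtain g where g: "continuous_on (half_ball R \<union> flat_bdry R) g" "\<And>z. z \<in> half_ball R \<Longrightarrow> g z = pdiff ds u z"
    using u_ext by metis
  define T where "T = cball 0 r \<inter> {z::real^3. z $ 3 \<ge> 0}"
  have "compact T" unfolding T_def
    by (intro compact_Int_closed compact_cball closed_Collect_le continuous_intros)
  moreover have T: "T \<subseteq> half_ball R \<union> flat_bdry R"
    using assms by (auto simp: T_def half_ball_def flat_bdry_def)
  ultimately have "compact (g ` T)" using g(1) by (intro compact_continuous_image continuous_on_subset[OF g(1)])
  then obtain B where B: "\<And>z. z \<in> T \<Longrightarrow> norm (g z) \<le> B"
    by (meson bounded_iff compact_imp_bounded imageI)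
  have "half_ball r \<subseteq> T" "half_ball r \<subseteq> H" using assms by (auto simp: T_def half_ball_def)
  then have "\<bar>pdiff ds u z\<bar> \<le> B" if "z \<in> half_ball r" for z
    using B g(2) that by (metis subsetD real_norm_def)
  moreover have "continuous_on (half_ball r) (pdiff ds u)"
    using smooth_on_continuous[OF u_smooth] \<open>half_ball r \<subseteq> H\<close> continuous_on_subset by blast
  ultimately show ?thesis by (auto simp: adm_def)
qed

lemma adm_A:
  assumes "r < R" shows "adm (half_ball r) (pdiff ds (\<lambda>w. A w $ i $ j))"
proof -
  have "half_ball r \<subseteq> H" using assms by (intro half_ball_mono) simp
  then show ?thesis unfolding adm_def
    using A_bound[of _ ds i j] smooth_on_continuous[OF A_smooth] by (blast intro: continuous_on_subset)
qed

lemma adm_flux: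
  assumes "r < R" shows "adm (half_ball r) (pdiff ds (flux i))"
proof -
  have "adm (half_ball r) (\<lambda>z. \<Sum>j\<in>UNIV. leib ds (\<lambda>a b. pdiff a (\<lambda>w. A w $ i $ j) z * pdiff (b @ [j]) u z))"
    using assms by (intro adm_intros adm_A adm_u)
  moreover have "half_ball r \<subseteq> H" using assms by (intro half_ball_mono) simp
  ultimately show ?thesis using pdiff_flux by (subst adm_cong) auto
qed

lemma adm_f:
  assumes "r < R" shows "adm (half_ball r) (pdiff ds f)"
proof -
  have "adm (half_ball r) (\<lambda>z. - (\<Sum>i\<in>UNIV. pdiff (ds @ [i]) (flux i) z))"
    using assms by (intro adm_intros adm_flux)
  moreover have "half_ball r \<subseteq> H" using assms by (intro half_ball_mono) simp
  ultimately show ?thesis using pdiff_f by (subst adm_cong) auto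
qed

lemma U_bound:
  assumes "r < R" shows "l2 (half_ball r) (pdiff [j] u) \<le> U"
proof -
  have "ennreal (l2 (half_ball r) (pdiff [j] u)) \<le> L2norm H (grad_norm 1 u)"
  proof (rule l2_le_L2norm[OF open_half_ball bounded_half_ball adm_u[OF assms] half_ball_mono])
    fix z assume "z \<in> half_ball r"
    then have "z \<in> H" using half_ball_mono[of r R] assms by auto
    then show "\<bar>pdiff [j] u z\<bar> \<le> \<bar>grad_norm 1 u z\<bar>"
      using pdiff_le_grad_norm[OF H u_smooth, of z "[j]"] by simp
  qed (use assms in simp)
  also note grad_u
  finally show ?thesis using U by (simp only: ennreal_le_iff)
qed

lemma f_bound:
  assumes "r < R"
  shows "l2 (half_ball r) (pdiff ds f)
    \<le> Cf * \<gamma>f ^ length ds * (max (real (length ds)) \<rho> / R) ^ length ds"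
proof -
  have "ennreal (l2 (half_ball r) (pdiff ds f)) \<le> L2norm H (grad_norm (length ds) f)"
  proof (rule l2_le_L2norm[OF open_half_ball bounded_half_ball adm_f[OF assms] half_ball_mono])
    fix z assume "z \<in> half_ball r"
    then have "z \<in> H" using half_ball_mono[of r R] assms by auto
    then show "\<bar>pdiff ds f z\<bar> \<le> \<bar>grad_norm (length ds) f z\<bar>"
      using pdiff_le_grad_norm[OF H f_smooth, of z ds] by simp
  qed (use assms in simp)
  also note grad_f
  finally show ?thesis using Cf \<gamma>f R by (subst (asm) ennreal_le_iff) auto
qed

lemma vanishing_u: "3 \<notin> set ds \<Longrightarrow> vanishing R (pdiff ds u)"
proof (induction ds)
  case Nil
  have "(u \<longlongrightarrow> u z0) (at z0 within half_ball R)" if "z0 \<in> flat_bdry R" for z0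
    using u_cont that unfolding continuous_on_def by (meson UnI2 inf_sup_ord(3) tendsto_within_subset)
  then show ?case using u_flat unfolding vanishing_def by force
next
  case (Cons d ds)
  obtain g where g: "continuous_on (half_ball R \<union> flat_bdry R) g" "\<And>z. z \<in> half_ball R \<Longrightarrow> g z = pdiff (d # ds) u z"
    using u_ext by metis
  have "vanishing R (pdiff [d] (pdiff ds u))"
    using Cons by (intro vanishing_tangential[OF smooth_on_pdiff[OF u_smooth] _ _ g(1)]) (auto simp: g(2))
  then show ?case by simp
qed

lemma u_linear_bound:
  assumes "3 \<notin> set ds" "r < R"
  obtains B where "\<And>z. z \<in> half_ball r \<Longrightarrow> \<bar>pdiff ds u z\<bar> \<le> B * z $ 3"
proof -
  obtain B where B: "\<And>z. z \<in> half_ball r \<Longrightarrow> \<bar>pdiff (3 # ds) u z\<bar> \<le> B"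
    using adm_bounded[OF adm_u[OF assms(2)]] by metis
  show ?thesis
    by (rule that, rule vanishing_linear_bound[OF smooth_on_pdiff[OF u_smooth] vanishing_u[OF assms(1)], of r])
      (use B assms in auto)
qed

lemma pdiff_u_mset: "mset a = mset b \<Longrightarrow> z \<in> H \<Longrightarrow> pdiff a u z = pdiff b u z"
  by (rule pdiff_mset[OF H u_smooth])

lemma l2_u_mset:
  assumes "r < R" "mset a = mset b" shows "l2 (half_ball r) (pdiff a u) = l2 (half_ball r) (pdiff b u)"
  using assms half_ball_mono[of r R] by (intro l2_cong pdiff_u_mset) auto

text \<open>This is the commutator of the derivative \<open>ds\<close> with multiplication by an
  entry of \<open>A\<close>, applied to the derivative of \<open>u\<close> in direction
  \<open>j\<close>. As \<open>a\<close> is nonempty, \<open>b @ [j]\<close> is no longer than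
  \<open>ds\<close>, so only derivatives of \<open>u\<close> up to that order enter.\<close>

definition commutator :: "3 list \<Rightarrow> 3 \<Rightarrow> 3 \<Rightarrow> real^3 \<Rightarrow> real" where
  "commutator ds i j z = leib ds (\<lambda>a b. if a = [] then 0 else pdiff a (\<lambda>w. A w $ i $ j) z * pdiff (b @ [j]) u z)"

lemma pdiff_flux_commutator:
  assumes "z \<in> H"
  shows "pdiff ds (flux i) z = (\<Sum>j\<in>UNIV. A z $ i $ j * pdiff (ds @ [j]) u z + commutator ds i j z)"
  unfolding pdiff_flux[OF assms] commutator_def by (subst leib_split) simp

lemma adm_commutator:
  assumes "r < R" shows "adm (half_ball r) (commutator ds i j)"
proof -
  have "adm (half_ball r) (\<lambda>z. if a = [] then 0 else pdiff a (\<lambda>w. A w $ i $ j) z * pdiff (b @ [j]) u z)" for a b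
    using assms by (cases "a = []") (auto intro!: adm_intros adm_A adm_u)
  then show ?thesis unfolding commutator_def[abs_def] by (intro adm_intros)
qed

lemma l2_commutator:
  assumes r: "r < R"
  shows "l2 (half_ball r) (commutator ds i j) \<le>
    leib ds (\<lambda>a b. if a = [] then 0 else C * \<gamma> ^ length a * fact (length a) * l2 (half_ball r) (pdiff (b @ [j]) u))"
proof -
  note S = open_half_ball[of r] bounded_half_ball[of r]
  let ?F = "\<lambda>a b z. if a = [] then 0 else pdiff a (\<lambda>w. A w $ i $ j) z * pdiff (b @ [j]) u z"
  have adm: "adm (half_ball r) (?F a b)" for a b
    using assms by (cases "a = []") (auto intro!: adm_intros adm_A adm_u)
  have "l2 (half_ball r) (commutator ds i j) \<le> leib ds (\<lambda>a b. l2 (half_ball r) (?F a b))"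
    unfolding commutator_def[abs_def] by (rule l2_leib[OF S adm])
  also have "\<dots> \<le> leib ds (\<lambda>a b. if a = [] then 0 else C * \<gamma> ^ length a * fact (length a) * l2 (half_ball r) (pdiff (b @ [j]) u))"
  proof (rule leib_mono)
    fix a b :: "3 list"
    show "l2 (half_ball r) (?F a b) \<le> (if a = [] then 0 else C * \<gamma> ^ length a * fact (length a) * l2 (half_ball r) (pdiff (b @ [j]) u))"
    proof (cases "a = []")
      case False
      have "l2 (half_ball r) (\<lambda>z. pdiff a (\<lambda>w. A w $ i $ j) z * pdiff (b @ [j]) u z)
        \<le> C * \<gamma> ^ length a * fact (length a) * l2 (half_ball r) (pdiff (b @ [j]) u)"
        using r C \<gamma> half_ball_mono[of r R] by (intro l2_mult_le S adm_A adm_u A_bound) auto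
      then show ?thesis using False by simp
    qed (simp add: l2_def)
  qed
  finally show ?thesis .
qed

text \<open>For a tangential derivative \<open>w\<close> of \<open>u\<close>, one derivative of the right-hand side is moved
into the flux, which then becomes divergence free.\<close>

lemma tangential_caccioppoli:
  assumes tan: "3 \<notin> set (d # ds)" and r: "0 < r" "r < s" "s < R"
  shows "l2 (half_ball r) (pdiff (k # d # ds) u) \<le> cacc lam C *
    ((\<Sum>i\<in>UNIV. \<Sum>j\<in>UNIV. l2 (half_ball s) (commutator (d # ds) i j)) + l2 (half_ball s) (pdiff ds f)
      + l2 (half_ball s) (pdiff (d # ds) u) / (s - r))"
proof -
  let ?ds = "d # ds" and ?S = "half_ball s"
  note S = open_half_ball[of s] bounded_half_ball[of s]
  obtain B where B: "\<And>z. z \<in> half_ball s \<Longrightarrow> \<bar>pdiff ?ds u z\<bar> \<le> B * z $ 3"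
    using u_linear_bound[OF tan r(3)] by metis
  \<comment> \<open>The added term sits in component \<open>d\<close> alone, so its divergence is
    the derivative of \<open>f\<close> along \<open>d # ds\<close> and cancels that of the
    differentiated flux. Thus \<open>f\<close> is differentiated once less than
    \<open>u\<close>.\<close>
  define e where "e i = (if i = d then 1 else 0 :: real)" for i
  define F where "F i z = pdiff ?ds (flux i) z + e i * pdiff ds f z" for i z
  define dF where "dF i z = pdiff (i # ?ds) (flux i) z + e i * pdiff (i # ds) f z" for i z
  define G where "G i z = (\<Sum>j\<in>UNIV. commutator ?ds i j z) + e i * pdiff ds f z" for i z
  have sH: "half_ball s \<subseteq> H" using r by (intro half_ball_mono) simp
  have "l2 (half_ball r) (pdiff (k # ?ds) u) \<le> cacc lam C * ((\<Sum>i\<in>UNIV. l2 ?S (G i)) + l2 ?S (pdiff ?ds u) / (s - r))"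
  proof (rule caccioppoli[OF r lam, where A = A and F = F and dF = dF and G = G and B = B and X = "\<lambda>i. pdiff (i # ?ds) u"])
    fix z i assume z: "z \<in> H"
    show "((\<lambda>t. pdiff ?ds u (z + t *\<^sub>R axis i 1)) has_real_derivative pdiff (i # ?ds) u z) (at 0)"
      by (rule smooth_on_DERIV[OF u_smooth z])
    show "((\<lambda>t. F i (z + t *\<^sub>R axis i 1)) has_real_derivative dF i z) (at 0)"
      unfolding F_def dF_def
      by (intro DERIV_add DERIV_cmult smooth_on_DERIV[OF flux_smooth z] smooth_on_DERIV[OF f_smooth z])
  next
    fix z assume z: "z \<in> H"
    have "(\<Sum>i\<in>UNIV. pdiff (i # ?ds) (flux i) z) = (\<Sum>i\<in>UNIV. pdiff (?ds @ [i]) (flux i) z)"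
      by (intro sum.cong refl pdiff_mset[OF H flux_smooth _ z]) simp
    also have "\<dots> = - pdiff ?ds f z" unfolding pdiff_f[OF z] by simp
    finally show "(\<Sum>i\<in>UNIV. dF i z) = 0"
      unfolding dF_def sum.distrib by (simp add: e_def if_distrib[of "\<lambda>x. x * _"] cong: if_cong)
  next
    fix z i assume "z \<in> ?S"
    then have z: "z \<in> H" using sH by auto
    have "pdiff (?ds @ [j]) u z = pdiff (j # ?ds) u z" for j
      by (rule pdiff_u_mset[OF _ z]) simp
    then show "F i z = (\<Sum>j\<in>UNIV. A z $ i $ j * pdiff (j # ?ds) u z) + G i z"
      unfolding F_def G_def pdiff_flux_commutator[OF z] by (simp add: sum.distrib del: pdiff.simps append.simps)
  next
    show "\<bar>A z $ i $ j\<bar> \<le> C" if "z \<in> ?S" for z i j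
      using A_bound[of z "[]" i j] that sH by auto
  qed (use r B C sH coercive adm_u adm_f adm_flux adm_commutator in
        \<open>auto simp: F_def[abs_def] dF_def[abs_def] G_def[abs_def] simp del: pdiff.simps intro!: adm_intros\<close>)
  also have "\<dots> \<le> cacc lam C * (((\<Sum>i\<in>UNIV. \<Sum>j\<in>UNIV. l2 ?S (commutator ?ds i j)) + l2 ?S (pdiff ds f))
      + l2 ?S (pdiff ?ds u) / (s - r))"
  proof (intro mult_left_mono add_right_mono)
    have "l2 ?S (G i) \<le> (\<Sum>j\<in>UNIV. l2 ?S (commutator ?ds i j)) + e i * l2 ?S (pdiff ds f)" for i
    proof -
      have "l2 ?S (G i) \<le> l2 ?S (\<lambda>z. \<Sum>j\<in>UNIV. commutator ?ds i j z) + l2 ?S (\<lambda>z. e i * pdiff ds f z)"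
        unfolding G_def[abs_def] using r by (intro l2_add S adm_intros adm_commutator adm_f)
      also have "\<dots> \<le> (\<Sum>j\<in>UNIV. l2 ?S (commutator ?ds i j)) + \<bar>e i\<bar> * l2 ?S (pdiff ds f)"
        unfolding l2_cmult using r by (intro add_right_mono l2_sum S adm_commutator)
      finally show ?thesis by (simp add: e_def split: if_splits)
    qed
    then have "(\<Sum>i\<in>UNIV. l2 ?S (G i)) \<le> (\<Sum>i\<in>UNIV. (\<Sum>j\<in>UNIV. l2 ?S (commutator ?ds i j)) + e i * l2 ?S (pdiff ds f))"
      by (intro sum_mono)
    also have "\<dots> = (\<Sum>i\<in>UNIV. \<Sum>j\<in>UNIV. l2 ?S (commutator ?ds i j)) + l2 ?S (pdiff ds f)"
      by (simp add: sum.distrib e_def if_distrib[of "\<lambda>x. x * _"] cong: if_cong)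
    finally show "(\<Sum>i\<in>UNIV. l2 ?S (G i)) \<le> (\<Sum>i\<in>UNIV. \<Sum>j\<in>UNIV. l2 ?S (commutator ?ds i j)) + l2 ?S (pdiff ds f)" .
    show "0 \<le> cacc lam C" using lam by (simp add: cacc_def)
  qed
  finally show ?thesis .
qed

end

section \<open>Bounds for all derivatives\<close>

definition wt :: "real \<Rightarrow> real \<Rightarrow> 3 list \<Rightarrow> real" where
  "wt K1 K2 ds = prod_list (map (\<lambda>i. if i = 3 then K2 else K1) ds)"

lemma wt_simps [simp]: "wt K1 K2 [] = 1" "wt K1 K2 (i # ds) = (if i = 3 then K2 else K1) * wt K1 K2 ds"
  by (simp_all add: wt_def)

lemma wt_append: "wt K1 K2 (a @ b) = wt K1 K2 a * wt K1 K2 b"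
  by (simp add: wt_def)

lemma wt_mset: "mset a = mset b \<Longrightarrow> wt K1 K2 a = wt K1 K2 b"
  unfolding wt_def by (metis mset_map prod_mset_prod_list)

lemma wt_ge:
  assumes "0 \<le> K1" "K1 \<le> K2" shows "K1 ^ length ds \<le> wt K1 K2 ds"
  using assms by (induction ds) (auto intro!: mult_mono)

lemma wt_nonneg: "0 \<le> K1 \<Longrightarrow> K1 \<le> K2 \<Longrightarrow> 0 \<le> wt K1 K2 ds"
  by (rule order_trans[OF zero_le_power wt_ge])

lemma geometric_tail_le:
  fixes x :: real assumes x: "0 \<le> x" "x \<le> 1 / 2"
  shows "(\<Sum>k\<le>n. if k = 0 then 0 else x ^ k) \<le> 2 * x"
proof -
  \<comment> \<open>Strengthened for the induction: the added factor leaves exactly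
    \<open>x * (1 / 2) ^ n\<close> of room for the next term.\<close>
  have "(\<Sum>k\<le>n. if k = 0 then 0 else x ^ k) \<le> 2 * x * (1 - (1 / 2) ^ n)"
  proof (induction n)
    case (Suc n)
    have "x * x ^ n \<le> x * (1 / 2) ^ n" using x by (intro mult_left_mono power_mono) auto
    then show ?case using Suc by (simp add: algebra_simps)
  qed simp
  also have "\<dots> \<le> 2 * x" using x by (simp add: mult_left_le)
  finally show ?thesis .
qed

text \<open>Bounds the loss when the radius is enlarged by the fraction 1/(n + 1) of its distance to
  \<open>R\<close>: the m-th powers of the old and the new distance differ by this factor.\<close>

lemma one_plus_inverse_power_le_3:
  assumes "0 < n" "m \<le> n" shows "((real n + 1) / real n) ^ m \<le> 3"
proof -
  have "((real n + 1) / real n) ^ m \<le> ((real n + 1) / real n) ^ n"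
    using assms by (intro power_increasing) auto
  also have "\<dots> \<le> exp (1 / real n) ^ n"
    using assms exp_ge_add_one_self[of "1 / real n"] by (intro power_mono) (auto simp: field_simps)
  also have "\<dots> = exp 1" using assms by (simp add: exp_of_nat_mult[symmetric])
  also have "\<dots> \<le> 3" by (rule exp_le)
  finally show ?thesis .
qed

section \<open>The majorant and the tangential derivatives\<close>

context elliptic_problem begin

text \<open>\<open>m = 0\<close> is the gradient itself, where \<open>f\<close> does not enter. For
  positive \<open>m\<close> the exponent is the order of the derivative of \<open>f\<close>; its
  bound contains R to the power -(m - 1), and against the weight, at most R to the power m, one
  factor \<open>R\<close> survives.\<close>

definition maj :: "nat \<Rightarrow> real" where
  "maj m = (if m = 0 then U else Cf * R * max (real m) \<rho> ^ (m - 1) + fact m * U)"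

lemma maj_nonneg: "0 \<le> maj m"
  using Cf R \<rho> U by (auto simp: maj_def intro!: add_nonneg_nonneg mult_nonneg_nonneg)

text \<open>The factorial part reproduces itself exactly. In the data part m!/(m - k)! is at most
  the k-th power of m, which supplies the missing powers of the maximum.\<close>

lemma maj_step:
  assumes "k \<le> m"
  shows "real (m choose k) * fact k * maj (m - k) \<le> maj m"
proof -
  have fct: "real (m choose k) * fact k * fact (m - k) = fact m"
    using arg_cong[OF binomial_fact_lemma[OF assms], of real] by (simp add: mult_ac)
  show ?thesis
  proof (cases "k = m")
    case True
    then show ?thesis using Cf R \<rho> by (auto simp: maj_def)
  next
    case False
    then have m: "m \<noteq> 0" "m - k \<noteq> 0" "k + (m - k - 1) = m - 1" using assms by auto
    have pow: "real (m choose k) * fact k \<le> real m ^ k"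
      using of_nat_mono[OF binomial_fact_pow[of m k], where ?'a = real] by simp
    have "real (m choose k) * fact k * max (real (m - k)) \<rho> ^ (m - k - 1)
        \<le> max (real m) \<rho> ^ k * max (real m) \<rho> ^ (m - k - 1)"
    proof (intro mult_mono power_mono)
      show "real (m choose k) * fact k \<le> max (real m) \<rho> ^ k"
        by (rule order_trans[OF pow power_mono]) auto
    qed auto
    also have "\<dots> = max (real m) \<rho> ^ (m - 1)" unfolding power_add[symmetric] m(3) ..
    finally have "Cf * R * (real (m choose k) * fact k * max (real (m - k)) \<rho> ^ (m - k - 1)) \<le> Cf * R * max (real m) \<rho> ^ (m - 1)"
      using Cf R by (intro mult_left_mono) auto
    moreover have "real (m choose k) * fact k * maj (m - k)
        = Cf * R * (real (m choose k) * fact k * max (real (m - k)) \<rho> ^ (m - k - 1)) + fact m * U"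
      unfolding fct[symmetric] using m(2) by (simp add: maj_def algebra_simps)
    ultimately show ?thesis using m(1) by (simp add: maj_def)
  qed
qed

text \<open>By \<open>maj_step\<close> the k-th term is at most
  \<open>C * (\<gamma> / K) ^ k * maj n\<close>. Since \<open>k = 0\<close> is absent, the geometric
  sum is of size \<open>\<gamma> / K\<close>, and this smallness lets both inductions close.\<close>

lemma maj_commutator_sum:
  assumes K: "2 * \<gamma> \<le> K"
  shows "(\<Sum>k\<le>n. real (n choose k) * (if k = 0 then 0 else C * \<gamma> ^ k * fact k * (maj (n - k) / K ^ k)))
    \<le> 2 * C * \<gamma> / K * maj n"
proof -
  have K0: "0 < K" using K \<gamma> by linarith
  have "(\<Sum>k\<le>n. real (n choose k) * (if k = 0 then 0 else C * \<gamma> ^ k * fact k * (maj (n - k) / K ^ k)))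
    \<le> (\<Sum>k\<le>n. C * maj n * (if k = 0 then 0 else (\<gamma> / K) ^ k))"
  proof (rule sum_mono)
    fix k assume "k \<in> {..n}"
    then have "C * (\<gamma> / K) ^ k * (real (n choose k) * fact k * maj (n - k)) \<le> C * (\<gamma> / K) ^ k * maj n"
      using C \<gamma> K0 by (intro mult_left_mono maj_step) auto
    then show "real (n choose k) * (if k = 0 then 0 else C * \<gamma> ^ k * fact k * (maj (n - k) / K ^ k))
        \<le> C * maj n * (if k = 0 then 0 else (\<gamma> / K) ^ k)"
      by (simp add: power_divide mult_ac)
  qed
  also have "\<dots> = C * maj n * (\<Sum>k\<le>n. if k = 0 then 0 else (\<gamma> / K) ^ k)"
    by (simp only: sum_distrib_left)
  also have "\<dots> \<le> C * maj n * (2 * (\<gamma> / K))"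
    using C K K0 \<gamma> maj_nonneg by (intro mult_left_mono geometric_tail_le) (auto simp: field_simps)
  finally show ?thesis by (simp add: mult_ac)
qed

text \<open>Shared by both inductions: \<open>P\<close> is a power of \<open>R - r\<close> and
  \<open>M\<close> the weight allotted to the whole derivative. The premise demands that each
  derivative moved onto \<open>A\<close> saves a factor \<open>K\<close>.\<close>

lemma l2_commutator_le_maj:
  assumes r: "r < R" and K: "2 * \<gamma> \<le> K" and P: "0 \<le> P" and M: "0 \<le> M"
    and b: "\<And>a b. mset a + mset b = mset ds \<Longrightarrow> a \<noteq> [] \<Longrightarrow>
      P * l2 (half_ball r) (pdiff (b @ [j]) u) \<le> M * (maj (length ds - length a) / K ^ length a)"
  shows "P * l2 (half_ball r) (commutator ds i j) \<le> M * (2 * C * \<gamma> / K * maj (length ds))"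
proof -
  define \<phi> where "\<phi> k = M * (if k = 0 then 0 else C * \<gamma> ^ k * fact k * (maj (length ds - k) / K ^ k))" for k
  have "P * l2 (half_ball r) (commutator ds i j) \<le>
    P * leib ds (\<lambda>a b. if a = [] then 0 else C * \<gamma> ^ length a * fact (length a) * l2 (half_ball r) (pdiff (b @ [j]) u))"
    using P by (intro mult_left_mono l2_commutator[OF r])
  also have "\<dots> = leib ds (\<lambda>a b. P * (if a = [] then 0 else C * \<gamma> ^ length a * fact (length a) * l2 (half_ball r) (pdiff (b @ [j]) u)))"
    by (simp only: leib_cmult)
  also have "\<dots> \<le> leib ds (\<lambda>a b. \<phi> (length a))"
  proof (rule leib_mono)
    fix a b assume ab: "mset a + mset b = mset ds"
    show "P * (if a = [] then 0 else C * \<gamma> ^ length a * fact (length a) * l2 (half_ball r) (pdiff (b @ [j]) u)) \<le> \<phi> (length a)"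
    proof (cases "a = []")
      case False
      have "C * \<gamma> ^ length a * fact (length a) * (P * l2 (half_ball r) (pdiff (b @ [j]) u))
          \<le> C * \<gamma> ^ length a * fact (length a) * (M * (maj (length ds - length a) / K ^ length a))"
        using b[OF ab False] C \<gamma> by (intro mult_left_mono) auto
      then show ?thesis using False by (simp add: \<phi>_def mult_ac)
    qed (simp add: \<phi>_def)
  qed
  also have "\<dots> = M * (\<Sum>k\<le>length ds. real (length ds choose k) *
      (if k = 0 then 0 else C * \<gamma> ^ k * fact k * (maj (length ds - k) / K ^ k)))"
    unfolding leib_length sum_distrib_left by (simp only: \<phi>_def mult_ac)
  also have "\<dots> \<le> M * (2 * C * \<gamma> / K * maj (length ds))"
    using M by (intro mult_left_mono maj_commutator_sum K)
  finally show ?thesis .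
qed

lemma f_le_maj:
  assumes r: "r < R" and P: "0 \<le> P" "P \<le> R"
  shows "P ^ Suc (length ds) * l2 (half_ball r) (pdiff ds f) \<le> \<gamma>f ^ length ds * maj (Suc (length ds))"
proof -
  let ?m = "length ds"
  have "P ^ Suc ?m * l2 (half_ball r) (pdiff ds f) \<le> R ^ Suc ?m * (Cf * \<gamma>f ^ ?m * (max (real ?m) \<rho> / R) ^ ?m)"
    using P R f_bound[OF r] by (intro mult_mono power_mono l2_nonneg) auto
  also have "\<dots> = \<gamma>f ^ ?m * (Cf * R * max (real ?m) \<rho> ^ ?m)"
    using R by (simp add: power_divide field_simps)
  also have "\<dots> \<le> \<gamma>f ^ ?m * (Cf * R * max (real (Suc ?m)) \<rho> ^ ?m + fact (Suc ?m) * U)"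
  proof -
    have "Cf * R * max (real ?m) \<rho> ^ ?m \<le> Cf * R * max (real (Suc ?m)) \<rho> ^ ?m"
      using Cf R by (intro mult_left_mono power_mono) auto
    moreover have "0 \<le> fact (Suc ?m) * U" using U by simp
    ultimately have "Cf * R * max (real ?m) \<rho> ^ ?m \<le> Cf * R * max (real (Suc ?m)) \<rho> ^ ?m + fact (Suc ?m) * U"
      by linarith
    then show ?thesis using \<gamma>f by (intro mult_left_mono) auto
  qed
  finally show ?thesis by (simp add: maj_def)
qed

text \<open>The direction \<open>k\<close> is arbitrary because the energy estimate controls the
  full gradient of a tangential derivative. One normal derivative is therefore included.\<close>

lemma tangential_bound:
  assumes K: "1 \<le> K" "2 * \<gamma> \<le> K" "\<gamma>f \<le> K" "cacc lam C * (54 * C * \<gamma> + 7) \<le> K"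
    and "3 \<notin> set ds" "0 < r" "r < R"
  shows "(R - r) ^ length ds * l2 (half_ball r) (pdiff (k # ds) u) \<le> K ^ length ds * maj (length ds)"
  using assms(5-)
proof (induction "length ds" arbitrary: ds k r rule: less_induct)
  case less
  show ?case
  proof (cases ds)
    case Nil
    then show ?thesis using U_bound[OF less.prems(3)] by (simp add: maj_def)
  next
    case (Cons d ds')
    define n where "n = length ds"
    have n: "n = Suc (length ds')" "n > 0" using Cons by (auto simp: n_def)
    define P where "P = R - r"
    have P: "0 < P" "P \<le> 1" "P \<le> R" using less.prems R by (auto simp: P_def)
    \<comment> \<open>With this choice \<open>R - s\<close> is \<open>P\<close> times n/(n + 1), so
      passing from powers of \<open>R - s\<close> to powers of \<open>P\<close> costs at most
      3.\<close>
    define s where "s = r + P / (real n + 1)"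
    have "P / (real n + 1) < P" using P n(2) by (simp add: divide_less_eq)
    then have s: "r < s" "s < R" using P by (auto simp: s_def P_def)
    then have s0: "0 < s" using less.prems by linarith
    have Rs: "P = (R - s) * ((real n + 1) / real n)"
    proof -
      have "R - s = P - P / (real n + 1)" by (simp add: s_def P_def)
      also have "\<dots> = P * (real n / (real n + 1))" by (simp add: field_simps)
      finally show ?thesis using n(2) by simp
    qed
    have conv: "P ^ m \<le> 3 * (R - s) ^ m" if "m \<le> n" for m
    proof -
      have "P ^ m = (R - s) ^ m * ((real n + 1) / real n) ^ m" by (subst Rs) (rule power_mult_distrib)
      also have "\<dots> \<le> (R - s) ^ m * 3"
        using s by (intro mult_left_mono one_plus_inverse_power_le_3 n that) auto
      finally show ?thesis by simp
    qed
    have IH: "P ^ length b * l2 (half_ball s) (pdiff (j # b) u) \<le> 3 * (K ^ length b * maj (length b))"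
      if "3 \<notin> set b" "length b < n" for j b
    proof -
      have "P ^ length b * l2 (half_ball s) (pdiff (j # b) u) \<le> 3 * (R - s) ^ length b * l2 (half_ball s) (pdiff (j # b) u)"
        using that by (intro mult_right_mono conv l2_nonneg) auto
      also have "\<dots> \<le> 3 * (K ^ length b * maj (length b))"
        using less.hyps[of b s j] that s s0 by (simp add: n_def mult.assoc)
      finally show ?thesis .
    qed
    have comm: "P ^ n * l2 (half_ball s) (commutator ds i j) \<le> 3 * K ^ n * (2 * C * \<gamma> / K * maj n)" for i j
      unfolding n_def
    proof (rule l2_commutator_le_maj[OF s(2) K(2)])
      fix a b :: "3 list" assume ab: "mset a + mset b = mset ds" "a \<noteq> []"
      have len: "length a + length b = n" using arg_cong[OF ab(1), of size] by (simp add: n_def)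
      have lb: "length b < n" "length b = n - length a" using len ab(2) by auto
      have "set b \<subseteq> set ds" using arg_cong[OF ab(1), of set_mset] by auto
      then have tan: "3 \<notin> set b" using less.prems by auto
      have eq: "l2 (half_ball s) (pdiff (b @ [j]) u) = l2 (half_ball s) (pdiff (j # b) u)"
        by (rule l2_u_mset[OF s(2)]) simp
      have Kn: "K ^ n = K ^ length a * K ^ length b" unfolding len[symmetric] by (rule power_add)
      have "P ^ n * l2 (half_ball s) (pdiff (b @ [j]) u) \<le> P ^ length b * l2 (half_ball s) (pdiff (j # b) u)"
        unfolding eq using P lb(1) by (intro mult_right_mono power_decreasing l2_nonneg) auto
      also have "\<dots> \<le> 3 * (K ^ length b * maj (length b))" by (rule IH[OF tan lb(1)])
      also have "\<dots> = 3 * K ^ n * (maj (n - length a) / K ^ length a)"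
        using K(1) unfolding Kn lb(2)[symmetric] by simp
      finally show "P ^ length ds * l2 (half_ball s) (pdiff (b @ [j]) u) \<le> 3 * K ^ length ds * (maj (length ds - length a) / K ^ length a)"
        by (simp add: n_def)
    qed (use P K in auto)
    have "P ^ n * l2 (half_ball s) (pdiff ds' f) \<le> \<gamma>f ^ length ds' * maj n"
      using f_le_maj[OF s(2), of P ds'] P unfolding n(1) by simp
    also have "\<dots> \<le> K ^ length ds' * maj n"
      using K \<gamma>f by (intro mult_right_mono power_mono maj_nonneg) auto
    also have "\<dots> = K ^ n / K * maj n" using K(1) by (simp add: n(1))
    finally have fterm: "P ^ n * l2 (half_ball s) (pdiff ds' f) \<le> K ^ n / K * maj n" .
    \<comment> \<open>The leading direction \<open>d\<close> of \<open>ds\<close> plays the role of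
      \<open>k\<close> in the induction hypothesis for \<open>ds'\<close>. The division by
      \<open>s - r\<close> produces n + 1, at most 2n; the n is absorbed by \<open>maj_step\<close>
      with \<open>k = 1\<close>, and the 2 joins the 3 from the enlargement.\<close>
    have wterm: "P ^ n * (l2 (half_ball s) (pdiff ds u) / (s - r)) \<le> 6 * (K ^ n / K * maj n)"
    proof -
      let ?L = "l2 (half_ball s) (pdiff ds u)"
      have "P ^ n * (?L / (s - r)) = (real n + 1) * (P ^ length ds' * ?L)"
      proof -
        have "s - r = P / (real n + 1)" "P ^ n = P * P ^ length ds'" by (simp_all add: s_def n(1))
        then show ?thesis using P by simp
      qed
      also have "\<dots> \<le> (real n + 1) * (3 * (K ^ length ds' * maj (length ds')))"
        using IH[of ds' d] less.prems n(1) Cons by (intro mult_left_mono) auto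
      also have "\<dots> \<le> (2 * real n) * (3 * (K ^ length ds' * maj (length ds')))"
        using n K maj_nonneg by (intro mult_right_mono) auto
      also have "\<dots> = 6 * (K ^ length ds' * (real n * maj (length ds')))" by simp
      also have "\<dots> \<le> 6 * (K ^ length ds' * maj n)"
        using maj_step[of 1 n] n K by (intro mult_left_mono) auto
      also have "\<dots> = 6 * (K ^ n / K * maj n)" using K(1) by (simp add: n(1))
      finally show ?thesis .
    qed
    have "l2 (half_ball r) (pdiff (k # ds) u) \<le> cacc lam C *
      ((\<Sum>i\<in>UNIV. \<Sum>j\<in>UNIV. l2 (half_ball s) (commutator ds i j)) + l2 (half_ball s) (pdiff ds' f)
      + l2 (half_ball s) (pdiff ds u) / (s - r))"
      using tangential_caccioppoli[of d ds' r s k] less.prems s unfolding Cons by blast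
    then have "P ^ n * l2 (half_ball r) (pdiff (k # ds) u) \<le> P ^ n * (cacc lam C *
      ((\<Sum>i\<in>UNIV. \<Sum>j\<in>UNIV. l2 (half_ball s) (commutator ds i j)) + l2 (half_ball s) (pdiff ds' f)
      + l2 (half_ball s) (pdiff ds u) / (s - r)))"
      using P by (intro mult_left_mono) auto
    also have "\<dots> = cacc lam C *
      ((\<Sum>i\<in>UNIV. \<Sum>j\<in>UNIV. P ^ n * l2 (half_ball s) (commutator ds i j)) + P ^ n * l2 (half_ball s) (pdiff ds' f)
      + P ^ n * (l2 (half_ball s) (pdiff ds u) / (s - r)))"
      by (simp only: sum_distrib_left[symmetric] distrib_left mult_ac)
    also have "\<dots> \<le> cacc lam C *
      ((\<Sum>i\<in>(UNIV::3 set). \<Sum>j\<in>(UNIV::3 set). 3 * K ^ n * (2 * C * \<gamma> / K * maj n)) + K ^ n / K * maj n + 6 * (K ^ n / K * maj n))"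
    proof (intro mult_left_mono add_mono sum_mono comm fterm wterm)
      show "0 \<le> cacc lam C" using lam by (simp add: cacc_def)
    qed
    \<comment> \<open>54 = 9 * 3 * 2 comes from the nine commutators, 7 = 1 + 6 from
      \<open>f\<close> and the term with the cutoff gradient.\<close>
    also have "\<dots> = cacc lam C * (54 * C * \<gamma> + 7) * (K ^ n / K * maj n)"
      by (simp add: algebra_simps add_divide_distrib)
    also have "\<dots> \<le> K * (K ^ n / K * maj n)"
      using K maj_nonneg by (intro mult_right_mono) auto
    also have "\<dots> = K ^ n * maj n" using K(1) by simp
    finally show ?thesis by (simp add: P_def n_def)
  qed
qed

end

section \<open>Normal derivatives from the equation\<close>

lemma mset_remove1_twice:
  assumes "2 \<le> count (mset ds) (x::'a)"
  shows "mset ds = mset (remove1 x (remove1 x ds) @ [x, x])"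
proof (rule multiset_eqI)
  fix y
  show "count (mset ds) y = count (mset (remove1 x (remove1 x ds) @ [x, x])) y"
    using assms by (cases "y = x") auto
qed

context elliptic_problem begin

text \<open>Coercivity tested with the unit normal. It permits solving the equation for the second
  normal derivative.\<close>

lemma A33_ge: "z \<in> H \<Longrightarrow> lam \<le> A z $ 3 $ 3"
  using coercive[of z "axis 3 1"]
  by (simp add: matrix_vector_mult_basis inner_axis' column_def norm_axis_1)

lemma normal_equation:
  assumes "z \<in> H"
  shows "A z $ 3 $ 3 * pdiff (e @ [3, 3]) u z = - (pdiff e f z
    + (\<Sum>i\<in>UNIV. \<Sum>j\<in>UNIV. (if i = 3 \<and> j = 3 then 0 else A z $ i $ j) * pdiff (e @ [i, j]) u z)
    + (\<Sum>i\<in>UNIV. \<Sum>j\<in>UNIV. commutator (e @ [i]) i j z))"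
  unfolding pdiff_f[OF assms] pdiff_flux_commutator[OF assms] sum_3 by simp

lemma l2_normal_le:
  assumes r: "r < R"
  shows "lam * l2 (half_ball r) (pdiff (e @ [3, 3]) u) \<le> l2 (half_ball r) (pdiff e f)
    + (\<Sum>i\<in>UNIV. \<Sum>j\<in>UNIV. C * (if i = 3 \<and> j = 3 then 0 else l2 (half_ball r) (pdiff (e @ [i, j]) u)))
    + (\<Sum>i\<in>UNIV. \<Sum>j\<in>UNIV. l2 (half_ball r) (commutator (e @ [i]) i j))"
proof -
  let ?S = "half_ball r"
  note S = open_half_ball[of r] bounded_half_ball[of r]
  have SH: "?S \<subseteq> H" using r by (intro half_ball_mono) simp
  define t where "t i j z = (if i = 3 \<and> j = 3 then 0 else A z $ i $ j)" for i j :: 3 and z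
  have admt: "adm ?S (t i j)" for i j
    using adm_A[OF r, of "[]" i j] adm_const[of ?S 0] by (cases "i = 3 \<and> j = 3") (auto simp: t_def[abs_def])
  have admt2: "adm ?S (\<lambda>z. \<Sum>i\<in>UNIV. \<Sum>j\<in>UNIV. t i j z * pdiff (e @ [i, j]) u z)"
    by (intro adm_intros admt adm_u[OF r])
  have admc: "adm ?S (\<lambda>z. \<Sum>i\<in>UNIV. \<Sum>j\<in>UNIV. commutator (e @ [i]) i j z)"
    by (intro adm_intros adm_commutator[OF r])
  define g where "g z = (pdiff e f z + (\<Sum>i\<in>UNIV. \<Sum>j\<in>UNIV. t i j z * pdiff (e @ [i, j]) u z))
    + (\<Sum>i\<in>UNIV. \<Sum>j\<in>UNIV. commutator (e @ [i]) i j z)" for z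
  have admg: "adm ?S g" unfolding g_def[abs_def] by (intro adm_add adm_f[OF r] admt2 admc)
  have "lam * l2 ?S (pdiff (e @ [3, 3]) u) = l2 ?S (\<lambda>z. lam * pdiff (e @ [3, 3]) u z)"
    using lam by (simp add: l2_cmult)
  also have "\<dots> \<le> l2 ?S g"
  proof (rule l2_mono_abs[OF S _ admg])
    show "adm ?S (\<lambda>z. lam * pdiff (e @ [3, 3]) u z)" by (intro adm_intros adm_u[OF r])
    fix z assume "z \<in> ?S"
    then have z: "z \<in> H" using SH by auto
    have "\<bar>lam * pdiff (e @ [3, 3]) u z\<bar> \<le> \<bar>A z $ 3 $ 3 * pdiff (e @ [3, 3]) u z\<bar>"
      unfolding abs_mult using A33_ge[OF z] lam by (intro mult_right_mono) auto
    also have "\<dots> = \<bar>g z\<bar>" unfolding normal_equation[OF z] g_def t_def by (rule abs_minus_cancel)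
    finally show "\<bar>lam * pdiff (e @ [3, 3]) u z\<bar> \<le> \<bar>g z\<bar>" .
  qed
  also have "\<dots> \<le> (l2 ?S (pdiff e f) + l2 ?S (\<lambda>z. \<Sum>i\<in>UNIV. \<Sum>j\<in>UNIV. t i j z * pdiff (e @ [i, j]) u z))
    + l2 ?S (\<lambda>z. \<Sum>i\<in>UNIV. \<Sum>j\<in>UNIV. commutator (e @ [i]) i j z)"
    unfolding g_def[abs_def]
    by (rule order_trans[OF l2_add[OF S adm_add[OF adm_f[OF r] admt2] admc]])
       (intro add_right_mono l2_add[OF S adm_f[OF r] admt2])
  also have "\<dots> \<le> (l2 ?S (pdiff e f)
     + (\<Sum>i\<in>UNIV. \<Sum>j\<in>UNIV. C * (if i = 3 \<and> j = 3 then 0 else l2 ?S (pdiff (e @ [i, j]) u))))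
    + (\<Sum>i\<in>UNIV. \<Sum>j\<in>UNIV. l2 ?S (commutator (e @ [i]) i j))"
  proof (intro add_mono order.refl)
    have "l2 ?S (\<lambda>z. \<Sum>i\<in>UNIV. \<Sum>j\<in>UNIV. t i j z * pdiff (e @ [i, j]) u z)
        \<le> (\<Sum>i\<in>UNIV. l2 ?S (\<lambda>z. \<Sum>j\<in>UNIV. t i j z * pdiff (e @ [i, j]) u z))"
      by (intro l2_sum S adm_intros admt adm_u[OF r])
    also have "\<dots> \<le> (\<Sum>i\<in>UNIV. \<Sum>j\<in>UNIV. l2 ?S (\<lambda>z. t i j z * pdiff (e @ [i, j]) u z))"
      by (intro sum_mono l2_sum S adm_intros admt adm_u[OF r])
    also have "\<dots> \<le> (\<Sum>i\<in>UNIV. \<Sum>j\<in>UNIV. C * (if i = 3 \<and> j = 3 then 0 else l2 ?S (pdiff (e @ [i, j]) u)))"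
    proof (intro sum_mono)
      fix i j :: 3
      show "l2 ?S (\<lambda>z. t i j z * pdiff (e @ [i, j]) u z) \<le> C * (if i = 3 \<and> j = 3 then 0 else l2 ?S (pdiff (e @ [i, j]) u))"
      proof (cases "i = 3 \<and> j = 3")
        case True
        then show ?thesis by (simp add: t_def l2_def)
      next
        case False
        have "l2 ?S (\<lambda>z. t i j z * pdiff (e @ [i, j]) u z) \<le> C * l2 ?S (pdiff (e @ [i, j]) u)"
        proof (rule l2_mult_le[OF S admt adm_u[OF r] _ C])
          show "\<bar>t i j z\<bar> \<le> C" if "z \<in> ?S" for z
            using A_bound[of z "[]" i j] that SH False by (auto simp: t_def)
        qed
        then show ?thesis using False by auto
      qed
    qed
    finally show "l2 ?S (\<lambda>z. \<Sum>i\<in>UNIV. \<Sum>j\<in>UNIV. t i j z * pdiff (e @ [i, j]) u z)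
      \<le> (\<Sum>i\<in>UNIV. \<Sum>j\<in>UNIV. C * (if i = 3 \<and> j = 3 then 0 else l2 ?S (pdiff (e @ [i, j]) u)))" .
    have "l2 ?S (\<lambda>z. \<Sum>i\<in>UNIV. \<Sum>j\<in>UNIV. commutator (e @ [i]) i j z)
        \<le> (\<Sum>i\<in>UNIV. l2 ?S (\<lambda>z. \<Sum>j\<in>UNIV. commutator (e @ [i]) i j z))"
      by (intro l2_sum S adm_intros adm_commutator[OF r])
    also have "\<dots> \<le> (\<Sum>i\<in>UNIV. \<Sum>j\<in>UNIV. l2 ?S (commutator (e @ [i]) i j))"
      by (intro sum_mono l2_sum S adm_commutator[OF r])
    finally show "l2 ?S (\<lambda>z. \<Sum>i\<in>UNIV. \<Sum>j\<in>UNIV. commutator (e @ [i]) i j z)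
      \<le> (\<Sum>i\<in>UNIV. \<Sum>j\<in>UNIV. l2 ?S (commutator (e @ [i]) i j))" .
  qed
  finally show ?thesis .
qed

text \<open>After solving for the doubly normal derivative, the commutators contain only derivatives
  of \<open>u\<close> of lower order, which the outer induction covers. The remaining second-order
  terms have the same order but fewer normal directions, which is the inner induction.\<close>

lemma derivative_bound:
  assumes K1: "1 \<le> K1" "2 * \<gamma> \<le> K1" "\<gamma>f \<le> K1" "cacc lam C * (54 * C * \<gamma> + 7) \<le> K1" "54 * C * \<gamma> \<le> lam * K1"
    and K2: "K1 \<le> K2" "3 \<le> lam * K2" "27 * C * K1 \<le> lam * K2"
    and r: "0 < r" "r < R"
  shows "length ds = Suc n \<Longrightarrow> (R - r) ^ n * l2 (half_ball r) (pdiff ds u) \<le> wt K1 K2 ds * maj n"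
proof (induction n arbitrary: ds rule: less_induct)
  case (less n)
  note IHn = less.IH
  show ?case using less.prems
  proof (induction "count (mset ds) 3" arbitrary: ds rule: less_induct)
    case (less ds)
    note IHc = less.hyps
    define P where "P = R - r"
    have P: "0 \<le> P" "P \<le> 1" "P \<le> R" using r R by (auto simp: P_def)
    have K0: "0 < K1" "0 < K2" "1 \<le> K2" using K1 K2 by auto
    have nn: "0 \<le> wt K1 K2 a" for a using K0 K2 by (intro wt_nonneg) auto
    show ?case
    proof (cases "count (mset ds) 3 \<le> 1")
      case True
      \<comment> \<open>A normal direction, if there is one, goes to the front, where
        \<open>tangential_bound\<close> admits any direction.\<close>
      obtain k b where kb: "mset ds = mset (k # b)" "3 \<notin> set b"
      proof (cases "3 \<in> set ds")
        case True
        then have "count (mset (remove1 3 ds)) 3 = 0" using \<open>count (mset ds) 3 \<le> 1\<close> by simp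
        then have "3 \<notin> set (remove1 3 ds)" by (simp only: count_eq_zero_iff set_mset_mset not_False_eq_True)
        then show ?thesis using True by (intro that[of 3 "remove1 3 ds"]) auto
      next
        case False
        then show ?thesis using less.prems by (cases ds) (auto intro: that)
      qed
      have len: "length b = n" using arg_cong[OF kb(1), of size] less.prems by simp
      have "P ^ n * l2 (half_ball r) (pdiff ds u) = P ^ n * l2 (half_ball r) (pdiff (k # b) u)"
        using l2_u_mset[OF r(2) kb(1)] by simp
      also have "\<dots> \<le> K1 ^ n * maj n"
        using tangential_bound[OF K1(1-4) kb(2) r, of k] by (simp add: len P_def)
      also have "\<dots> \<le> wt K1 K2 ds * maj n"
      proof (rule mult_right_mono[OF _ maj_nonneg])
        have "K1 ^ n \<le> K1 ^ length ds" using K1 less.prems by (intro power_increasing) auto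
        also have "\<dots> \<le> wt K1 K2 ds" using K0 K2 by (intro wt_ge) auto
        finally show "K1 ^ n \<le> wt K1 K2 ds" .
      qed
      finally show ?thesis by (simp add: P_def)
    next
      case False
      define e where "e = remove1 3 (remove1 3 ds)"
      have ms: "mset ds = mset (e @ [3, 3])" unfolding e_def using False by (intro mset_remove1_twice) simp
      have n: "n = Suc (length e)" using arg_cong[OF ms, of size] less.prems by simp
      define w where "w = wt K1 K2 ds"
      have we: "w = wt K1 K2 e * K2 * K2" using wt_mset[OF ms, of K1 K2] by (simp add: w_def wt_append)
      have wte: "K1 ^ length e \<le> wt K1 K2 e" "0 \<le> wt K1 K2 e"
        using wt_ge[of K1 K2 e] K0 K2 nn by auto
      have w0: "0 \<le> w" using nn by (simp add: w_def)
      have fterm: "P ^ n * l2 (half_ball r) (pdiff e f) \<le> w * maj n / K2"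
      proof -
        have "P ^ n * l2 (half_ball r) (pdiff e f) \<le> \<gamma>f ^ length e * maj n"
          using f_le_maj[OF r(2) P(1,3), of e] by (simp add: n)
        also have "\<dots> \<le> (w / K2) * maj n"
        proof (rule mult_right_mono[OF _ maj_nonneg])
          have "\<gamma>f ^ length e \<le> K1 ^ length e" using K1 \<gamma>f by (intro power_mono) auto
          also have "\<dots> \<le> wt K1 K2 e * 1" using wte by simp
          also have "\<dots> \<le> wt K1 K2 e * K2" using wte K0 by (intro mult_left_mono) auto
          finally show "\<gamma>f ^ length e \<le> w / K2" using K0 by (simp add: we)
        qed
        finally show ?thesis by simp
      qed
      have mterm: "P ^ n * (C * (if i = 3 \<and> j = 3 then 0 else l2 (half_ball r) (pdiff (e @ [i, j]) u)))
          \<le> C * (K1 / K2) * (w * maj n)" for i j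
      proof (cases "i = 3 \<and> j = 3")
        case False
        have "count (mset (e @ [i, j])) 3 < count (mset ds) 3" unfolding ms using False by auto
        moreover have "length (e @ [i, j]) = Suc n" by (simp add: n)
        ultimately have "P ^ n * l2 (half_ball r) (pdiff (e @ [i, j]) u) \<le> wt K1 K2 (e @ [i, j]) * maj n"
          unfolding P_def by (rule IHc)
        also have "\<dots> \<le> (K1 / K2 * w) * maj n"
        proof (rule mult_right_mono[OF _ maj_nonneg])
          \<comment> \<open>At most one of \<open>i\<close> and \<open>j\<close> is normal, so a
            factor \<open>K1 / K2\<close> is gained over the two normal directions removed from
            \<open>ds\<close>.\<close>
          have "wt K1 K2 [i, j] \<le> K1 * K2"
            using False K0 K2 by (auto simp: mult.commute[of K2] intro: mult_left_mono)
          then have "wt K1 K2 e * wt K1 K2 [i, j] \<le> wt K1 K2 e * (K1 * K2)"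
            using wte by (intro mult_left_mono) auto
          then show "wt K1 K2 (e @ [i, j]) \<le> K1 / K2 * w" using K0 by (simp add: we wt_append mult_ac)
        qed
        finally have "C * (P ^ n * l2 (half_ball r) (pdiff (e @ [i, j]) u)) \<le> C * (K1 / K2 * w * maj n)"
          using C by (rule mult_left_mono)
        then show ?thesis using False by (auto simp: mult_ac)
      qed (use C K0 w0 maj_nonneg in auto)
      have cterm: "P ^ n * l2 (half_ball r) (commutator (e @ [i]) i j) \<le> w * (2 * C * \<gamma> / K1 * maj n)" for i j
      proof -
        have len: "length (e @ [i]) = n" by (simp add: n)
        have "P ^ n * l2 (half_ball r) (commutator (e @ [i]) i j) \<le> w * (2 * C * \<gamma> / K1 * maj (length (e @ [i])))"
        proof (rule l2_commutator_le_maj[OF r(2) K1(2) _ w0])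
          fix a b :: "3 list" assume ab: "mset a + mset b = mset (e @ [i])" "a \<noteq> []"
          have lab: "length a + length b = n" using arg_cong[OF ab(1), of size] by (simp add: n)
          have lb: "length b < n" "n - length a = length b" using lab ab(2) by auto
          have "P ^ n * l2 (half_ball r) (pdiff (b @ [j]) u) \<le> P ^ length b * l2 (half_ball r) (pdiff (b @ [j]) u)"
            using P lb by (intro mult_right_mono power_decreasing l2_nonneg) auto
          also have "\<dots> \<le> wt K1 K2 (b @ [j]) * maj (length b)"
            unfolding P_def by (rule IHn[OF lb(1)]) simp
          also have "\<dots> \<le> w / K1 ^ length a * maj (length b)"
          proof (rule mult_right_mono[OF _ maj_nonneg])
            have one: "0 \<le> wt K1 K2 [l]" "wt K1 K2 [l] \<le> K2" for l using K0 K2 by auto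
            \<comment> \<open>Every direction in \<open>a\<close> weighs at least \<open>K1\<close>.
              The directions \<open>i\<close> and \<open>j\<close> weigh at most \<open>K2\<close>
              each, as much as the two removed normal directions contribute to
              \<open>w\<close>.\<close>
            have "K1 ^ length a * wt K1 K2 (b @ [j]) \<le> wt K1 K2 a * (wt K1 K2 b * K2)"
            proof (rule mult_mono)
              show "wt K1 K2 (b @ [j]) \<le> wt K1 K2 b * K2"
                unfolding wt_append using nn one(2) by (rule mult_left_mono[rotated])
            qed (use K0 K2 nn in \<open>auto intro: wt_ge\<close>)
            also have "\<dots> = wt K1 K2 (a @ b) * K2" by (simp add: wt_append)
            also have "wt K1 K2 (a @ b) = wt K1 K2 e * wt K1 K2 [i]"
              using wt_mset[of "a @ b" "e @ [i]" K1 K2] ab(1) by (simp add: wt_append)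
            also have "\<dots> * K2 \<le> w"
              unfolding we using one wte K0 by (intro mult_right_mono mult_left_mono) auto
            finally show "wt K1 K2 (b @ [j]) \<le> w / K1 ^ length a" using K0 by (simp add: field_simps)
          qed
          finally show "P ^ n * l2 (half_ball r) (pdiff (b @ [j]) u) \<le> w * (maj (length (e @ [i]) - length a) / K1 ^ length a)"
            unfolding len lb(2) by simp
        qed (use P in simp)
        then show ?thesis by (simp only: len)
      qed
      have "lam * (P ^ n * l2 (half_ball r) (pdiff ds u)) = P ^ n * (lam * l2 (half_ball r) (pdiff (e @ [3, 3]) u))"
        using l2_u_mset[OF r(2) ms] by simp
      also have "\<dots> \<le> P ^ n * (l2 (half_ball r) (pdiff e f)
        + (\<Sum>i\<in>UNIV. \<Sum>j\<in>UNIV. C * (if i = 3 \<and> j = 3 then 0 else l2 (half_ball r) (pdiff (e @ [i, j]) u)))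
        + (\<Sum>i\<in>UNIV. \<Sum>j\<in>UNIV. l2 (half_ball r) (commutator (e @ [i]) i j)))"
        using P by (intro mult_left_mono l2_normal_le r) auto
      also have "\<dots> = P ^ n * l2 (half_ball r) (pdiff e f)
        + (\<Sum>i\<in>UNIV. \<Sum>j\<in>UNIV. P ^ n * (C * (if i = 3 \<and> j = 3 then 0 else l2 (half_ball r) (pdiff (e @ [i, j]) u))))
        + (\<Sum>i\<in>UNIV. \<Sum>j\<in>UNIV. P ^ n * l2 (half_ball r) (commutator (e @ [i]) i j))"
        by (simp only: distrib_left sum_distrib_left)
      also have "\<dots> \<le> w * maj n / K2 + (\<Sum>i\<in>(UNIV::3 set). \<Sum>j\<in>(UNIV::3 set). C * (K1 / K2) * (w * maj n))
        + (\<Sum>i\<in>(UNIV::3 set). \<Sum>j\<in>(UNIV::3 set). w * (2 * C * \<gamma> / K1 * maj n))"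
        by (intro add_mono sum_mono fterm mterm cterm)
      also have "\<dots> = (1 / K2 + 9 * C * K1 / K2 + 18 * C * \<gamma> / K1) * (w * maj n)"
        by (simp add: algebra_simps)
      also have "\<dots> \<le> lam * (w * maj n)"
      \<comment> \<open>Each contribution takes at most a third of \<open>lam\<close>; this is the
        origin of the constants 3, 27 = 3 * 9 and 54 = 3 * 18 in the assumptions.\<close>
      proof (rule mult_right_mono)
        have "1 / K2 \<le> lam / 3" using K2(2) K0 by (simp add: field_simps)
        moreover have "9 * C * K1 / K2 \<le> lam / 3" using K2(3) K0 by (simp add: field_simps)
        moreover have "18 * C * \<gamma> / K1 \<le> lam / 3" using K1(5) K0 by (simp add: field_simps)
        ultimately show "1 / K2 + 9 * C * K1 / K2 + 18 * C * \<gamma> / K1 \<le> lam" by linarith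
        show "0 \<le> w * maj n" using w0 maj_nonneg by simp
      qed
      finally show ?thesis using lam by (simp add: P_def w_def)
    qed
  qed
qed

end

section \<open>Passage to the weighted norms \<open>Nprime\<close>\<close>

lemma wt_mi_list: "wt K1 K2 (mi_list \<alpha>) = K1 ^ (\<alpha> 1 + \<alpha> 2) * K2 ^ \<alpha> 3"
proof -
  have "wt K1 K2 (replicate m i) = (if i = 3 then K2 else K1) ^ m" for m i
    by (induction m) auto
  then show ?thesis by (simp add: mi_list_def wt_append power_add)
qed

lemma length_mi_list: "length (mi_list \<alpha>) = \<alpha> 1 + \<alpha> 2 + \<alpha> 3"
  by (simp add: mi_list_def)

context elliptic_problem begin

text \<open>For \<open>n = 0\<close> the power has exponent -1, and the gradient term alone suffices
  because its coefficient is 2. Otherwise that term carries n!/[n - 1]!, at most n + 2, which is the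
  linear factor of the final bound.\<close>

lemma maj_le_bracket:
  fixes l :: int
  assumes l: "l = int n - 1"
  shows "R * maj n / fact (brk l)
    \<le> Cf * R\<^sup>2 * (max (real_of_int (l + 3)) \<rho>) powi l / fact (brk l) + real_of_int (l + 3) * R * U"
proof (cases n)
  case 0
  have "0 \<le> Cf * R\<^sup>2 * (max (real_of_int (l + 3)) \<rho>) powi l / fact (brk l)"
    using Cf l 0 by (intro divide_nonneg_nonneg mult_nonneg_nonneg zero_le_power_int) auto
  moreover have "R * U \<le> 2 * R * U" using R U by simp
  ultimately show ?thesis using 0 l by (simp add: maj_def brk_def)
next
  case (Suc m)
  then have lm: "l = int m" using l by simp
  let ?F = "fact (brk l) :: real"
  have F: "brk l = max 1 m" by (simp add: brk_def lm max_def)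
  have "max (real (Suc m)) \<rho> ^ m \<le> max (real_of_int (l + 3)) \<rho> ^ m"
    by (intro power_mono) (auto simp: lm)
  then have 1: "Cf * R\<^sup>2 * max (real (Suc m)) \<rho> ^ m / ?F \<le> Cf * R\<^sup>2 * (max (real_of_int (l + 3)) \<rho>) powi l / ?F"
    using Cf by (intro divide_right_mono mult_left_mono) (auto simp: lm)
  have "fact (Suc m) \<le> (real m + 3) * ?F"
    by (cases "m = 0") (auto simp: F max_def not_le intro: mult_right_mono)
  then have "fact (Suc m) / ?F \<le> real m + 3" by (simp add: pos_divide_le_eq del: fact_Suc)
  then have "fact (Suc m) / ?F * (R * U) \<le> (real m + 3) * (R * U)"
    using R U by (intro mult_right_mono) auto
  then have 2: "fact (Suc m) / ?F * (R * U) \<le> real_of_int (l + 3) * R * U" by (simp add: lm mult_ac del: fact_Suc)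
  have "R * maj n / ?F = Cf * R\<^sup>2 * max (real (Suc m)) \<rho> ^ m / ?F + fact (Suc m) / ?F * (R * U)"
    by (simp add: maj_def Suc power2_eq_square add_divide_distrib distrib_left mult_ac del: fact_Suc)
  then show ?thesis using 1 2 by linarith
qed

lemma Nprime_bound:
  assumes K1: "1 \<le> K1" "2 * \<gamma> \<le> K1" "\<gamma>f \<le> K1" "cacc lam C * (54 * C * \<gamma> + 7) \<le> K1" "54 * C * \<gamma> \<le> lam * K1"
    and K2: "K1 \<le> K2" "3 \<le> lam * K2" "27 * C * K1 \<le> lam * K2"
    and q: "q \<ge> -2" "(p, q) \<noteq> (0, -2)"
  shows "Nprime R p q u \<le> ennreal ((2 * K1) ^ (p + 2) * K2 ^ nat (q + 2) *
    (Cf * R\<^sup>2 * (max (real_of_int (int p + q + 3)) \<rho>) powi (int p + q) / fact (brk (int p + q))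
      + real_of_int (int p + q + 3) * R * U))"
proof -
  define k where "k = nat (q + 2)"
  \<comment> \<open>The excluded pair is precisely the one with \<open>p + k = 0\<close>, so the
    subtraction is never truncated.\<close>
  define n where "n = p + k - 1"
  have qk: "q = int k - 2" using q by (simp add: k_def)
  have pk: "p + k = Suc n" using q qk by (cases "p + k = 0") (auto simp: n_def)
  have l: "int p + q = int n - 1" using pk qk by linarith
  \<comment> \<open>The weight in \<open>Nprime\<close> has one power of \<open>R - r\<close> more
    than \<open>derivative_bound\<close> consumes; the spare factor is estimated by
    \<open>R\<close>.\<close>
  have e: "nat (int p + q + 2) = Suc n" using l by simp
  define b where "b = K1 ^ p * K2 ^ k * maj n"
  have b: "0 \<le> b" using K1 K2 maj_nonneg by (auto simp: b_def)
  have sup: "ennreal ((R - r) ^ Suc n) * L2norm (half_ball r) (tan_grad_norm k p u) \<le> ennreal (R * (2 ^ p * b))"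
    if r: "r \<in> {R/2..<R}" for r
  proof -
    have r0: "0 < r" "r < R" using r R by auto
    have "L2norm (half_ball r) (tan_grad_norm k p u) \<le> ennreal (2 ^ p * (b / (R - r) ^ n))"
    proof (rule L2norm_tan_grad_norm_le[OF open_half_ball bounded_half_ball adm_u[OF r0(2)]])
      fix \<alpha> :: "3 \<Rightarrow> nat" assume \<alpha>: "\<alpha> 3 = 0" "mi_abs \<alpha> = p"
      then have s: "\<alpha> 1 + \<alpha> 2 = p" by (simp add: mi_abs_def sum_3)
      let ?ds = "mi_list (\<alpha>(3 := k))"
      have "length ?ds = Suc n" using s pk by (simp add: length_mi_list)
      then have "(R - r) ^ n * l2 (half_ball r) (pdiff ?ds u) \<le> wt K1 K2 ?ds * maj n"
        by (rule derivative_bound[OF K1 K2 r0])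
      then show "l2 (half_ball r) (Dmi (\<alpha>(3 := k)) u) \<le> b / (R - r) ^ n"
        using r0 s by (simp add: Dmi_def b_def wt_mi_list pos_le_divide_eq mult.commute)
    qed (use b r0 in simp)
    then have "ennreal ((R - r) ^ Suc n) * L2norm (half_ball r) (tan_grad_norm k p u)
        \<le> ennreal ((R - r) ^ Suc n) * ennreal (2 ^ p * (b / (R - r) ^ n))"
      by (intro mult_left_mono) auto
    also have "\<dots> = ennreal ((R - r) ^ Suc n * (2 ^ p * (b / (R - r) ^ n)))"
      using r0 b by (intro ennreal_mult[symmetric]) auto
    also have "(R - r) ^ Suc n * (2 ^ p * (b / (R - r) ^ n)) = (R - r) * (2 ^ p * b)"
      using r0 by simp
    also have "ennreal \<dots> \<le> ennreal (R * (2 ^ p * b))"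
      using r0 b by (intro ennreal_leI mult_right_mono) auto
    finally show ?thesis .
  qed
  let ?F = "fact (brk (int p + q)) :: real"
  let ?E = "Cf * R\<^sup>2 * (max (real_of_int (int p + q + 3)) \<rho>) powi (int p + q) / ?F + real_of_int (int p + q + 3) * R * U"
  have "Nprime R p q u \<le> ennreal (1 / ?F) * ennreal (R * (2 ^ p * b))"
    unfolding Nprime_def e k_def[symmetric] by (intro mult_left_mono SUP_least sup) auto
  also have "\<dots> = ennreal (1 / ?F * (R * (2 ^ p * b)))"
    using R b by (intro ennreal_mult[symmetric]) auto
  also have "1 / ?F * (R * (2 ^ p * b)) = (2 * K1) ^ p * K2 ^ k * (R * maj n / ?F)"
    by (simp add: b_def power_mult_distrib)
  also have "ennreal \<dots> \<le> ennreal ((2 * K1) ^ (p + 2) * K2 ^ k * ?E)"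
  proof (intro ennreal_leI mult_mono)
    show "(2 * K1) ^ p \<le> (2 * K1) ^ (p + 2)" using K1(1) by (intro power_increasing) auto
    show "R * maj n / ?F \<le> ?E" by (rule maj_le_bracket[OF l])
  qed (use K1 K2 R maj_nonneg in auto)
  finally show ?thesis by (simp only: k_def)
qed

end

section \<open>Choice of the constants\<close>

theorem theoremE2:
  fixes lam_min C_A \<gamma>A \<gamma>f :: real
  assumes "lam_min > 0"
  shows "\<exists>K1 K2 :: real. K1 \<ge> 1 \<and> K2 \<ge> 1 \<and>
    (\<forall>(R::real) (\<epsilon>::real) (A :: real^3 \<Rightarrow> real^3^3) (f :: real^3 \<Rightarrow> real)
       (u :: real^3 \<Rightarrow> real) (Cf::real).
      0 < R \<and> R \<le> 1 \<and> 0 \<le> Cf \<and> 0 < \<epsilon> \<and> \<epsilon> \<le> 1 \<and>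
      (\<forall>z\<in>half_ball R. transpose (A z) = A z) \<and>
      (\<forall>z\<in>half_ball R. \<forall>\<xi>::real^3. \<xi> \<bullet> (A z *v \<xi>) \<ge> lam_min * (norm \<xi>)\<^sup>2) \<and>
      Ainf C_A \<gamma>A (half_ball R) A \<and>
      (\<forall>p::nat. L2norm (half_ball R) (grad_norm p f)
          \<le> ennreal (Cf * \<gamma>f ^ p * (max (real p / R) (1 / \<epsilon>)) ^ p)) \<and>
      smooth_on (half_ball R) u \<and>
      continuous_on (half_ball R \<union> flat_bdry R) u \<and>
      (\<forall>ds. \<exists>g. continuous_on (half_ball R \<union> flat_bdry R) g \<and>
             (\<forall>z\<in>half_ball R. g z = pdiff ds u z)) \<and>
      L2norm (half_ball R) (grad_norm 1 u) < \<infinity> \<and>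
      (\<forall>z\<in>half_ball R.
         - (\<Sum>i\<in>UNIV. partial i (\<lambda>w. \<Sum>j\<in>UNIV. A w $ i $ j * partial j u w) z) = f z) \<and>
      (\<forall>z\<in>flat_bdry R. u z = 0)
      \<longrightarrow>
      (\<forall>(p::nat) (q::int). q \<ge> -2 \<and> (p, q) \<noteq> (0, -2) \<longrightarrow>
         Nprime R p q u \<le> ennreal (K1 ^ (p + 2) * K2 ^ nat (q + 2) *
           (Cf * R\<^sup>2 * (max (real_of_int (int p + q + 3)) (R / \<epsilon>)) powi (int p + q)
               / fact (brk (int p + q))
            + real_of_int (int p + q + 3) * R * enn2real (L2norm (half_ball R) (grad_norm 1 u))))))"
proof -
  \<comment> \<open>The given constants may have any sign; enlarging them preserves the bounds and
    meets the normalisation of the locale.\<close>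
  define C \<gamma> g where "C = \<bar>C_A\<bar>" and "\<gamma> = max 1 \<bar>\<gamma>A\<bar>" and "g = max 1 \<bar>\<gamma>f\<bar>"
  define a where "a = cacc lam_min C * (54 * C * \<gamma> + 7)"
  \<comment> \<open>Both constants are sums of nonnegative terms, one for each lower bound required
    by \<open>Nprime_bound\<close>, and they are fixed before \<open>R\<close>,
    \<open>\<epsilon>\<close> and the functions are introduced.\<close>
  define K1 where "K1 = 1 + 2 * \<gamma> + g + a + 54 * C * \<gamma> / lam_min"
  define K2 where "K2 = K1 + 3 / lam_min + 27 * C * K1 / lam_min"
  have pos: "0 \<le> C" "1 \<le> \<gamma>" "1 \<le> g" by (auto simp: C_def \<gamma>_def g_def)
  then have terms: "0 \<le> a" "0 \<le> 54 * C * \<gamma> / lam_min"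
    using assms by (auto simp: a_def cacc_def)
  then have K1: "1 \<le> K1" "2 * \<gamma> \<le> K1" "g \<le> K1" "a \<le> K1" "54 * C * \<gamma> / lam_min \<le> K1"
    using pos by (auto simp: K1_def)
  then have terms2: "0 \<le> 3 / lam_min" "0 \<le> 27 * C * K1 / lam_min" using assms pos by auto
  then have K2: "K1 \<le> K2" "3 / lam_min \<le> K2" "27 * C * K1 / lam_min \<le> K2"
    using K1(1) by (auto simp: K2_def)
  show ?thesis
  proof (rule exI[of _ "2 * K1"], rule exI[of _ K2], intro conjI allI impI; (elim conjE)?)
    show "2 * K1 \<ge> 1" "K2 \<ge> 1" using K1 K2 by auto
    fix R \<epsilon> Cf :: real and A :: "real^3 \<Rightarrow> real^3^3" and f u :: "real^3 \<Rightarrow> real" and p :: nat and q :: int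
    assume R: "0 < R" "R \<le> 1" and Cf: "0 \<le> Cf" and \<epsilon>: "0 < \<epsilon>"
      and coer: "\<forall>z\<in>half_ball R. \<forall>\<xi>::real^3. \<xi> \<bullet> (A z *v \<xi>) \<ge> lam_min * (norm \<xi>)\<^sup>2"
      and A: "Ainf C_A \<gamma>A (half_ball R) A"
      and f: "\<forall>p::nat. L2norm (half_ball R) (grad_norm p f)
          \<le> ennreal (Cf * \<gamma>f ^ p * (max (real p / R) (1 / \<epsilon>)) ^ p)"
      and u: "smooth_on (half_ball R) u" "continuous_on (half_ball R \<union> flat_bdry R) u"
        "\<forall>ds. \<exists>g. continuous_on (half_ball R \<union> flat_bdry R) g \<and> (\<forall>z\<in>half_ball R. g z = pdiff ds u z)"
        "L2norm (half_ball R) (grad_norm 1 u) < \<infinity>"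
      and pde: "\<forall>z\<in>half_ball R.
         - (\<Sum>i\<in>UNIV. partial i (\<lambda>w. \<Sum>j\<in>UNIV. A w $ i $ j * partial j u w) z) = f z"
      and flat: "\<forall>z\<in>flat_bdry R. u z = 0"
      and q: "q \<ge> -2" "(p, q) \<noteq> (0, -2)"
    define U where "U = enn2real (L2norm (half_ball R) (grad_norm 1 u))"
    interpret elliptic_problem R lam_min C \<gamma> g Cf "R / \<epsilon>" U A f u
    proof
      show "mgrad_norm n A z \<le> C * \<gamma> ^ n * fact n" if "z \<in> half_ball R" for n z
      proof -
        have "C_A * \<gamma>A ^ n * fact n \<le> \<bar>C_A * \<gamma>A ^ n\<bar> * fact n" by (intro mult_right_mono) auto
        also have "\<dots> = C * \<bar>\<gamma>A\<bar> ^ n * fact n" by (simp add: abs_mult power_abs C_def)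
        also have "\<dots> \<le> C * \<gamma> ^ n * fact n"
          using pos by (intro mult_right_mono mult_left_mono power_mono) (auto simp: \<gamma>_def)
        finally show ?thesis using A that unfolding Ainf_def by (meson order_trans)
      qed
      show "L2norm (half_ball R) (grad_norm n f) \<le> ennreal (Cf * g ^ n * (max (real n) (R / \<epsilon>) / R) ^ n)" for n
      proof -
        \<comment> \<open>Pulling out \<open>R\<close> turns the hypothesis on \<open>f\<close> into
          the form of the locale with \<open>\<rho>\<close> equal to
          \<open>R / \<epsilon>\<close>.\<close>
        have m: "max (real n / R) (1 / \<epsilon>) = max (real n) (R / \<epsilon>) / R"
          using R \<epsilon> by (simp add: max_def field_simps)
        have "Cf * \<gamma>f ^ n \<le> Cf * g ^ n"
        proof (rule mult_left_mono[OF _ Cf])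
          have "\<gamma>f ^ n \<le> \<bar>\<gamma>f\<bar> ^ n" by (simp add: power_abs[symmetric])
          also have "\<dots> \<le> g ^ n" by (intro power_mono) (auto simp: g_def)
          finally show "\<gamma>f ^ n \<le> g ^ n" .
        qed
        then have "Cf * \<gamma>f ^ n * (max (real n / R) (1 / \<epsilon>)) ^ n \<le> Cf * g ^ n * (max (real n) (R / \<epsilon>) / R) ^ n"
          unfolding m using R by (intro mult_right_mono) auto
        then show ?thesis using f by (meson ennreal_leI order_trans)
      qed
      show "L2norm (half_ball R) (grad_norm 1 u) \<le> ennreal U"
        unfolding U_def using u(4) by (simp add: ennreal_enn2real)
    qed (use R Cf \<epsilon> assms pos u coer A pde flat in \<open>auto simp: Ainf_def U_def\<close>)
    have "54 * C * \<gamma> \<le> lam_min * K1" "3 \<le> lam_min * K2" "27 * C * K1 \<le> lam_min * K2"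
      using K1(5) K2(2,3) assms by (simp_all add: field_simps)
    then show "Nprime R p q u \<le> ennreal ((2 * K1) ^ (p + 2) * K2 ^ nat (q + 2) *
           (Cf * R\<^sup>2 * (max (real_of_int (int p + q + 3)) (R / \<epsilon>)) powi (int p + q)
               / fact (brk (int p + q))
            + real_of_int (int p + q + 3) * R * enn2real (L2norm (half_ball R) (grad_norm 1 u))))"
      unfolding U_def[symmetric] using K1 K2 q by (intro Nprime_bound) (auto simp: a_def)
  qed
qed

end
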